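(* Every group object in the opposite $\mathbf{Mon}^{\rm op}$ of the category of monoids is of the following form: an abelian group $G$ with comultiplication $G \to G \oplus G$, $g \mapsto (g,g)$, and coinverse $g \mapsto -g$. Consequently the functor $\mathbb{G} : A \mapsto \operatorname{Spec} A$ is an equivalence of categories from the opposite of the category of abelian groups to the category of affine group fans. In fact, any connected group fan is isomorphic (as a group fan) to $\mathbb{G}(G)$ for some abelian group $G$.
   Context: Monoids are commutative, written additively, with $0$. $P^*$ is the group of units of $P$. A monoid map $h : Q \to P$ is local if $h^{-1}(P^* ) = Q^*$. The coproduct of monoids is $\oplus$. A locally monoidal space is a topological space $X$ with a sheaf of monoids $\mathcal{M}_X$; a morphism $f : X \to Y$ is a continuous map together with a map $f^{-1}\mathcal{M}_Y \to \mathcal{M}_X$ whose stalks $f_x : \mathcal{M}_{Y,f(x)} \to \mathcal{M}_{X,x}$ are all local. A face of $P$ is a submonoid $F$ such that $p+p' \in F$ implies $p,p' \in F$. $\operatorname{Spec} P$ is the set of faces of $P$, with the topology having basis $U_p = \{F : p \in F\}$ ($p \in P$), and with the structure sheaf $\mathcal{M}_P$ determined by $\mathcal{M}_P(U_p) = P[-p]$ (localization making $p$ invertible); its stalk at $F$ is $F^{-1}P$. A fan is a locally monoidal space locally isomorphic to $\operatorname{Spec} P$ for monoids $P$; it is affine if it is isomorphic to some $\operatorname{Spec} P$. Maps of fans are morphisms of locally monoidal spaces. The category of fans has finite products, and $\operatorname{Spec} : \mathbf{Mon}^{\rm op} \to \mathbf{Fans}$ preserves inverse limits. A group fan is a group object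 in the category of fans; it is affine (resp. connected) if its underlying fan is affine (resp. its underlying topological space is connected). For an abelian group $A$, the comultiplication $a \mapsto (a,a)$ and coinverse $a \mapsto -a$ make $A$ an abelian group object in $\mathbf{Mon}^{\rm op}$, and $\mathbb{G}(A)$ denotes the resulting group fan with underlying fan $\operatorname{Spec} A$. *)

theory Defs
  imports "HOL-Algebra.Group" "HOL-Analysis.Product_Topology"
begin

section \<open>Categories\<close>

text \<open>A category whose objects and arrows live in fixed types. Composition and identities carry
  their objects as arguments because arrows are plain (extensional) functions, which do not
  remember their codomain.\<close>

record ('o, 'f) category =
  Ob :: "'o set"
  Hom :: "'o \<Rightarrow> 'o \<Rightarrow> 'f set"
  Comp :: "'o \<Rightarrow> 'o \<Rightarrow> 'o \<Rightarrow> 'f \<Rightarrow> 'f \<Rightarrow> 'f"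
  Id :: "'o \<Rightarrow> 'f"

definition is_category :: "('o, 'f) category \<Rightarrow> bool" where
  "is_category C \<longleftrightarrow>
     (\<forall>X\<in>Ob C. Id C X \<in> Hom C X X) \<and>
     (\<forall>X\<in>Ob C. \<forall>Y\<in>Ob C. \<forall>Z\<in>Ob C. \<forall>f\<in>Hom C X Y. \<forall>g\<in>Hom C Y Z.
        Comp C X Y Z g f \<in> Hom C X Z) \<and>
     (\<forall>X\<in>Ob C. \<forall>Y\<in>Ob C. \<forall>f\<in>Hom C X Y.
        Comp C X Y Y (Id C Y) f = f \<and> Comp C X X Y f (Id C X) = f) \<and>
     (\<forall>W\<in>Ob C. \<forall>X\<in>Ob C. \<forall>Y\<in>Ob C. \<forall>Z\<in>Ob C. \<forall>f\<in>Hom C W X. \<forall>g\<in>Hom C X Y. \<forall>h\<in>Hom C Y Z.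
        Comp C W X Z (Comp C X Y Z h g) f = Comp C W Y Z h (Comp C W X Y g f))"

definition opposite :: "('o, 'f) category \<Rightarrow> ('o, 'f) category" where
  "opposite C = \<lparr>Ob = Ob C, Hom = (\<lambda>X Y. Hom C Y X),
     Comp = (\<lambda>X Y Z g f. Comp C Z Y X f g), Id = Id C\<rparr>"

definition is_iso :: "('o, 'f) category \<Rightarrow> 'o \<Rightarrow> 'o \<Rightarrow> 'f \<Rightarrow> bool" where
  "is_iso C X Y f \<longleftrightarrow> f \<in> Hom C X Y \<and>
     (\<exists>g\<in>Hom C Y X. Comp C X Y X g f = Id C X \<and> Comp C Y X Y f g = Id C Y)"

record ('o, 'f, 'p, 'g) cat_functor =
  FOb :: "'o \<Rightarrow> 'p"
  FArr :: "'o \<Rightarrow> 'o \<Rightarrow> 'f \<Rightarrow> 'g"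

definition is_functor ::
    "('o, 'f) category \<Rightarrow> ('p, 'g) category \<Rightarrow> ('o, 'f, 'p, 'g) cat_functor \<Rightarrow> bool" where
  "is_functor C D F \<longleftrightarrow> is_category C \<and> is_category D \<and>
     (\<forall>X\<in>Ob C. FOb F X \<in> Ob D) \<and>
     (\<forall>X\<in>Ob C. \<forall>Y\<in>Ob C. \<forall>f\<in>Hom C X Y. FArr F X Y f \<in> Hom D (FOb F X) (FOb F Y)) \<and>
     (\<forall>X\<in>Ob C. FArr F X X (Id C X) = Id D (FOb F X)) \<and>
     (\<forall>X\<in>Ob C. \<forall>Y\<in>Ob C. \<forall>Z\<in>Ob C. \<forall>f\<in>Hom C X Y. \<forall>g\<in>Hom C Y Z.
        FArr F X Z (Comp C X Y Z g f) =
        Comp D (FOb F X) (FOb F Y) (FOb F Z) (FArr F Y Z g) (FArr F X Y f))"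

definition id_functor :: "('o, 'f, 'o, 'f) cat_functor" where
  "id_functor = \<lparr>FOb = (\<lambda>X. X), FArr = (\<lambda>X Y f. f)\<rparr>"

definition comp_functor ::
    "('p, 'g, 'q, 'h) cat_functor \<Rightarrow> ('o, 'f, 'p, 'g) cat_functor \<Rightarrow> ('o, 'f, 'q, 'h) cat_functor"
  where
  "comp_functor G F = \<lparr>FOb = (\<lambda>X. FOb G (FOb F X)),
     FArr = (\<lambda>X Y f. FArr G (FOb F X) (FOb F Y) (FArr F X Y f))\<rparr>"

definition naturally_isomorphic ::
    "('o, 'f) category \<Rightarrow> ('p, 'g) category \<Rightarrow>
     ('o, 'f, 'p, 'g) cat_functor \<Rightarrow> ('o, 'f, 'p, 'g) cat_functor \<Rightarrow> bool" where
  "naturally_isomorphic C D F G \<longleftrightarrow> is_functor C D F \<and> is_functor C D G \<and>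
     (\<exists>\<eta>. (\<forall>X\<in>Ob C. is_iso D (FOb F X) (FOb G X) (\<eta> X)) \<and>
        (\<forall>X\<in>Ob C. \<forall>Y\<in>Ob C. \<forall>f\<in>Hom C X Y.
           Comp D (FOb F X) (FOb F Y) (FOb G Y) (\<eta> Y) (FArr F X Y f) =
           Comp D (FOb F X) (FOb G X) (FOb G Y) (FArr G X Y f) (\<eta> X)))"

definition is_equivalence ::
    "('o, 'f) category \<Rightarrow> ('p, 'g) category \<Rightarrow> ('o, 'f, 'p, 'g) cat_functor \<Rightarrow> bool" where
  "is_equivalence C D F \<longleftrightarrow> is_functor C D F \<and>
     (\<exists>G. is_functor D C G \<and>
        naturally_isomorphic C C (comp_functor G F) id_functor \<and>
        naturally_isomorphic D D (comp_functor F G) id_functor)"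


section \<open>Monoids\<close>

text \<open>Monoids are written multiplicatively, as in HOL-Algebra. Homomorphisms are taken to be
  extensional, so that equality of functions is equality of maps; note that \<^const>\<open>hom\<close> alone does
  not require preservation of the unit. The coproduct of two commutative monoids is
  \<^const>\<open>DirProd\<close>.\<close>

definition mon_hom :: "'a monoid \<Rightarrow> 'b monoid \<Rightarrow> ('a \<Rightarrow> 'b) set" where
  "mon_hom P Q = {h \<in> hom P Q. h \<in> extensional (carrier P) \<and> h \<one>\<^bsub>P\<^esub> = \<one>\<^bsub>Q\<^esub>}"

definition local_hom :: "'a monoid \<Rightarrow> 'b monoid \<Rightarrow> ('a \<Rightarrow> 'b) \<Rightarrow> bool" where
  "local_hom Q P h \<longleftrightarrow> {q \<in> carrier Q. h q \<in> Units P} = Units Q"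

definition mon_id :: "'a monoid \<Rightarrow> 'a \<Rightarrow> 'a" where
  "mon_id P = (\<lambda>p\<in>carrier P. p)"

definition trivial_monoid :: "unit monoid" where
  "trivial_monoid = \<lparr>carrier = UNIV, mult = (\<lambda>_ _. ()), one = ()\<rparr>"

definition from_trivial :: "'a monoid \<Rightarrow> unit \<Rightarrow> 'a" where
  "from_trivial P = (\<lambda>_. \<one>\<^bsub>P\<^esub>)"

definition inc_l :: "'a monoid \<Rightarrow> 'b monoid \<Rightarrow> 'a \<Rightarrow> 'a \<times> 'b" where
  "inc_l P Q = (\<lambda>p\<in>carrier P. (p, \<one>\<^bsub>Q\<^esub>))"

definition inc_r :: "'a monoid \<Rightarrow> 'b monoid \<Rightarrow> 'b \<Rightarrow> 'a \<times> 'b" where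
  "inc_r P Q = (\<lambda>q\<in>carrier Q. (\<one>\<^bsub>P\<^esub>, q))"

definition copair ::
    "'a monoid \<Rightarrow> 'b monoid \<Rightarrow> 'c monoid \<Rightarrow> ('a \<Rightarrow> 'c) \<Rightarrow> ('b \<Rightarrow> 'c) \<Rightarrow> 'a \<times> 'b \<Rightarrow> 'c" where
  "copair P Q R h k = (\<lambda>(p, q)\<in>carrier (P \<times>\<times> Q). h p \<otimes>\<^bsub>R\<^esub> k q)"

text \<open>A group object in the opposite of the category of commutative monoids: the usual diagrams for
  multiplication, unit and inverse, with all arrows reversed. The conditions are, in order,
  coassociativity, the two counit laws and the two coinverse laws.\<close>

definition mon_op_group_object ::
    "'a monoid \<Rightarrow> ('a \<Rightarrow> 'a \<times> 'a) \<Rightarrow> ('a \<Rightarrow> unit) \<Rightarrow> ('a \<Rightarrow> 'a) \<Rightarrow> bool" where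
  "mon_op_group_object P \<delta> \<epsilon> \<iota> \<longleftrightarrow>
     comm_monoid P \<and> \<delta> \<in> mon_hom P (P \<times>\<times> P) \<and> \<epsilon> \<in> mon_hom P trivial_monoid \<and> \<iota> \<in> mon_hom P P \<and>
     (let PP = P \<times>\<times> P; PPP = PP \<times>\<times> P;
          j1 = compose (carrier P) (inc_l PP P) (inc_l P P);
          j2 = compose (carrier P) (inc_l PP P) (inc_r P P);
          j3 = inc_r PP P;
          u = compose (carrier P) (from_trivial P) \<epsilon>
      in compose (carrier P) (copair P P PPP (compose (carrier P) (inc_l PP P) \<delta>) j3) \<delta> =
           compose (carrier P)
             (copair P P PPP j1 (compose (carrier P) (copair P P PPP j2 j3) \<delta>)) \<delta> \<and>
         compose (carrier P) (copair P P P u (mon_id P)) \<delta> = mon_id P \<and>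
         compose (carrier P) (copair P P P (mon_id P) u) \<delta> = mon_id P \<and>
         compose (carrier P) (copair P P P \<iota> (mon_id P)) \<delta> = u \<and>
         compose (carrier P) (copair P P P (mon_id P) \<iota>) \<delta> = u)"

definition Ab :: "('a monoid, 'a \<Rightarrow> 'a) category" where
  "Ab = \<lparr>Ob = {A. comm_group A}, Hom = (\<lambda>A B. hom A B \<inter> extensional (carrier A)),
     Comp = (\<lambda>A B C g f. compose (carrier A) g f), Id = mon_id\<rparr>"


section \<open>Locally monoidal spaces\<close>

text \<open>A sheaf of monoids is represented by its stalks and by its sections, a section over \<open>U\<close> being
  identified with the family of its germs at the points of \<open>U\<close>. Thus \<open>sect X U\<close> is the monoid of
  sections over an open set \<open>U\<close> (with pointwise operations), restriction maps are restrictions of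
  functions, and compatible local sections are the same as one function that is locally a section.
  Every sheaf is canonically isomorphic to one of this kind, the sheaf of sections of its espace
  etale. Values of \<open>sect X\<close> at sets that are not open are irrelevant.\<close>

record ('x, 'm) lmspace =
  space_of :: "'x topology"
  stalk :: "'x \<Rightarrow> 'm monoid"
  sect :: "'x set \<Rightarrow> ('x \<Rightarrow> 'm) set"

abbreviation points :: "('x, 'm) lmspace \<Rightarrow> 'x set" where
  "points X \<equiv> topspace (space_of X)"

definition locally_monoidal :: "('x, 'm) lmspace \<Rightarrow> bool" where
  "locally_monoidal X \<longleftrightarrow>
     (\<forall>x\<in>points X. comm_monoid (stalk X x)) \<and>
     (\<forall>U. openin (space_of X) U \<longrightarrow>
        sect X U \<subseteq> (\<Pi>\<^sub>E x\<in>U. carrier (stalk X x)) \<and>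
        (\<lambda>x\<in>U. \<one>\<^bsub>stalk X x\<^esub>) \<in> sect X U \<and>
        (\<forall>s\<in>sect X U. \<forall>t\<in>sect X U. (\<lambda>x\<in>U. s x \<otimes>\<^bsub>stalk X x\<^esub> t x) \<in> sect X U) \<and>
        (\<forall>s\<in>sect X U. \<forall>V. openin (space_of X) V \<and> V \<subseteq> U \<longrightarrow> restrict s V \<in> sect X V) \<and>
        (\<forall>s\<in>\<Pi>\<^sub>E x\<in>U. carrier (stalk X x).
           (\<forall>x\<in>U. \<exists>V. openin (space_of X) V \<and> x \<in> V \<and> V \<subseteq> U \<and> restrict s V \<in> sect X V)
           \<longrightarrow> s \<in> sect X U) \<and>
        (\<forall>s\<in>sect X U. \<forall>t\<in>sect X U. \<forall>x\<in>U. s x = t x \<longrightarrow>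
           (\<exists>V. openin (space_of X) V \<and> x \<in> V \<and> V \<subseteq> U \<and> restrict s V = restrict t V))) \<and>
     (\<forall>x\<in>points X. \<forall>a\<in>carrier (stalk X x).
        \<exists>U. openin (space_of X) U \<and> x \<in> U \<and> (\<exists>s\<in>sect X U. s x = a))"

text \<open>A morphism consists of a continuous map \<open>f\<close> on points and a map of sheaves from the inverse
  image of the target sheaf. In terms of stalks the latter is a family of local homomorphisms from
  the stalk at \<open>f x\<close> to the stalk at \<open>x\<close> that carries sections to sections.\<close>

record ('x, 'm, 'y, 'n) lmmap =
  pt :: "'x \<Rightarrow> 'y"
  st :: "'x \<Rightarrow> 'n \<Rightarrow> 'm"

definition lm_hom :: "('x, 'm) lmspace \<Rightarrow> ('y, 'n) lmspace \<Rightarrow> ('x, 'm, 'y, 'n) lmmap set" where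
  "lm_hom X Y = {f.
     continuous_map (space_of X) (space_of Y) (pt f) \<and>
     pt f \<in> extensional (points X) \<and> st f \<in> extensional (points X) \<and>
     (\<forall>x\<in>points X. st f x \<in> mon_hom (stalk Y (pt f x)) (stalk X x) \<and>
        local_hom (stalk Y (pt f x)) (stalk X x) (st f x)) \<and>
     (\<forall>V. openin (space_of Y) V \<longrightarrow> (\<forall>s\<in>sect Y V.
        (\<lambda>x\<in>{x\<in>points X. pt f x \<in> V}. st f x (s (pt f x))) \<in> sect X {x\<in>points X. pt f x \<in> V}))}"

definition lm_id :: "('x, 'm) lmspace \<Rightarrow> ('x, 'm, 'x, 'm) lmmap" where
  "lm_id X = \<lparr>pt = (\<lambda>x\<in>points X. x), st = (\<lambda>x\<in>points X. \<lambda>a\<in>carrier (stalk X x). a)\<rparr>"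

definition lm_comp :: "('x, 'm) lmspace \<Rightarrow> ('z, 'k) lmspace \<Rightarrow>
    ('y, 'n, 'z, 'k) lmmap \<Rightarrow> ('x, 'm, 'y, 'n) lmmap \<Rightarrow> ('x, 'm, 'z, 'k) lmmap" where
  "lm_comp X Z g f = \<lparr>pt = (\<lambda>x\<in>points X. pt g (pt f x)),
     st = (\<lambda>x\<in>points X. \<lambda>a\<in>carrier (stalk Z (pt g (pt f x))). st f x (st g (pt f x) a))\<rparr>"

definition lm_inverse :: "('x, 'm) lmspace \<Rightarrow> ('y, 'n) lmspace \<Rightarrow>
    ('x, 'm, 'y, 'n) lmmap \<Rightarrow> ('y, 'n, 'x, 'm) lmmap \<Rightarrow> bool" where
  "lm_inverse X Y f g \<longleftrightarrow> f \<in> lm_hom X Y \<and> g \<in> lm_hom Y X \<and>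
     lm_comp X X g f = lm_id X \<and> lm_comp Y Y f g = lm_id Y"

definition lm_isomorphic :: "('x, 'm) lmspace \<Rightarrow> ('y, 'n) lmspace \<Rightarrow> bool" where
  "lm_isomorphic X Y \<longleftrightarrow> (\<exists>f g. lm_inverse X Y f g)"

definition open_subspace :: "('x, 'm) lmspace \<Rightarrow> 'x set \<Rightarrow> ('x, 'm) lmspace" where
  "open_subspace X U = \<lparr>space_of = subtopology (space_of X) U, stalk = stalk X, sect = sect X\<rparr>"

subsection \<open>Finite products\<close>

text \<open>The structure sheaf of a product is the coproduct of the inverse images of the structure sheaves
  of the factors: its stalk at \<open>(x, y)\<close> is the coproduct of the stalks, and its sections are
  locally pairs of sections. The universal property is \<open>lm_pair_hom\<close>, \<open>lm_fst_pair\<close> and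
  \<open>lm_pair_unique\<close> below. (For the terminal object see \<open>lm_bang_unique\<close>.)\<close>

definition lm_prod :: "('x, 'm) lmspace \<Rightarrow> ('y, 'n) lmspace \<Rightarrow> ('x \<times> 'y, 'm \<times> 'n) lmspace" where
  "lm_prod X Y = \<lparr>space_of = prod_topology (space_of X) (space_of Y),
     stalk = (\<lambda>(x, y). stalk X x \<times>\<times> stalk Y y),
     sect = (\<lambda>W. {s \<in> \<Pi>\<^sub>E z\<in>W. carrier (stalk X (fst z) \<times>\<times> stalk Y (snd z)).
       \<forall>z\<in>W. \<exists>U V. openin (space_of X) U \<and> openin (space_of Y) V \<and> z \<in> U \<times> V \<and> U \<times> V \<subseteq> W \<and>
         (\<exists>a\<in>sect X U. \<exists>b\<in>sect Y V. \<forall>x\<in>U. \<forall>y\<in>V. s (x, y) = (a x, b y))})\<rparr>"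

definition lm_fst :: "('x, 'm) lmspace \<Rightarrow> ('y, 'n) lmspace \<Rightarrow> ('x \<times> 'y, 'm \<times> 'n, 'x, 'm) lmmap" where
  "lm_fst X Y = \<lparr>pt = restrict fst (points X \<times> points Y),
     st = (\<lambda>(x, y)\<in>points X \<times> points Y. inc_l (stalk X x) (stalk Y y))\<rparr>"

definition lm_snd :: "('x, 'm) lmspace \<Rightarrow> ('y, 'n) lmspace \<Rightarrow> ('x \<times> 'y, 'm \<times> 'n, 'y, 'n) lmmap" where
  "lm_snd X Y = \<lparr>pt = restrict snd (points X \<times> points Y),
     st = (\<lambda>(x, y)\<in>points X \<times> points Y. inc_r (stalk X x) (stalk Y y))\<rparr>"

definition lm_pair :: "('t, 'k) lmspace \<Rightarrow> ('x, 'm) lmspace \<Rightarrow> ('y, 'n) lmspace \<Rightarrow>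
    ('t, 'k, 'x, 'm) lmmap \<Rightarrow> ('t, 'k, 'y, 'n) lmmap \<Rightarrow> ('t, 'k, 'x \<times> 'y, 'm \<times> 'n) lmmap" where
  "lm_pair T X Y f g = \<lparr>pt = (\<lambda>t\<in>points T. (pt f t, pt g t)),
     st = (\<lambda>t\<in>points T. copair (stalk X (pt f t)) (stalk Y (pt g t)) (stalk T t) (st f t) (st g t))\<rparr>"

definition lm_times :: "('x, 'm) lmspace \<Rightarrow> ('x2, 'm2) lmspace \<Rightarrow>
    ('y, 'n) lmspace \<Rightarrow> ('y2, 'n2) lmspace \<Rightarrow> ('x, 'm, 'y, 'n) lmmap \<Rightarrow> ('x2, 'm2, 'y2, 'n2) lmmap \<Rightarrow>
    ('x \<times> 'x2, 'm \<times> 'm2, 'y \<times> 'y2, 'n \<times> 'n2) lmmap" where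
  "lm_times X X2 Y Y2 f g = lm_pair (lm_prod X X2) Y Y2
     (lm_comp (lm_prod X X2) Y f (lm_fst X X2)) (lm_comp (lm_prod X X2) Y2 g (lm_snd X X2))"


section \<open>Spectra and fans\<close>

definition faces :: "('a, 'b) monoid_scheme \<Rightarrow> 'a set set" where
  "faces P = {F. submonoid F P \<and>
     (\<forall>p\<in>carrier P. \<forall>q\<in>carrier P. p \<otimes>\<^bsub>P\<^esub> q \<in> F \<longrightarrow> p \<in> F \<and> q \<in> F)}"

definition loc_rel :: "('a, 'b) monoid_scheme \<Rightarrow> 'a set \<Rightarrow> (('a \<times> 'a) \<times> ('a \<times> 'a)) set" where
  "loc_rel P F = {((p, f), (q, g)). p \<in> carrier P \<and> q \<in> carrier P \<and> f \<in> F \<and> g \<in> F \<and>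
     (\<exists>h\<in>F. p \<otimes>\<^bsub>P\<^esub> g \<otimes>\<^bsub>P\<^esub> h = q \<otimes>\<^bsub>P\<^esub> f \<otimes>\<^bsub>P\<^esub> h)}"

definition loc_frac :: "('a, 'b) monoid_scheme \<Rightarrow> 'a set \<Rightarrow> 'a \<Rightarrow> 'a \<Rightarrow> ('a \<times> 'a) set" where
  "loc_frac P F p f = loc_rel P F `` {(p, f)}"

definition localization :: "('a, 'b) monoid_scheme \<Rightarrow> 'a set \<Rightarrow> ('a \<times> 'a) set monoid" where
  "localization P F = \<lparr>carrier = (carrier P \<times> F) // loc_rel P F,
     mult = (\<lambda>A B. \<Union>(p, f)\<in>A. \<Union>(q, g)\<in>B. loc_frac P F (p \<otimes>\<^bsub>P\<^esub> q) (f \<otimes>\<^bsub>P\<^esub> g)),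
     one = loc_frac P F \<one>\<^bsub>P\<^esub> \<one>\<^bsub>P\<^esub>\<rparr>"

definition spec_basic :: "('a, 'b) monoid_scheme \<Rightarrow> 'a \<Rightarrow> 'a set set" where
  "spec_basic P p = {F \<in> faces P. p \<in> F}"

text \<open>The sets \<open>spec_basic P p\<close> are closed under binary intersection, so they form a basis of the
  topology they generate. The sections of the structure sheaf are the functions that are locally
  given by a fraction; over \<open>spec_basic P p\<close> these are exactly the elements of the localization of
  \<open>P\<close> in which \<open>p\<close> becomes invertible (\<open>Spec_sect_basic\<close> below).\<close>

definition Spec :: "('a, 'b) monoid_scheme \<Rightarrow> ('a set, ('a \<times> 'a) set) lmspace" where
  "Spec P = \<lparr>space_of = topology_generated_by (spec_basic P ` carrier P),
     stalk = localization P,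
     sect = (\<lambda>U. {s \<in> \<Pi>\<^sub>E F\<in>U. carrier (localization P F).
       \<forall>F\<in>U. \<exists>V p f. openin (topology_generated_by (spec_basic P ` carrier P)) V \<and> F \<in> V \<and> V \<subseteq> U \<and>
         p \<in> carrier P \<and> (\<forall>G\<in>V. f \<in> G \<and> s G = loc_frac P G p f)})\<rparr>"

text \<open>The morphism from \<open>Spec P\<close> to \<open>Spec Q\<close> induced by a homomorphism \<open>h\<close> from \<open>Q\<close> to \<open>P\<close>.\<close>

definition Spec_map :: "'b monoid \<Rightarrow> 'a monoid \<Rightarrow> ('b \<Rightarrow> 'a) \<Rightarrow>
    ('a set, ('a \<times> 'a) set, 'b set, ('b \<times> 'b) set) lmmap" where
  "Spec_map Q P h = \<lparr>pt = (\<lambda>F\<in>faces P. {q \<in> carrier Q. h q \<in> F}),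
     st = (\<lambda>F\<in>faces P. \<lambda>A\<in>carrier (localization Q {q \<in> carrier Q. h q \<in> F}).
       \<Union>(q, g)\<in>A. loc_frac P F (h q) (h g))\<rparr>"

text \<open>It is no restriction to ask for a monoid \<open>P\<close> on the type of the stalks: the stalk of \<open>Spec P\<close>
  at the smallest face, the group of units, is isomorphic to \<open>P\<close>.\<close>

definition affine_fan :: "('x, 'm) lmspace \<Rightarrow> bool" where
  "affine_fan X \<longleftrightarrow> locally_monoidal X \<and> (\<exists>P :: 'm monoid. comm_monoid P \<and> lm_isomorphic X (Spec P))"

definition fan :: "('x, 'm) lmspace \<Rightarrow> bool" where
  "fan X \<longleftrightarrow> locally_monoidal X \<and>
     (\<forall>x\<in>points X. \<exists>U. openin (space_of X) U \<and> x \<in> U \<and> affine_fan (open_subspace X U))"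

text \<open>The terminal fan is the spectrum of the trivial monoid, whose only face is \<open>UNIV\<close>.\<close>

definition lm_one :: "(unit set, (unit \<times> unit) set) lmspace" where
  "lm_one = Spec trivial_monoid"

definition lm_bang :: "('x, 'm) lmspace \<Rightarrow> ('x, 'm, unit set, (unit \<times> unit) set) lmmap" where
  "lm_bang X = \<lparr>pt = (\<lambda>x\<in>points X. UNIV),
     st = (\<lambda>x\<in>points X. \<lambda>a\<in>carrier (stalk lm_one UNIV). \<one>\<^bsub>stalk X x\<^esub>)\<rparr>"


section \<open>Group fans\<close>

record ('x, 'm) gfan =
  ufan :: "('x, 'm) lmspace"
  gmult :: "('x \<times> 'x, 'm \<times> 'm, 'x, 'm) lmmap"
  gunit :: "(unit set, (unit \<times> unit) set, 'x, 'm) lmmap"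
  ginv :: "('x, 'm, 'x, 'm) lmmap"

definition group_fan :: "('x, 'm) gfan \<Rightarrow> bool" where
  "group_fan \<X> \<longleftrightarrow>
     (let X = ufan \<X>; m = gmult \<X>; XX = lm_prod X X; XXX = lm_prod XX X;
          q1 = lm_comp XXX X (lm_fst X X) (lm_fst XX X);
          q2 = lm_comp XXX X (lm_snd X X) (lm_fst XX X);
          q3 = lm_snd XX X;
          u = lm_comp X X (gunit \<X>) (lm_bang X)
      in fan X \<and> m \<in> lm_hom XX X \<and> gunit \<X> \<in> lm_hom lm_one X \<and> ginv \<X> \<in> lm_hom X X \<and>
         lm_comp XXX X m (lm_pair XXX X X (lm_comp XXX X m (lm_fst XX X)) q3) =
           lm_comp XXX X m (lm_pair XXX X X q1 (lm_comp XXX X m (lm_pair XXX X X q2 q3))) \<and>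
         lm_comp X X m (lm_pair X X X u (lm_id X)) = lm_id X \<and>
         lm_comp X X m (lm_pair X X X (lm_id X) u) = lm_id X \<and>
         lm_comp X X m (lm_pair X X X (ginv \<X>) (lm_id X)) = u \<and>
         lm_comp X X m (lm_pair X X X (lm_id X) (ginv \<X>)) = u)"

definition gfan_hom :: "('x, 'm) gfan \<Rightarrow> ('y, 'n) gfan \<Rightarrow> ('x, 'm, 'y, 'n) lmmap set" where
  "gfan_hom \<X> \<Y> = {f \<in> lm_hom (ufan \<X>) (ufan \<Y>).
     lm_comp (lm_prod (ufan \<X>) (ufan \<X>)) (ufan \<Y>) f (gmult \<X>) =
     lm_comp (lm_prod (ufan \<X>) (ufan \<X>)) (ufan \<Y>) (gmult \<Y>)
       (lm_times (ufan \<X>) (ufan \<X>) (ufan \<Y>) (ufan \<Y>) f f)}"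

definition gfan_isomorphic :: "('x, 'm) gfan \<Rightarrow> ('y, 'n) gfan \<Rightarrow> bool" where
  "gfan_isomorphic \<X> \<Y> \<longleftrightarrow>
     (\<exists>f\<in>gfan_hom \<X> \<Y>. \<exists>g\<in>gfan_hom \<Y> \<X>. lm_inverse (ufan \<X>) (ufan \<Y>) f g)"

text \<open>The canonical isomorphism from \<open>Spec P \<times> Spec Q\<close> to \<open>Spec (P \<times>\<times> Q)\<close>: the inverse of the
  morphism whose components are induced by the two inclusions of the coproduct. It exists by
  \<open>Spec_prod_iso_inverse\<close> below.\<close>

definition Spec_prod_iso :: "'a monoid \<Rightarrow> 'b monoid \<Rightarrow>
    ('a set \<times> 'b set, ('a \<times> 'a) set \<times> ('b \<times> 'b) set,
     ('a \<times> 'b) set, (('a \<times> 'b) \<times> ('a \<times> 'b)) set) lmmap" where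
  "Spec_prod_iso P Q = (THE g. lm_inverse (Spec (P \<times>\<times> Q)) (lm_prod (Spec P) (Spec Q))
     (lm_pair (Spec (P \<times>\<times> Q)) (Spec P) (Spec Q)
        (Spec_map P (P \<times>\<times> Q) (inc_l P Q)) (Spec_map Q (P \<times>\<times> Q) (inc_r P Q))) g)"

definition GG :: "'a monoid \<Rightarrow> ('a set, ('a \<times> 'a) set) gfan" where
  "GG A = \<lparr>ufan = Spec A,
     gmult = lm_comp (lm_prod (Spec A) (Spec A)) (Spec A)
       (Spec_map A (A \<times>\<times> A) (\<lambda>a\<in>carrier A. (a, a))) (Spec_prod_iso A A),
     gunit = Spec_map A trivial_monoid (\<lambda>a\<in>carrier A. ()),
     ginv = Spec_map A A (\<lambda>a\<in>carrier A. inv\<^bsub>A\<^esub> a)\<rparr>"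

definition GG_functor :: "('a monoid, 'a \<Rightarrow> 'a, ('a set, ('a \<times> 'a) set) gfan,
    ('a set, ('a \<times> 'a) set, 'a set, ('a \<times> 'a) set) lmmap) cat_functor" where
  "GG_functor = \<lparr>FOb = GG, FArr = (\<lambda>A B h. Spec_map B A h)\<rparr>"

text \<open>The category of affine group fans relative to the universe \<open>'a\<close>: its objects are the group
  fans on the types that carry the spectra of monoids on \<open>'a\<close>, with underlying fan isomorphic to
  such a spectrum. (Without the bound on \<open>P\<close> there would be objects whose monoid is too large to
  live on \<open>'a\<close>.)\<close>

definition AffGrpFan :: "(('a set, ('a \<times> 'a) set) gfan,
    ('a set, ('a \<times> 'a) set, 'a set, ('a \<times> 'a) set) lmmap) category" where
  "AffGrpFan = \<lparr>Ob = {\<X>. group_fan \<X> \<and>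
       (\<exists>P :: 'a monoid. comm_monoid P \<and> lm_isomorphic (ufan \<X>) (Spec P))},
     Hom = gfan_hom,
     Comp = (\<lambda>\<X> \<Y> \<Z> g f. lm_comp (ufan \<X>) (ufan \<Z>) g f),
     Id = (\<lambda>\<X>. lm_id (ufan \<X>))\<rparr>"


section \<open>Properties of spectra and products\<close>

lemma facesD:
  assumes "F \<in> faces P"
  shows "F \<subseteq> carrier P" "\<one>\<^bsub>P\<^esub> \<in> F" "\<And>p q. p \<in> F \<Longrightarrow> q \<in> F \<Longrightarrow> p \<otimes>\<^bsub>P\<^esub> q \<in> F"
    "\<And>p q. p \<in> carrier P \<Longrightarrow> q \<in> carrier P \<Longrightarrow> p \<otimes>\<^bsub>P\<^esub> q \<in> F \<Longrightarrow> p \<in> F"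
    "\<And>p q. p \<in> carrier P \<Longrightarrow> q \<in> carrier P \<Longrightarrow> p \<otimes>\<^bsub>P\<^esub> q \<in> F \<Longrightarrow> q \<in> F"
  using assms unfolding faces_def submonoid_def by blast+

context comm_monoid
begin

lemma equiv_loc_rel:
  assumes F: "F \<in> faces G"
  shows "equiv (carrier G \<times> F) (loc_rel G F)"
proof (rule equivI)
  note FD = facesD[OF F]
  show "loc_rel G F \<subseteq> (carrier G \<times> F) \<times> carrier G \<times> F"
    unfolding loc_rel_def by auto
  show "refl_on (carrier G \<times> F) (loc_rel G F)"
    using FD(2) unfolding refl_on_def loc_rel_def by auto
  show "sym (loc_rel G F)"
  proof (rule symI)
    fix x y assume "(x, y) \<in> loc_rel G F"
    then obtain p f q g h where "x = (p, f)" "y = (q, g)" "p \<in> carrier G" "q \<in> carrier G"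
      "f \<in> F" "g \<in> F" "h \<in> F" "q \<otimes> f \<otimes> h = p \<otimes> g \<otimes> h"
      unfolding loc_rel_def by auto
    then show "(y, x) \<in> loc_rel G F" unfolding loc_rel_def by blast
  qed
  show "trans (loc_rel G F)"
  proof (rule transI)
    fix x y z assume "(x, y) \<in> loc_rel G F" "(y, z) \<in> loc_rel G F"
    then obtain p f q g r k h h' where xyz: "x = (p, f)" "y = (q, g)" "z = (r, k)"
      and c: "p \<in> carrier G" "q \<in> carrier G" "r \<in> carrier G" and
      fg: "f \<in> F" "g \<in> F" "k \<in> F" "h \<in> F" "h' \<in> F"
      and e1: "p \<otimes> g \<otimes> h = q \<otimes> f \<otimes> h" and e2: "q \<otimes> k \<otimes> h' = r \<otimes> g \<otimes> h'"
      unfolding loc_rel_def by auto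
    have cc: "f \<in> carrier G" "g \<in> carrier G" "k \<in> carrier G" "h \<in> carrier G" "h' \<in> carrier G"
      using fg FD(1) by auto
    have "p \<otimes> k \<otimes> (g \<otimes> h \<otimes> h') = (p \<otimes> g \<otimes> h) \<otimes> (k \<otimes> h')"
      using c cc by (simp add: m_ac)
    also have "\<dots> = (q \<otimes> k \<otimes> h') \<otimes> (f \<otimes> h)"
      unfolding e1 using c cc by (simp add: m_ac)
    also have "\<dots> = r \<otimes> f \<otimes> (g \<otimes> h \<otimes> h')"
      unfolding e2 using c cc by (simp add: m_ac)
    finally show "(x, z) \<in> loc_rel G F"
      unfolding loc_rel_def xyz using c fg FD(3) by (auto intro!: bexI[of _ "g \<otimes> h \<otimes> h'"])
  qed
qed

lemma frac_eq_iff: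
  assumes F: "F \<in> faces G" and "p \<in> carrier G" "q \<in> carrier G" "f \<in> F" "g \<in> F"
  shows "loc_frac G F p f = loc_frac G F q g \<longleftrightarrow> (\<exists>h\<in>F. p \<otimes> g \<otimes> h = q \<otimes> f \<otimes> h)"
proof -
  have "loc_frac G F p f = loc_frac G F q g \<longleftrightarrow> ((p, f), (q, g)) \<in> loc_rel G F"
    unfolding loc_frac_def by (rule eq_equiv_class_iff[OF equiv_loc_rel[OF F]]) (use assms in auto)
  then show ?thesis unfolding loc_rel_def using assms by auto
qed

lemma frac_in_carrier:
  assumes "p \<in> carrier G" "f \<in> F"
  shows "loc_frac G F p f \<in> carrier (localization G F)"
  using assms unfolding localization_def loc_frac_def by (auto intro: quotientI)

lemma localization_cases:
  assumes "A \<in> carrier (localization G F)"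
  obtains p f where "p \<in> carrier G" "f \<in> F" "A = loc_frac G F p f"
  using assms unfolding localization_def loc_frac_def by (auto elim: quotientE)

lemma UN_frac:
  assumes F: "F \<in> faces G" and "p \<in> carrier G" "f \<in> F"
    and "\<And>q g. q \<in> carrier G \<Longrightarrow> g \<in> F \<Longrightarrow> loc_frac G F q g = loc_frac G F p f \<Longrightarrow> \<phi> q g = \<phi> p f"
  shows "(\<Union>(q, g)\<in>loc_frac G F p f. \<phi> q g) = \<phi> p f"
proof -
  have m: "(q, g) \<in> loc_frac G F p f \<longleftrightarrow> q \<in> carrier G \<and> g \<in> F \<and> loc_frac G F q g = loc_frac G F p f" for q g
  proof -
    have "(q, g) \<in> loc_frac G F p f \<longleftrightarrow> ((p, f), (q, g)) \<in> loc_rel G F"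
      unfolding loc_frac_def by auto
    also have "\<dots> \<longleftrightarrow> q \<in> carrier G \<and> g \<in> F \<and> loc_frac G F q g = loc_frac G F p f"
      using equiv_class_eq_iff[OF equiv_loc_rel[OF F], of "(p, f)" "(q, g)"] assms(2,3)
      unfolding loc_frac_def by auto
    finally show ?thesis .
  qed
  have "(p, f) \<in> loc_frac G F p f" using assms m by auto
  moreover have "(case x of (q, g) \<Rightarrow> \<phi> q g) = \<phi> p f" if "x \<in> loc_frac G F p f" for x
    using that m assms(4) by (cases x) auto
  ultimately show ?thesis by blast
qed

lemma frac_mult:
  assumes F: "F \<in> faces G" and c: "p \<in> carrier G" "q \<in> carrier G" "f \<in> F" "g \<in> F"
  shows "loc_frac G F p f \<otimes>\<^bsub>localization G F\<^esub> loc_frac G F q g = loc_frac G F (p \<otimes> q) (f \<otimes> g)"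
proof -
  note FD = facesD[OF F]
  have k: "loc_frac G F (p' \<otimes> q') (f' \<otimes> g') = loc_frac G F (p1 \<otimes> q1) (f1 \<otimes> g1)"
    if pc: "p' \<in> carrier G" "q' \<in> carrier G" "f' \<in> F" "g' \<in> F"
      "p1 \<in> carrier G" "q1 \<in> carrier G" "f1 \<in> F" "g1 \<in> F"
      and e: "loc_frac G F p' f' = loc_frac G F p1 f1" "loc_frac G F q' g' = loc_frac G F q1 g1"
    for p' q' f' g' p1 q1 f1 g1
  proof -
    obtain h h' where hh: "h \<in> F" "h' \<in> F" and e1: "p' \<otimes> f1 \<otimes> h = p1 \<otimes> f' \<otimes> h"
      and e2: "q' \<otimes> g1 \<otimes> h' = q1 \<otimes> g' \<otimes> h'"
      using e pc frac_eq_iff[OF F] by metis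
    have cc: "f' \<in> carrier G" "g' \<in> carrier G" "f1 \<in> carrier G" "g1 \<in> carrier G" 
      "h \<in> carrier G" "h' \<in> carrier G"
      using pc hh FD(1) by auto
    have "(p' \<otimes> q') \<otimes> (f1 \<otimes> g1) \<otimes> (h \<otimes> h') = (p' \<otimes> f1 \<otimes> h) \<otimes> (q' \<otimes> g1 \<otimes> h')"
      using pc cc by (simp add: m_ac)
    also have "\<dots> = (p1 \<otimes> q1) \<otimes> (f' \<otimes> g') \<otimes> (h \<otimes> h')"
      unfolding e1 e2 using pc cc by (simp add: m_ac)
    finally show ?thesis
      using pc hh FD(3) by (subst frac_eq_iff[OF F]) (auto intro!: bexI[of _ "h \<otimes> h'"])
  qed
  have "(\<Union>(q', g')\<in>loc_frac G F q g. loc_frac G F (p' \<otimes> q') (f' \<otimes> g')) = loc_frac G F (p' \<otimes> q) (f' \<otimes> g)"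
    if "p' \<in> carrier G" "f' \<in> F" for p' f'
    by (rule UN_frac[OF F c(2,4)])
      (rule k[OF that(1) _ that(2) _ that(1) c(2) that(2) c(4) refl])
  then have inner: "(\<Union>(q', g')\<in>loc_frac G F q g. loc_frac G F (p' \<otimes> q') (f' \<otimes> g')) = loc_frac G F (p' \<otimes> q) (f' \<otimes> g)"
    if "p' \<in> carrier G" "f' \<in> F" for p' f' using that by blast
  moreover have "(\<Union>(p', f')\<in>loc_frac G F p f. (\<Union>(q', g')\<in>loc_frac G F q g. loc_frac G F (p' \<otimes> q') (f' \<otimes> g'))) =
     (\<Union>(q', g')\<in>loc_frac G F q g. loc_frac G F (p \<otimes> q') (f \<otimes> g'))"
  proof (rule UN_frac[OF F c(1,3)])
    fix p' f' assume a: "p' \<in> carrier G" "f' \<in> F" "loc_frac G F p' f' = loc_frac G F p f"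
    show "(\<Union>(q', g')\<in>loc_frac G F q g. loc_frac G F (p' \<otimes> q') (f' \<otimes> g')) =
      (\<Union>(q', g')\<in>loc_frac G F q g. loc_frac G F (p \<otimes> q') (f \<otimes> g'))"
      unfolding inner[OF a(1,2)] inner[OF c(1,3)]
      by (rule k[OF a(1) c(2) a(2) c(4) c(1) c(2) c(3) c(4) a(3) refl])
  qed
  ultimately show ?thesis using c unfolding localization_def by simp
qed

lemma localization_one: "\<one>\<^bsub>localization G F\<^esub> = loc_frac G F \<one> \<one>"
  by (simp add: localization_def)

lemma comm_monoid_localization:
  assumes F: "F \<in> faces G"
  shows "comm_monoid (localization G F)"
proof -
  note FD = facesD[OF F]
  note ss = subsetD[OF FD(1)]
  let ?L = "localization G F"
  show ?thesis
  proof (rule comm_monoidI)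
    show "\<one>\<^bsub>?L\<^esub> \<in> carrier ?L"
      unfolding localization_one by (rule frac_in_carrier[OF one_closed FD(2)])
  next
    fix A B assume "A \<in> carrier ?L" "B \<in> carrier ?L"
    then obtain p f q g where *: "p \<in> carrier G" "f \<in> F" "A = loc_frac G F p f"
      "q \<in> carrier G" "g \<in> F" "B = loc_frac G F q g" by (metis localization_cases)
    show "A \<otimes>\<^bsub>?L\<^esub> B \<in> carrier ?L"
      unfolding *(3,6) frac_mult[OF F *(1,4,2,5)] by (rule frac_in_carrier) (use * FD(3) in auto)
    show "A \<otimes>\<^bsub>?L\<^esub> B = B \<otimes>\<^bsub>?L\<^esub> A"
      unfolding *(3,6) frac_mult[OF F *(1,4,2,5)] frac_mult[OF F *(4,1,5,2)]
      using m_comm[of p q] m_comm[of f g] * ss by simp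
  next
    fix A assume "A \<in> carrier ?L"
    then obtain p f where *: "p \<in> carrier G" "f \<in> F" "A = loc_frac G F p f"
      by (metis localization_cases)
    show "\<one>\<^bsub>?L\<^esub> \<otimes>\<^bsub>?L\<^esub> A = A"
      unfolding localization_one *(3) frac_mult[OF F one_closed *(1) FD(2) *(2)] using * ss by simp
  next
    fix A B C assume "A \<in> carrier ?L" "B \<in> carrier ?L" "C \<in> carrier ?L"
    then obtain p f q g r h where *: "p \<in> carrier G" "f \<in> F" "A = loc_frac G F p f"
      "q \<in> carrier G" "g \<in> F" "B = loc_frac G F q g" "r \<in> carrier G" "h \<in> F" "C = loc_frac G F r h"
      by (metis localization_cases)
    have c: "p \<otimes> q \<in> carrier G" "q \<otimes> r \<in> carrier G" "f \<otimes> g \<in> F" "g \<otimes> h \<in> F" using * FD(3) by auto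
    show "A \<otimes>\<^bsub>?L\<^esub> B \<otimes>\<^bsub>?L\<^esub> C = A \<otimes>\<^bsub>?L\<^esub> (B \<otimes>\<^bsub>?L\<^esub> C)"
      unfolding *(3,6,9) frac_mult[OF F *(1,4,2,5)] frac_mult[OF F *(4,7,5,8)]
        frac_mult[OF F c(1) *(7) c(3) *(8)] frac_mult[OF F *(1) c(2) *(2) c(4)]
      using * ss by (simp add: m_assoc)
  qed
qed

lemma frac_self:
  assumes F: "F \<in> faces G" and "f \<in> F" shows "loc_frac G F f f = \<one>\<^bsub>localization G F\<^esub>"
proof -
  have f: "f \<in> carrier G" using facesD(1)[OF F] assms by blast
  show ?thesis unfolding localization_one frac_eq_iff[OF F f one_closed assms(2) facesD(2)[OF F]]
    using f facesD(2)[OF F] by (auto intro!: bexI[of _ "\<one>"])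
qed

lemma frac_Units:
  assumes F: "F \<in> faces G" and p: "p \<in> carrier G" "f \<in> F"
  shows "loc_frac G F p f \<in> Units (localization G F) \<longleftrightarrow> p \<in> F"
proof
  note FD = facesD[OF F]
  note ss = subsetD[OF FD(1)]
  assume "p \<in> F"
  then have "loc_frac G F p f \<otimes>\<^bsub>localization G F\<^esub> loc_frac G F f p = \<one>\<^bsub>localization G F\<^esub>"
    "loc_frac G F f p \<otimes>\<^bsub>localization G F\<^esub> loc_frac G F p f = \<one>\<^bsub>localization G F\<^esub>"
    using p FD(3) ss by (simp_all add: frac_mult[OF F] frac_self[OF F] m_comm)
  then show "loc_frac G F p f \<in> Units (localization G F)"
    unfolding Units_def using p \<open>p \<in> F\<close> ss by (auto intro!: frac_in_carrier bexI[of _ "loc_frac G F f p"])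
next
  note FD = facesD[OF F]
  note ss = subsetD[OF FD(1)]
  assume "loc_frac G F p f \<in> Units (localization G F)"
  then obtain B where B: "B \<in> carrier (localization G F)"
     "loc_frac G F p f \<otimes>\<^bsub>localization G F\<^esub> B = \<one>\<^bsub>localization G F\<^esub>"
    unfolding Units_def by auto
  then obtain q g where q: "q \<in> carrier G" "g \<in> F" "B = loc_frac G F q g"
    by (auto elim: localization_cases)
  then have "loc_frac G F (p \<otimes> q) (f \<otimes> g) = loc_frac G F \<one> \<one>"
    using B p frac_mult[OF F] localization_one by auto
  then obtain h where "h \<in> F" "p \<otimes> q \<otimes> \<one> \<otimes> h = \<one> \<otimes> (f \<otimes> g) \<otimes> h"
    using frac_eq_iff[OF F m_closed[OF p(1) q(1)] one_closed FD(3)[OF p(2) q(2)] FD(2)] by blast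
  moreover have "f \<otimes> g \<otimes> h \<in> F" using FD(3) p q \<open>h \<in> F\<close> by blast
  ultimately have "p \<otimes> (q \<otimes> h) \<in> F" using p q ss by (simp add: m_assoc)
  then show "p \<in> F" using FD(4)[OF p(1) m_closed[OF q(1) ss[OF \<open>h \<in> F\<close>]]] by blast
qed

abbreviation "Tp \<equiv> topology_generated_by (spec_basic G ` carrier G)"

lemma spec_basic_mult:
  assumes "p \<in> carrier G" "q \<in> carrier G"
  shows "spec_basic G (p \<otimes> q) = spec_basic G p \<inter> spec_basic G q"
  unfolding spec_basic_def using facesD(3,4,5)[of _ G] assms by blast

lemma openin_spec_basic: "p \<in> carrier G \<Longrightarrow> openin Tp (spec_basic G p)"
  by (rule topology_generated_by_Basis) auto

lemma topspace_Tp: "topspace Tp = faces G"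
  unfolding topology_generated_by_topspace spec_basic_def using facesD(2)[of _ G] by auto

lemma openin_Tp:
  "openin Tp U \<longleftrightarrow> U \<subseteq> faces G \<and> (\<forall>F\<in>U. \<exists>p\<in>F. spec_basic G p \<subseteq> U)"
proof
  assume "openin Tp U"
  then have "generate_topology_on (spec_basic G ` carrier G) U"
    by (simp add: openin_topology_generated_by_iff)
  then have "U \<subseteq> faces G" "\<And>F. F \<in> U \<Longrightarrow> \<exists>p\<in>F. spec_basic G p \<subseteq> U"
  proof (induction rule: generate_topology_on.induct)
    case (Int A B)
    { case 1 show ?case using Int.IH(1) by blast }
    { case (2 F)
      then have FA: "F \<in> A" and FB: "F \<in> B" by blast+
      have FF: "F \<in> faces G" using Int.IH(1) FA by blast
      obtain p where p: "p \<in> F" "spec_basic G p \<subseteq> A" using Int.IH(2)[OF FA] by blast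
      obtain q where q: "q \<in> F" "spec_basic G q \<subseteq> B" using Int.IH(4)[OF FB] by blast
      have "spec_basic G (p \<otimes> q) = spec_basic G p \<inter> spec_basic G q"
        by (rule spec_basic_mult) (use facesD(1)[OF FF] p q in auto)
      then show ?case using p q facesD(3)[OF FF p(1) q(1)] by blast }
  next
    case (UN K)
    { case 1 show ?case using UN.IH(1) by blast }
    { case (2 F)
      then obtain k where k: "k \<in> K" "F \<in> k" by blast
      show ?case using UN.IH(2)[OF k] k by blast }
  next
    case (Basis s)
    { case 1 show ?case using Basis by (auto simp: spec_basic_def) }
    { case (2 F) then show ?case using Basis by (auto simp: spec_basic_def) }
  qed auto
  then show "U \<subseteq> faces G \<and> (\<forall>F\<in>U. \<exists>p\<in>F. spec_basic G p \<subseteq> U)" by blast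
next
  assume a: "U \<subseteq> faces G \<and> (\<forall>F\<in>U. \<exists>p\<in>F. spec_basic G p \<subseteq> U)"
  have "\<exists>T. openin Tp T \<and> F \<in> T \<and> T \<subseteq> U" if "F \<in> U" for F
  proof -
    have FF: "F \<in> faces G" using a that by auto
    obtain p where "p \<in> F" "spec_basic G p \<subseteq> U" using a \<open>F \<in> U\<close> by auto
    then show ?thesis using openin_spec_basic[of p] facesD(1)[OF FF] FF
      unfolding spec_basic_def by auto
  qed
  then show "openin Tp U" using openin_subopen by blast
qed

lemma Spec_sel:
  "space_of (Spec G) = Tp" "stalk (Spec G) = localization G"
  by (simp_all add: Spec_def)

lemma Spec_sect_iff:
  assumes U: "openin Tp U"
  shows "s \<in> sect (Spec G) U \<longleftrightarrow> s \<in> extensional U \<and>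
    (\<forall>F\<in>U. \<exists>q p f. q \<in> F \<and> spec_basic G q \<subseteq> U \<and> p \<in> carrier G \<and>
        (\<forall>H\<in>spec_basic G q. f \<in> H \<and> s H = loc_frac G H p f))" (is "_ \<longleftrightarrow> ?R")
proof
  assume s: "s \<in> sect (Spec G) U"
  show ?R
  proof (intro conjI ballI)
    show "s \<in> extensional U" using s unfolding Spec_def by (auto simp: PiE_def)
    fix F assume "F \<in> U"
    then obtain V p f where V: "openin Tp V" "F \<in> V" "V \<subseteq> U" "p \<in> carrier G"
      "\<forall>H\<in>V. f \<in> H \<and> s H = loc_frac G H p f"
      using s unfolding Spec_def by auto metis
    then obtain q where "q \<in> F" "spec_basic G q \<subseteq> V" using openin_Tp by auto
    then show "\<exists>q p f. q \<in> F \<and> spec_basic G q \<subseteq> U \<and> p \<in> carrier G \<and>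
        (\<forall>H\<in>spec_basic G q. f \<in> H \<and> s H = loc_frac G H p f)"
      using V by blast
  qed
next
  assume R: ?R
  have 1: "\<exists>V p f. openin Tp V \<and> F \<in> V \<and> V \<subseteq> U \<and>
         p \<in> carrier G \<and> (\<forall>H\<in>V. f \<in> H \<and> s H = loc_frac G H p f)" if F: "F \<in> U" for F
  proof -
    have FF: "F \<in> faces G" using U that openin_Tp by auto
    obtain q p f where "q \<in> F" "spec_basic G q \<subseteq> U" "p \<in> carrier G"
        "(\<forall>H\<in>spec_basic G q. f \<in> H \<and> s H = loc_frac G H p f)" using bspec[OF conjunct2[OF R] F] by blast
    then show ?thesis using openin_spec_basic[of q] facesD(1)[OF FF] FF
      by (intro exI[of _ "spec_basic G q"] exI[of _ p] exI[of _ f]) (auto simp: spec_basic_def)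
  qed
  have "s \<in> (\<Pi>\<^sub>E F\<in>U. carrier (localization G F))"
  proof (rule PiE_I)
    fix F assume "F \<in> U"
    then show "s F \<in> carrier (localization G F)" using 1[of F] by (auto intro!: frac_in_carrier)
  qed (use R in \<open>auto simp: extensional_def\<close>)
  then show "s \<in> sect (Spec G) U" using 1 unfolding Spec_def by simp
qed

lemma Spec_sectE:
  assumes "openin Tp U" "s \<in> sect (Spec G) U" "F \<in> U"
  obtains q p f where "q \<in> F" "spec_basic G q \<subseteq> U" "p \<in> carrier G"
      "\<forall>H\<in>spec_basic G q. f \<in> H \<and> s H = loc_frac G H p f"
  using bspec[OF conjunct2[OF iffD1[OF Spec_sect_iff[OF assms(1)] assms(2)]] assms(3)] by blast


lemma openin_TpE:
  assumes "openin Tp U" "F \<in> U"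
  obtains q where "q \<in> F" "spec_basic G q \<subseteq> U"
  using iffD1[OF openin_Tp assms(1)] assms(2) by blast

lemma Spec_sect_fracI:
  assumes "q \<in> carrier G" "p \<in> carrier G" "\<And>H. H \<in> spec_basic G q \<Longrightarrow> f \<in> H"
  shows "(\<lambda>H\<in>spec_basic G q. loc_frac G H p f) \<in> sect (Spec G) (spec_basic G q)"
proof -
  have "\<exists>q' p' f'. q' \<in> F \<and> spec_basic G q' \<subseteq> spec_basic G q \<and> p' \<in> carrier G \<and>
        (\<forall>H\<in>spec_basic G q'. f' \<in> H \<and> (\<lambda>H\<in>spec_basic G q. loc_frac G H p f) H = loc_frac G H p' f')" 
    if "F \<in> spec_basic G q" for F
  proof -
    have "q \<in> F" using that by (simp add: spec_basic_def)
    moreover have "\<forall>H\<in>spec_basic G q. f \<in> H \<and> (\<lambda>H\<in>spec_basic G q. loc_frac G H p f) H = loc_frac G H p f"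
      using assms(3) by simp
    ultimately show ?thesis using assms(2) by blast
  qed
  then show ?thesis
    using iffD2[OF Spec_sect_iff[OF openin_spec_basic[OF assms(1)]]] by (simp add: restrict_extensional)
qed

lemma openin_Tp_face: "openin Tp U \<Longrightarrow> F \<in> U \<Longrightarrow> F \<in> faces G"
  using openin_Tp by blast

lemma Spec_restrict:
  assumes "openin Tp U" "openin Tp V" "V \<subseteq> U" "s \<in> sect (Spec G) U"
  shows "restrict s V \<in> sect (Spec G) V"
proof -
  have "\<exists>q p f. q \<in> F \<and> spec_basic G q \<subseteq> V \<and> p \<in> carrier G \<and>
        (\<forall>H\<in>spec_basic G q. f \<in> H \<and> restrict s V H = loc_frac G H p f)" if F: "F \<in> V" for F
  proof -
    have FF: "F \<in> faces G" using assms(2) F openin_Tp by blast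
    obtain q p f where *: "q \<in> F" "spec_basic G q \<subseteq> U" "p \<in> carrier G"
      "(\<forall>H\<in>spec_basic G q. f \<in> H \<and> s H = loc_frac G H p f)"
      using Spec_sectE[OF assms(1,4) subsetD[OF assms(3) F]] by blast
    obtain q' where q': "q' \<in> F" "spec_basic G q' \<subseteq> V" using openin_TpE[OF assms(2) F] by blast
    have "spec_basic G (q \<otimes> q') = spec_basic G q \<inter> spec_basic G q'"
      by (rule spec_basic_mult) (use facesD(1)[OF FF] * q' in auto)
    then have "q \<otimes> q' \<in> F" "spec_basic G (q \<otimes> q') \<subseteq> V"
      "\<forall>H\<in>spec_basic G (q \<otimes> q'). f \<in> H \<and> restrict s V H = loc_frac G H p f"
      using * q' facesD(3)[OF FF *(1) q'(1)] by auto
    then show ?thesis using *(3) by blast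
  qed
  then show ?thesis using assms(2) by (subst Spec_sect_iff) auto
qed

theorem locally_monoidal_Spec: "locally_monoidal (Spec G)"
  unfolding locally_monoidal_def Spec_sel topspace_Tp
proof (intro conjI ballI allI impI)
  fix F assume "F \<in> faces G" then show "comm_monoid (localization G F)" 
    by (rule comm_monoid_localization)
next
  fix U assume "openin Tp U"
  then show "sect (Spec G) U \<subseteq> (\<Pi>\<^sub>E x\<in>U. carrier (localization G x))"
    by (auto simp: Spec_def)
next
  fix U assume U: "openin Tp U"
  then have "U \<subseteq> faces G" using openin_Tp by auto
  have "\<exists>q p f. q \<in> F \<and> spec_basic G q \<subseteq> U \<and> p \<in> carrier G \<and>
          (\<forall>H\<in>spec_basic G q. f \<in> H \<and> (\<lambda>x\<in>U. \<one>\<^bsub>localization G x\<^esub>) H = loc_frac G H p f)" if F: "F \<in> U" for F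
  proof -
    obtain q where q: "q \<in> F" "spec_basic G q \<subseteq> U" using openin_TpE[OF U F] by blast
    then have "\<forall>H\<in>spec_basic G q. \<one> \<in> H \<and> (\<lambda>x\<in>U. \<one>\<^bsub>localization G x\<^esub>) H = loc_frac G H \<one> \<one>"
      by (auto simp: localization_one spec_basic_def intro: facesD(2))
    with q show ?thesis using one_closed by blast
  qed
  then show "(\<lambda>x\<in>U. \<one>\<^bsub>localization G x\<^esub>) \<in> sect (Spec G) U"
    by (subst Spec_sect_iff[OF U]) auto
next
  fix U s t assume U: "openin Tp U" and s: "s \<in> sect (Spec G) U" and t: "t \<in> sect (Spec G) U"
  have "\<exists>q p f. q \<in> F \<and> spec_basic G q \<subseteq> U \<and> p \<in> carrier G \<and>
          (\<forall>H\<in>spec_basic G q. f \<in> H \<and> (\<lambda>x\<in>U. s x \<otimes>\<^bsub>localization G x\<^esub> t x) H = loc_frac G H p f)" if F: "F \<in> U" for F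
  proof -
    have FF: "F \<in> faces G" using openin_Tp_face[OF U F] .
    obtain q p f where *: "q \<in> F" "spec_basic G q \<subseteq> U" "p \<in> carrier G"
      "(\<forall>H\<in>spec_basic G q. f \<in> H \<and> s H = loc_frac G H p f)"
      using Spec_sectE[OF U s F] by blast
    obtain q' p' f' where **: "q' \<in> F" "spec_basic G q' \<subseteq> U" "p' \<in> carrier G"
      "(\<forall>H\<in>spec_basic G q'. f' \<in> H \<and> t H = loc_frac G H p' f')"
      using Spec_sectE[OF U t F] by blast
    have b: "spec_basic G (q \<otimes> q') = spec_basic G q \<inter> spec_basic G q'"
      by (rule spec_basic_mult) (use facesD(1)[OF FF] * ** in auto)
    have "f \<otimes> f' \<in> H \<and> (\<lambda>x\<in>U. s x \<otimes>\<^bsub>localization G x\<^esub> t x) H = loc_frac G H (p \<otimes> p') (f \<otimes> f')"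
      if "H \<in> spec_basic G (q \<otimes> q')" for H
    proof -
      have "H \<in> faces G" "H \<in> spec_basic G q" "H \<in> spec_basic G q'" using that b by (auto simp: spec_basic_def)
      then have h: "H \<in> faces G" "f \<in> H" "f' \<in> H" "s H = loc_frac G H p f" "t H = loc_frac G H p' f'" "H \<in> U"
        using * ** by auto
      show ?thesis using frac_mult[OF h(1) *(3) **(3) h(2,3)] facesD(3)[OF h(1-3)] h by simp
    qed
    moreover have "q \<otimes> q' \<in> F" "spec_basic G (q \<otimes> q') \<subseteq> U" "p \<otimes> p' \<in> carrier G"
      using b facesD(3)[OF FF] * ** by auto
    ultimately show ?thesis by blast
  qed
  then show "(\<lambda>x\<in>U. s x \<otimes>\<^bsub>localization G x\<^esub> t x) \<in> sect (Spec G) U"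
    by (subst Spec_sect_iff[OF U]) auto
next
  fix U s V assume "openin Tp U" "s \<in> sect (Spec G) U" "openin Tp V \<and> V \<subseteq> U"
  then show "restrict s V \<in> sect (Spec G) V" using Spec_restrict by blast
next
  fix U s assume U: "openin Tp U" and s: "s \<in> (\<Pi>\<^sub>E x\<in>U. carrier (localization G x))"
    and loc: "\<forall>x\<in>U. \<exists>V. openin Tp V \<and> x \<in> V \<and> V \<subseteq> U \<and> restrict s V \<in> sect (Spec G) V"
  have "\<exists>q p f. q \<in> F \<and> spec_basic G q \<subseteq> U \<and> p \<in> carrier G \<and>
          (\<forall>H\<in>spec_basic G q. f \<in> H \<and> s H = loc_frac G H p f)" if F: "F \<in> U" for F
  proof -
    obtain V where V: "openin Tp V" "F \<in> V" "V \<subseteq> U" "restrict s V \<in> sect (Spec G) V"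
      using loc F by blast
    then obtain q p f where *: "q \<in> F" "spec_basic G q \<subseteq> V" "p \<in> carrier G"
      "(\<forall>H\<in>spec_basic G q. f \<in> H \<and> restrict s V H = loc_frac G H p f)"
      using Spec_sectE[OF V(1) V(4) V(2)] by blast
    then have "\<forall>H\<in>spec_basic G q. f \<in> H \<and> s H = loc_frac G H p f" by (metis restrict_apply' subsetD)
    moreover have "spec_basic G q \<subseteq> U" using * V by blast
    ultimately show ?thesis using *(1,3) by blast
  qed
  then show "s \<in> sect (Spec G) U"
    using s by (subst Spec_sect_iff[OF U]) (auto simp: PiE_def)
next
  fix U s t F assume U: "openin Tp U" and s: "s \<in> sect (Spec G) U" and t: "t \<in> sect (Spec G) U"
    and F: "F \<in> U" and eq: "s F = t F"
  have FF: "F \<in> faces G" using openin_Tp_face[OF U F] .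
  note FD = facesD[OF FF]
  obtain q p f where *: "q \<in> F" "spec_basic G q \<subseteq> U" "p \<in> carrier G"
    "(\<forall>H\<in>spec_basic G q. f \<in> H \<and> s H = loc_frac G H p f)"
    using Spec_sectE[OF U s F] by blast
  obtain q' p' f' where **: "q' \<in> F" "spec_basic G q' \<subseteq> U" "p' \<in> carrier G"
    "(\<forall>H\<in>spec_basic G q'. f' \<in> H \<and> t H = loc_frac G H p' f')"
    using Spec_sectE[OF U t F] by blast
  have FS: "F \<in> spec_basic G q" "F \<in> spec_basic G q'" using FF * ** by (auto simp: spec_basic_def)
  obtain h where h: "h \<in> F" "p \<otimes> f' \<otimes> h = p' \<otimes> f \<otimes> h"
    using eq * ** FS frac_eq_iff[OF FF, of p p' f f'] by metis
  let ?V = "spec_basic G (q \<otimes> q' \<otimes> h)"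
  have c: "q \<in> carrier G" "q' \<in> carrier G" "h \<in> carrier G" using FD(1) * ** h by auto
  have b: "H \<in> spec_basic G q \<and> H \<in> spec_basic G q' \<and> h \<in> H \<and> H \<in> faces G" if "H \<in> ?V" for H
  proof -
    have "?V = spec_basic G q \<inter> spec_basic G q' \<inter> spec_basic G h"
      using c by (simp add: spec_basic_mult)
    then show ?thesis using that unfolding spec_basic_def by blast
  qed
  have "s H = t H" if "H \<in> ?V" for H
    using b[OF that] * ** h frac_eq_iff[of H p p' f f'] by metis
  moreover have "openin Tp ?V" "F \<in> ?V" "?V \<subseteq> U"
    subgoal by (rule openin_spec_basic) (use c in simp)
    subgoal using FF FD(3) * ** h by (simp add: spec_basic_def)
    subgoal using b * by auto
    done
  ultimately show "\<exists>V. openin Tp V \<and> F \<in> V \<and> V \<subseteq> U \<and> restrict s V = restrict t V"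
    using restrict_ext[of ?V s t] by blast
next
  fix F A assume F: "F \<in> faces G" and A: "A \<in> carrier (localization G F)"
  obtain p f where pf: "p \<in> carrier G" "f \<in> F" "A = loc_frac G F p f" using A by (rule localization_cases)
  have f: "f \<in> carrier G" using pf facesD(1)[OF F] by auto
  let ?s = "\<lambda>H\<in>spec_basic G f. loc_frac G H p f"
  have "?s \<in> sect (Spec G) (spec_basic G f)"
    by (rule Spec_sect_fracI[OF f pf(1)]) (simp add: spec_basic_def)
  moreover have "F \<in> spec_basic G f" using F pf by (simp add: spec_basic_def)
  ultimately show "\<exists>U. openin Tp U \<and> F \<in> U \<and> (\<exists>s\<in>sect (Spec G) U. s F = A)"
    using openin_spec_basic[OF f] pf(3) by (metis restrict_apply')
qed


definition "face_gen p = {f \<in> carrier G. \<exists>g\<in>carrier G. \<exists>n::nat. f \<otimes> g = p [^] n}"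

lemma face_gen: 
  assumes p: "p \<in> carrier G" 
  shows "face_gen p \<in> spec_basic G p" "\<And>F. F \<in> spec_basic G p \<Longrightarrow> face_gen p \<subseteq> F"
proof -
  have pw: "p [^] n \<in> F" if "F \<in> spec_basic G p" for F and n::nat
  proof -
    have "F \<in> faces G" "p \<in> F" using that by (auto simp: spec_basic_def)
    then show ?thesis by (induction n) (simp_all add: facesD(2,3))
  qed
  show "face_gen p \<subseteq> F" if F: "F \<in> spec_basic G p" for F
  proof
    fix f assume "f \<in> face_gen p"
    then obtain g n where "g \<in> carrier G" "f \<in> carrier G" "f \<otimes> g = p [^] (n::nat)" by (auto simp: face_gen_def)
    then have "f \<otimes> g \<in> F" "f \<in> carrier G" "g \<in> carrier G" using pw[OF F, of n] by auto
    moreover have "F \<in> faces G" using F by (simp add: spec_basic_def)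
    ultimately show "f \<in> F" using facesD(4)[of F G f g] by blast
  qed
  have "submonoid (face_gen p) G"
  proof
    show "\<one> \<in> face_gen p" unfolding face_gen_def by (auto intro!: bexI[of _ \<one>] exI[of _ "0::nat"])
    show "face_gen p \<subseteq> carrier G" unfolding face_gen_def by auto
    fix x y assume "x \<in> face_gen p" "y \<in> face_gen p"
    then obtain g n h k where *: "x \<in> carrier G" "y \<in> carrier G" "g \<in> carrier G" "h \<in> carrier G"
      "x \<otimes> g = p [^] (n::nat)" "y \<otimes> h = p [^] (k::nat)" by (auto simp: face_gen_def)
    have "x \<otimes> y \<otimes> (g \<otimes> h) = (x \<otimes> g) \<otimes> (y \<otimes> h)" using *(1-4) by (simp add: m_ac)
    also have "\<dots> = p [^] (n + k)" using * p by (simp add: nat_pow_mult)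
    finally show "x \<otimes> y \<in> face_gen p" using * unfolding face_gen_def by blast
  qed
  moreover have "x \<in> face_gen p \<and> y \<in> face_gen p"
    if xy: "x \<in> carrier G" "y \<in> carrier G" "x \<otimes> y \<in> face_gen p" for x y
  proof -
    obtain g n where g: "g \<in> carrier G" "x \<otimes> y \<otimes> g = p [^] (n::nat)"
      using xy by (auto simp: face_gen_def)
    have "x \<otimes> (y \<otimes> g) = p [^] n" "y \<otimes> (x \<otimes> g) = p [^] n" unfolding g(2)[symmetric] using xy(1,2) g(1) by (simp_all add: m_ac)
    then show ?thesis using xy g m_closed unfolding face_gen_def by blast
  qed
  moreover have "p \<in> face_gen p" using p unfolding face_gen_def 
    by (auto intro!: bexI[of _ \<one>] exI[of _ "1::nat"])
  ultimately show "face_gen p \<in> spec_basic G p" unfolding faces_def spec_basic_def by blast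
qed

theorem Spec_sect_basic:
  assumes p: "p \<in> carrier G"
  shows "sect (Spec G) (spec_basic G p) =
      (\<lambda>(a, n). \<lambda>F\<in>spec_basic G p. loc_frac G F a (p [^] n)) ` (carrier G \<times> (UNIV :: nat set))"
    and "\<And>a b (n :: nat) (m :: nat). a \<in> carrier G \<Longrightarrow> b \<in> carrier G \<Longrightarrow>
      (\<lambda>F\<in>spec_basic G p. loc_frac G F a (p [^] n)) = (\<lambda>F\<in>spec_basic G p. loc_frac G F b (p [^] m)) \<longleftrightarrow>
      (\<exists>k :: nat. a \<otimes> p [^] m \<otimes> p [^] k = b \<otimes> p [^] n \<otimes> p [^] k)"
proof -
  have fg: "face_gen p \<in> faces G" using face_gen[OF p] by (auto simp: spec_basic_def)
  have pw: "p [^] n \<in> F" if "F \<in> spec_basic G p" for F and n::nat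
  proof -
    have "F \<in> faces G" "p \<in> F" using that by (auto simp: spec_basic_def)
    then show ?thesis by (induction n) (simp_all add: facesD(2,3))
  qed
  have pc: "p [^] n \<in> carrier G" for n::nat using p by simp
  show "sect (Spec G) (spec_basic G p) =
      (\<lambda>(a, n). \<lambda>F\<in>spec_basic G p. loc_frac G F a (p [^] n)) ` (carrier G \<times> (UNIV :: nat set))"
  proof (intro Set.equalityI subsetI)
    fix s assume s: "s \<in> sect (Spec G) (spec_basic G p)"
    then obtain q a f where q: "q \<in> face_gen p" "spec_basic G q \<subseteq> spec_basic G p" "a \<in> carrier G"
      and sf: "\<forall>H\<in>spec_basic G q. f \<in> H \<and> s H = loc_frac G H a f"
      and ext: "s \<in> extensional (spec_basic G p)"
      using Spec_sectE[OF openin_spec_basic[OF p] s face_gen(1)[OF p]]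
        Spec_sect_iff[OF openin_spec_basic[OF p], of s] s by metis
    have "face_gen p \<in> spec_basic G q" using q fg by (simp add: spec_basic_def)
    then have "f \<in> face_gen p" using sf by blast
    then obtain g n where g: "f \<in> carrier G" "g \<in> carrier G" "f \<otimes> g = p [^] (n::nat)" by (auto simp: face_gen_def)
    have "s H = loc_frac G H (a \<otimes> g) (p [^] n)" if H: "H \<in> spec_basic G p" for H
    proof -
      have HF: "H \<in> faces G" using H by (simp add: spec_basic_def)
      have "q \<in> H" using face_gen(2)[OF p H] q by auto
      then have fH: "f \<in> H" "s H = loc_frac G H a f" using sf HF by (auto simp: spec_basic_def)
      have "loc_frac G H a f = loc_frac G H (a \<otimes> g) (p [^] n)"
        proof (subst frac_eq_iff[OF HF])
          show "\<exists>h\<in>H. a \<otimes> p [^] n \<otimes> h = a \<otimes> g \<otimes> f \<otimes> h"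
            unfolding g(3)[symmetric] using g(1,2) q(3) facesD(2)[OF HF] 
            by (intro bexI[of _ \<one>]) (simp_all add: m_ac)
        qed (use fH g q pw[OF H, of n] in auto)
      then show ?thesis using fH by simp
    qed
    then have "s = (\<lambda>F\<in>spec_basic G p. loc_frac G F (a \<otimes> g) (p [^] n))"
      using ext by (intro extensionalityI[of _ "spec_basic G p"]) auto
    then show "s \<in> (\<lambda>(a, n). \<lambda>F\<in>spec_basic G p. loc_frac G F a (p [^] n)) ` (carrier G \<times> (UNIV :: nat set))"
      using q g by (intro image_eqI[of _ _ "(a \<otimes> g, n)"]) auto
  next
    fix s assume "s \<in> (\<lambda>(a, n). \<lambda>F\<in>spec_basic G p. loc_frac G F a (p [^] n)) ` (carrier G \<times> (UNIV :: nat set))"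
    then obtain a n where a: "a \<in> carrier G" "s = (\<lambda>F\<in>spec_basic G p. loc_frac G F a (p [^] (n::nat)))" by auto
    show "s \<in> sect (Spec G) (spec_basic G p)"
      unfolding a(2) by (rule Spec_sect_fracI[OF p a(1)]) (rule pw)
  qed
  fix a b and n m :: nat assume ab: "a \<in> carrier G" "b \<in> carrier G"
  show "(\<lambda>F\<in>spec_basic G p. loc_frac G F a (p [^] n)) = (\<lambda>F\<in>spec_basic G p. loc_frac G F b (p [^] m)) \<longleftrightarrow>
      (\<exists>k :: nat. a \<otimes> p [^] m \<otimes> p [^] k = b \<otimes> p [^] n \<otimes> p [^] k)" (is "?L = ?R \<longleftrightarrow> ?E")
  proof
    assume "?L = ?R"
    have "loc_frac G (face_gen p) a (p [^] n) = loc_frac G (face_gen p) b (p [^] m)"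
      using fun_cong[OF \<open>?L = ?R\<close>, of "face_gen p"] face_gen(1)[OF p] by simp
    then obtain h where h: "h \<in> face_gen p" "a \<otimes> p [^] m \<otimes> h = b \<otimes> p [^] n \<otimes> h"
      using frac_eq_iff[OF fg ab pw[OF face_gen(1)[OF p]] pw[OF face_gen(1)[OF p]]] by blast
    then obtain g k where g: "h \<in> carrier G" "g \<in> carrier G" "h \<otimes> g = p [^] (k::nat)" by (auto simp: face_gen_def)
    have "a \<otimes> p [^] m \<otimes> p [^] k = (a \<otimes> p [^] m \<otimes> h) \<otimes> g" unfolding g(3)[symmetric] using g(1,2) ab pc by (simp add: m_ac)
    also have "\<dots> = b \<otimes> p [^] n \<otimes> p [^] k" unfolding h(2) g(3)[symmetric] using g(1,2) ab pc by (simp add: m_ac)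
    finally show ?E by blast
  next
    assume ?E
    then obtain k where "a \<otimes> p [^] m \<otimes> p [^] (k::nat) = b \<otimes> p [^] n \<otimes> p [^] k" by blast
    then have "loc_frac G F a (p [^] n) = loc_frac G F b (p [^] m)" if "F \<in> spec_basic G p" for F
    proof -
      have "F \<in> faces G" using that by (simp add: spec_basic_def)
      from frac_eq_iff[OF this ab pw[OF that] pw[OF that]] show ?thesis
        using \<open>a \<otimes> p [^] m \<otimes> p [^] (k::nat) = b \<otimes> p [^] n \<otimes> p [^] k\<close> pw[OF that] by blast
    qed
    then show "?L = ?R" by (rule restrict_ext)
  qed
qed

end

lemma locally_monoidalD:
  assumes "locally_monoidal X"
  shows "x \<in> points X \<Longrightarrow> comm_monoid (stalk X x)"
    and "openin (space_of X) U \<Longrightarrow> s \<in> sect X U \<Longrightarrow> s \<in> (\<Pi>\<^sub>E x\<in>U. carrier (stalk X x))"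
    and "openin (space_of X) U \<Longrightarrow> (\<lambda>x\<in>U. \<one>\<^bsub>stalk X x\<^esub>) \<in> sect X U"
    and "openin (space_of X) U \<Longrightarrow> s \<in> sect X U \<Longrightarrow> t \<in> sect X U \<Longrightarrow>
           (\<lambda>x\<in>U. s x \<otimes>\<^bsub>stalk X x\<^esub> t x) \<in> sect X U"
    and "openin (space_of X) U \<Longrightarrow> s \<in> sect X U \<Longrightarrow> openin (space_of X) V \<Longrightarrow> V \<subseteq> U \<Longrightarrow>
           restrict s V \<in> sect X V"
    and "openin (space_of X) U \<Longrightarrow> s \<in> (\<Pi>\<^sub>E x\<in>U. carrier (stalk X x)) \<Longrightarrow>
           (\<And>x. x \<in> U \<Longrightarrow> \<exists>V. openin (space_of X) V \<and> x \<in> V \<and> V \<subseteq> U \<and> restrict s V \<in> sect X V) \<Longrightarrow>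
           s \<in> sect X U"
    and "openin (space_of X) U \<Longrightarrow> s \<in> sect X U \<Longrightarrow> t \<in> sect X U \<Longrightarrow> x \<in> U \<Longrightarrow> s x = t x \<Longrightarrow>
           \<exists>V. openin (space_of X) V \<and> x \<in> V \<and> V \<subseteq> U \<and> restrict s V = restrict t V"
    and "x \<in> points X \<Longrightarrow> a \<in> carrier (stalk X x) \<Longrightarrow>
           \<exists>U. openin (space_of X) U \<and> x \<in> U \<and> (\<exists>s\<in>sect X U. s x = a)"
proof -
  note a = assms[unfolded locally_monoidal_def]
  show "x \<in> points X \<Longrightarrow> comm_monoid (stalk X x)" by (rule bspec[OF conjunct1[OF a]])
  show "x \<in> points X \<Longrightarrow> a \<in> carrier (stalk X x) \<Longrightarrow>
           \<exists>U. openin (space_of X) U \<and> x \<in> U \<and> (\<exists>s\<in>sect X U. s x = a)"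
    by (rule bspec[OF bspec[OF conjunct2[OF conjunct2[OF a]]]])
  note u = mp[OF spec[OF conjunct1[OF conjunct2[OF a]]]]
  assume U: "openin (space_of X) U"
  note u = u[OF U]
  show "s \<in> sect X U \<Longrightarrow> s \<in> (\<Pi>\<^sub>E x\<in>U. carrier (stalk X x))" by (rule subsetD[OF conjunct1[OF u]])
  show "(\<lambda>x\<in>U. \<one>\<^bsub>stalk X x\<^esub>) \<in> sect X U" by (rule conjunct1[OF conjunct2[OF u]])
  show "s \<in> sect X U \<Longrightarrow> t \<in> sect X U \<Longrightarrow> (\<lambda>x\<in>U. s x \<otimes>\<^bsub>stalk X x\<^esub> t x) \<in> sect X U"
    by (rule bspec[OF bspec[OF conjunct1[OF conjunct2[OF conjunct2[OF u]]]]])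
  show "s \<in> sect X U \<Longrightarrow> openin (space_of X) V \<Longrightarrow> V \<subseteq> U \<Longrightarrow> restrict s V \<in> sect X V"
    by (rule mp[OF spec[OF bspec[OF conjunct1[OF conjunct2[OF conjunct2[OF conjunct2[OF u]]]]]] conjI])
  show "s \<in> (\<Pi>\<^sub>E x\<in>U. carrier (stalk X x)) \<Longrightarrow>
           (\<And>x. x \<in> U \<Longrightarrow> \<exists>V. openin (space_of X) V \<and> x \<in> V \<and> V \<subseteq> U \<and> restrict s V \<in> sect X V) \<Longrightarrow>
           s \<in> sect X U"
    by (rule mp[OF bspec[OF conjunct1[OF conjunct2[OF conjunct2[OF conjunct2[OF conjunct2[OF u]]]]]] ballI])
  show "s \<in> sect X U \<Longrightarrow> t \<in> sect X U \<Longrightarrow> x \<in> U \<Longrightarrow> s x = t x \<Longrightarrow>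
           \<exists>V. openin (space_of X) V \<and> x \<in> V \<and> V \<subseteq> U \<and> restrict s V = restrict t V"
    by (rule mp[OF bspec[OF bspec[OF bspec[OF conjunct2[OF conjunct2[OF conjunct2[OF conjunct2[OF conjunct2[OF u]]]]]]]]])
qed

lemma lm_homD:
  assumes "f \<in> lm_hom X Y"
  shows "continuous_map (space_of X) (space_of Y) (pt f)"
    and "pt f \<in> extensional (points X)" and "st f \<in> extensional (points X)"
    and "x \<in> points X \<Longrightarrow> st f x \<in> mon_hom (stalk Y (pt f x)) (stalk X x)"
    and "x \<in> points X \<Longrightarrow> local_hom (stalk Y (pt f x)) (stalk X x) (st f x)"
    and "openin (space_of Y) V \<Longrightarrow> s \<in> sect Y V \<Longrightarrow>
      (\<lambda>x\<in>{x\<in>points X. pt f x \<in> V}. st f x (s (pt f x))) \<in> sect X {x\<in>points X. pt f x \<in> V}"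
    and "x \<in> points X \<Longrightarrow> pt f x \<in> points Y"
  subgoal using assms unfolding lm_hom_def by simp
  subgoal using assms unfolding lm_hom_def by simp
  subgoal using assms unfolding lm_hom_def by simp
  subgoal using assms unfolding lm_hom_def by simp
  subgoal using assms unfolding lm_hom_def by simp
  subgoal using assms unfolding lm_hom_def by simp
  subgoal using assms unfolding lm_hom_def continuous_map_def by auto
  done

lemma lm_prod_sel:
  "space_of (lm_prod X Y) = prod_topology (space_of X) (space_of Y)"
  "stalk (lm_prod X Y) z = stalk X (fst z) \<times>\<times> stalk Y (snd z)"
  "points (lm_prod X Y) = points X \<times> points Y"
  by (simp_all add: lm_prod_def case_prod_beta)

lemma lm_prod_sectE:
  assumes "s \<in> sect (lm_prod X Y) W" "z \<in> W"
  obtains U V a b where "openin (space_of X) U" "openin (space_of Y) V" "z \<in> U \<times> V" "U \<times> V \<subseteq> W"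
    "a \<in> sect X U" "b \<in> sect Y V" "\<And>x y. x \<in> U \<Longrightarrow> y \<in> V \<Longrightarrow> s (x, y) = (a x, b y)"
  using assms unfolding lm_prod_def by auto

lemma lm_prod_sectI:
  assumes X: "locally_monoidal X" and Y: "locally_monoidal Y" and "s \<in> extensional W"
    and loc: "\<And>z. z \<in> W \<Longrightarrow> \<exists>U V a b. openin (space_of X) U \<and> openin (space_of Y) V \<and> z \<in> U \<times> V \<and> U \<times> V \<subseteq> W \<and>
      a \<in> sect X U \<and> b \<in> sect Y V \<and> (\<forall>x\<in>U. \<forall>y\<in>V. s (x, y) = (a x, b y))"
  shows "s \<in> sect (lm_prod X Y) W"
proof -
  have "s z \<in> carrier (stalk X (fst z) \<times>\<times> stalk Y (snd z))" if z: "z \<in> W" for z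
  proof -
    obtain U V a b where *: "openin (space_of X) U" "openin (space_of Y) V" "z \<in> U \<times> V"
      "a \<in> sect X U" "b \<in> sect Y V" "\<forall>x\<in>U. \<forall>y\<in>V. s (x, y) = (a x, b y)"
      using loc[OF z] by blast
    have "a \<in> (\<Pi>\<^sub>E x\<in>U. carrier (stalk X x))" "b \<in> (\<Pi>\<^sub>E x\<in>V. carrier (stalk Y x))"
      using locally_monoidalD(2)[OF X *(1,4)] locally_monoidalD(2)[OF Y *(2,5)] .
    then show ?thesis using *(3,6) by auto
  qed
  then have "s \<in> (\<Pi>\<^sub>E z\<in>W. carrier (stalk X (fst z) \<times>\<times> stalk Y (snd z)))"
    using assms(3) by (auto simp: PiE_def)
  moreover have "\<exists>U V. openin (space_of X) U \<and> openin (space_of Y) V \<and> z \<in> U \<times> V \<and> U \<times> V \<subseteq> W \<and>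
         (\<exists>a\<in>sect X U. \<exists>b\<in>sect Y V. \<forall>x\<in>U. \<forall>y\<in>V. s (x, y) = (a x, b y))" if z: "z \<in> W" for z
    using loc[OF z] by blast
  ultimately show ?thesis unfolding lm_prod_def by simp
qed

lemma openin_prodE:
  assumes "openin (prod_topology S T) W" "z \<in> W"
  obtains U V where "openin S U" "openin T V" "z \<in> U \<times> V" "U \<times> V \<subseteq> W"
  using assms unfolding openin_prod_topology_alt by (cases z) (metis mem_Sigma_iff)

lemma DirProd_comm_monoid:
  assumes "comm_monoid P" "comm_monoid Q" shows "comm_monoid (P \<times>\<times> Q)"
proof -
  interpret P: comm_monoid P by fact
  interpret Q: comm_monoid Q by fact
  show ?thesis
    by (rule comm_monoidI) (auto simp: P.m_ac Q.m_ac)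
qed

theorem locally_monoidal_prod:
  assumes X: "locally_monoidal X" and Y: "locally_monoidal Y"
  shows "locally_monoidal (lm_prod X Y)"
proof -
  let ?P = "lm_prod X Y"
  note XD = locally_monoidalD[OF X] and YD = locally_monoidalD[OF Y]
  have restr: "restrict s W' \<in> sect ?P W'" 
    if s: "s \<in> sect ?P W" and W': "openin (space_of ?P) W'" and sub: "W' \<subseteq> W" for s W W'
  proof (rule lm_prod_sectI[OF X Y])
    fix z assume z: "z \<in> W'"
    obtain U V a b where 1: "openin (space_of X) U" "openin (space_of Y) V" "z \<in> U \<times> V" "U \<times> V \<subseteq> W"
       "a \<in> sect X U" "b \<in> sect Y V" "\<And>x y. x \<in> U \<Longrightarrow> y \<in> V \<Longrightarrow> s (x, y) = (a x, b y)"
      using lm_prod_sectE[OF s subsetD[OF sub z]] by blast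
    obtain U' V' where 2: "openin (space_of X) U'" "openin (space_of Y) V'" "z \<in> U' \<times> V'" "U' \<times> V' \<subseteq> W'"
      using openin_prodE[OF W'[unfolded lm_prod_sel] z] by blast
    have UU: "openin (space_of X) (U \<inter> U')" "openin (space_of Y) (V \<inter> V')" using 1 2 by auto
    have "restrict a (U \<inter> U') \<in> sect X (U \<inter> U')" "restrict b (V \<inter> V') \<in> sect Y (V \<inter> V')"
      using XD(5)[OF 1(1,5) UU(1)] YD(5)[OF 1(2,6) UU(2)] by auto
    moreover have "z \<in> (U \<inter> U') \<times> (V \<inter> V')" "(U \<inter> U') \<times> (V \<inter> V') \<subseteq> W'" using 1 2 by auto
    moreover have "\<forall>x\<in>U \<inter> U'. \<forall>y\<in>V \<inter> V'. restrict s W' (x, y) = (restrict a (U \<inter> U') x, restrict b (V \<inter> V') y)"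
      using 1(7) 2(4) by auto
    ultimately show "\<exists>U V a b. openin (space_of X) U \<and> openin (space_of Y) V \<and> z \<in> U \<times> V \<and> U \<times> V \<subseteq> W' \<and>
      a \<in> sect X U \<and> b \<in> sect Y V \<and> (\<forall>x\<in>U. \<forall>y\<in>V. restrict s W' (x, y) = (a x, b y))"
      using UU by blast
  qed simp
  show ?thesis
    unfolding locally_monoidal_def
  proof (intro conjI ballI allI impI)
    fix z assume "z \<in> points ?P"
    then show "comm_monoid (stalk ?P z)"
      unfolding lm_prod_sel using XD(1) YD(1) by (auto intro: DirProd_comm_monoid)
  next
    fix W assume "openin (space_of ?P) W"
    show "sect ?P W \<subseteq> (\<Pi>\<^sub>E z\<in>W. carrier (stalk ?P z))"
      unfolding lm_prod_sel by (auto simp: lm_prod_def)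
  next
    fix W assume W: "openin (space_of ?P) W"
    show "(\<lambda>z\<in>W. \<one>\<^bsub>stalk ?P z\<^esub>) \<in> sect ?P W"
    proof (rule lm_prod_sectI[OF X Y])
      fix z assume z: "z \<in> W"
      obtain U V where 2: "openin (space_of X) U" "openin (space_of Y) V" "z \<in> U \<times> V" "U \<times> V \<subseteq> W"
        using openin_prodE[OF W[unfolded lm_prod_sel] z] by blast
      have "\<forall>x\<in>U. \<forall>y\<in>V. (\<lambda>z\<in>W. \<one>\<^bsub>stalk ?P z\<^esub>) (x, y) = ((\<lambda>x\<in>U. \<one>\<^bsub>stalk X x\<^esub>) x, (\<lambda>x\<in>V. \<one>\<^bsub>stalk Y x\<^esub>) y)"
        using 2 by (auto simp: lm_prod_sel)
      then show "\<exists>U V a b. openin (space_of X) U \<and> openin (space_of Y) V \<and> z \<in> U \<times> V \<and> U \<times> V \<subseteq> W \<and>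
      a \<in> sect X U \<and> b \<in> sect Y V \<and> (\<forall>x\<in>U. \<forall>y\<in>V. (\<lambda>z\<in>W. \<one>\<^bsub>stalk ?P z\<^esub>) (x, y) = (a x, b y))"
        using 2 XD(3)[OF 2(1)] YD(3)[OF 2(2)] by blast
    qed simp
  next
    fix W s t assume W: "openin (space_of ?P) W" and s: "s \<in> sect ?P W" and t: "t \<in> sect ?P W"
    let ?st = "\<lambda>z\<in>W. s z \<otimes>\<^bsub>stalk ?P z\<^esub> t z"
    show "?st \<in> sect ?P W"
    proof (rule lm_prod_sectI[OF X Y])
      fix z assume z: "z \<in> W"
      obtain U V a b where 1: "openin (space_of X) U" "openin (space_of Y) V" "z \<in> U \<times> V" "U \<times> V \<subseteq> W"
         "a \<in> sect X U" "b \<in> sect Y V" "\<And>x y. x \<in> U \<Longrightarrow> y \<in> V \<Longrightarrow> s (x, y) = (a x, b y)"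
        using lm_prod_sectE[OF s z] by blast
      obtain U' V' a' b' where 2: "openin (space_of X) U'" "openin (space_of Y) V'" "z \<in> U' \<times> V'" "U' \<times> V' \<subseteq> W"
         "a' \<in> sect X U'" "b' \<in> sect Y V'" "\<And>x y. x \<in> U' \<Longrightarrow> y \<in> V' \<Longrightarrow> t (x, y) = (a' x, b' y)"
        using lm_prod_sectE[OF t z] by blast
      have UU: "openin (space_of X) (U \<inter> U')" "openin (space_of Y) (V \<inter> V')" using 1 2 by auto
      have r: "restrict a (U \<inter> U') \<in> sect X (U \<inter> U')" "restrict b (V \<inter> V') \<in> sect Y (V \<inter> V')"
          "restrict a' (U \<inter> U') \<in> sect X (U \<inter> U')" "restrict b' (V \<inter> V') \<in> sect Y (V \<inter> V')"
        using XD(5)[OF 1(1,5) UU(1)] YD(5)[OF 1(2,6) UU(2)] XD(5)[OF 2(1,5) UU(1)] YD(5)[OF 2(2,6) UU(2)] by auto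
      have "\<forall>x\<in>U \<inter> U'. \<forall>y\<in>V \<inter> V'. ?st (x, y) = 
         ((\<lambda>x\<in>U \<inter> U'. restrict a (U \<inter> U') x \<otimes>\<^bsub>stalk X x\<^esub> restrict a' (U \<inter> U') x) x,
          (\<lambda>x\<in>V \<inter> V'. restrict b (V \<inter> V') x \<otimes>\<^bsub>stalk Y x\<^esub> restrict b' (V \<inter> V') x) y)"
        using 1(4,7) 2(4,7) by (auto simp: lm_prod_sel)
      moreover have "z \<in> (U \<inter> U') \<times> (V \<inter> V')" "(U \<inter> U') \<times> (V \<inter> V') \<subseteq> W" using 1 2 by auto
      ultimately show "\<exists>U V a b. openin (space_of X) U \<and> openin (space_of Y) V \<and> z \<in> U \<times> V \<and> U \<times> V \<subseteq> W \<and>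
          a \<in> sect X U \<and> b \<in> sect Y V \<and> (\<forall>x\<in>U. \<forall>y\<in>V. ?st (x, y) = (a x, b y))"
        using UU XD(4)[OF UU(1) r(1,3)] YD(4)[OF UU(2) r(2,4)] by blast
    qed simp
  next
    fix W s W' assume "openin (space_of ?P) W" "s \<in> sect ?P W" "openin (space_of ?P) W' \<and> W' \<subseteq> W"
    then show "restrict s W' \<in> sect ?P W'" using restr by blast
  next
    fix W s assume W: "openin (space_of ?P) W" and s: "s \<in> (\<Pi>\<^sub>E z\<in>W. carrier (stalk ?P z))"
      and loc: "\<forall>z\<in>W. \<exists>V. openin (space_of ?P) V \<and> z \<in> V \<and> V \<subseteq> W \<and> restrict s V \<in> sect ?P V"
    show "s \<in> sect ?P W"
    proof (rule lm_prod_sectI[OF X Y])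
      fix z assume z: "z \<in> W"
      obtain W' where W': "openin (space_of ?P) W'" "z \<in> W'" "W' \<subseteq> W" "restrict s W' \<in> sect ?P W'"
        using loc z by blast
      obtain U V a b where 1: "openin (space_of X) U" "openin (space_of Y) V" "z \<in> U \<times> V" "U \<times> V \<subseteq> W'"
         "a \<in> sect X U" "b \<in> sect Y V" "\<And>x y. x \<in> U \<Longrightarrow> y \<in> V \<Longrightarrow> restrict s W' (x, y) = (a x, b y)"
        using lm_prod_sectE[OF W'(4,2)] by blast
      have "\<forall>x\<in>U. \<forall>y\<in>V. s (x, y) = (a x, b y)"
      proof (intro ballI)
        fix x y assume "x \<in> U" "y \<in> V"
        then show "s (x, y) = (a x, b y)" using 1(7)[of x y] 1(4) by auto
      qed
      moreover have "U \<times> V \<subseteq> W" using 1(4) W'(3) by blast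
      ultimately show "\<exists>U V a b. openin (space_of X) U \<and> openin (space_of Y) V \<and> z \<in> U \<times> V \<and> U \<times> V \<subseteq> W \<and>
          a \<in> sect X U \<and> b \<in> sect Y V \<and> (\<forall>x\<in>U. \<forall>y\<in>V. s (x, y) = (a x, b y))"
        using 1 by blast
    qed (use s in \<open>simp add: PiE_def\<close>)
  next
    fix W s t z assume W: "openin (space_of ?P) W" and s: "s \<in> sect ?P W" and t: "t \<in> sect ?P W"
      and z: "z \<in> W" and eq: "s z = t z"
    obtain U V a b where 1: "openin (space_of X) U" "openin (space_of Y) V" "z \<in> U \<times> V" "U \<times> V \<subseteq> W"
       "a \<in> sect X U" "b \<in> sect Y V" "\<And>x y. x \<in> U \<Longrightarrow> y \<in> V \<Longrightarrow> s (x, y) = (a x, b y)"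
      using lm_prod_sectE[OF s z] by blast
    obtain U' V' a' b' where 2: "openin (space_of X) U'" "openin (space_of Y) V'" "z \<in> U' \<times> V'" "U' \<times> V' \<subseteq> W"
       "a' \<in> sect X U'" "b' \<in> sect Y V'" "\<And>x y. x \<in> U' \<Longrightarrow> y \<in> V' \<Longrightarrow> t (x, y) = (a' x, b' y)"
      using lm_prod_sectE[OF t z] by blast
    have UU: "openin (space_of X) (U \<inter> U')" "openin (space_of Y) (V \<inter> V')" using 1 2 by auto
    have r: "restrict a (U \<inter> U') \<in> sect X (U \<inter> U')" "restrict b (V \<inter> V') \<in> sect Y (V \<inter> V')"
        "restrict a' (U \<inter> U') \<in> sect X (U \<inter> U')" "restrict b' (V \<inter> V') \<in> sect Y (V \<inter> V')"
      using XD(5)[OF 1(1,5) UU(1)] YD(5)[OF 1(2,6) UU(2)] XD(5)[OF 2(1,5) UU(1)] YD(5)[OF 2(2,6) UU(2)] by auto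
    obtain x y where xy: "z = (x, y)" by (cases z)
    have m: "x \<in> U \<inter> U'" "y \<in> V \<inter> V'" using 1(3) 2(3) xy by auto
    have "a x = a' x" "b y = b' y" using eq 1(7)[of x y] 2(7)[of x y] m xy by auto
    then have e: "restrict a (U \<inter> U') x = restrict a' (U \<inter> U') x" "restrict b (V \<inter> V') y = restrict b' (V \<inter> V') y"
      using m by auto
    obtain U2 where U2: "openin (space_of X) U2" "x \<in> U2" "U2 \<subseteq> U \<inter> U'"
      "restrict (restrict a (U \<inter> U')) U2 = restrict (restrict a' (U \<inter> U')) U2"
      using XD(7)[OF UU(1) r(1,3) m(1) e(1)] by blast
    obtain V2 where V2: "openin (space_of Y) V2" "y \<in> V2" "V2 \<subseteq> V \<inter> V'"
      "restrict (restrict b (V \<inter> V')) V2 = restrict (restrict b' (V \<inter> V')) V2"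
      using YD(7)[OF UU(2) r(2,4) m(2) e(2)] by blast
    have "s (x', y') = t (x', y')" if p: "x' \<in> U2" "y' \<in> V2" for x' y'
    proof -
      have i: "x' \<in> U" "x' \<in> U'" "y' \<in> V" "y' \<in> V'" using p U2 V2 by auto
      have "a x' = a' x'" "b y' = b' y'" using fun_cong[OF U2(4), of x'] fun_cong[OF V2(4), of y'] p i by auto
      then show ?thesis using 1(7)[OF i(1,3)] 2(7)[OF i(2,4)] by simp
    qed
    then have "restrict s (U2 \<times> V2) = restrict t (U2 \<times> V2)" by (intro restrict_ext) auto
    moreover have "openin (space_of ?P) (U2 \<times> V2)" "z \<in> U2 \<times> V2" "U2 \<times> V2 \<subseteq> W"
      subgoal unfolding lm_prod_sel by (simp add: openin_prod_Times_iff U2 V2)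
      subgoal using U2 V2 xy by simp
      subgoal using U2(3) V2(3) 1(4) by blast
      done
    ultimately show "\<exists>V. openin (space_of ?P) V \<and> z \<in> V \<and> V \<subseteq> W \<and> restrict s V = restrict t V"
      by blast
  next
    fix z c assume z: "z \<in> points ?P" and c: "c \<in> carrier (stalk ?P z)"
    obtain x y where xy: "z = (x, y)" by (cases z)
    obtain a b where ab: "c = (a, b)" by (cases c)
    have p: "x \<in> points X" "y \<in> points Y" using z xy unfolding lm_prod_sel by auto
    have q: "a \<in> carrier (stalk X x)" "b \<in> carrier (stalk Y y)" using c xy ab unfolding lm_prod_sel by auto
    obtain U s where s: "openin (space_of X) U" "x \<in> U" "s \<in> sect X U" "s x = a" using XD(8)[OF p(1) q(1)] by blast
    obtain V t where t: "openin (space_of Y) V" "y \<in> V" "t \<in> sect Y V" "t y = b" using YD(8)[OF p(2) q(2)] by blast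
    let ?r = "\<lambda>z\<in>U \<times> V. (s (fst z), t (snd z))"
    have "?r \<in> sect ?P (U \<times> V)"
    proof (rule lm_prod_sectI[OF X Y])
      fix z assume z: "z \<in> U \<times> V"
      have "\<forall>x\<in>U. \<forall>y\<in>V. ?r (x, y) = (s x, t y)" by simp
      then show "\<exists>U' V' a b. openin (space_of X) U' \<and> openin (space_of Y) V' \<and> z \<in> U' \<times> V' \<and> U' \<times> V' \<subseteq> U \<times> V \<and>
          a \<in> sect X U' \<and> b \<in> sect Y V' \<and> (\<forall>x\<in>U'. \<forall>y\<in>V'. ?r (x, y) = (a x, b y))"
        using s t z by blast
    qed simp
    moreover have "?r z = c" using s t xy ab by simp
    moreover have "openin (space_of ?P) (U \<times> V)" "z \<in> U \<times> V"
      unfolding lm_prod_sel using s t xy by (simp_all add: openin_prod_Times_iff)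
    ultimately show "\<exists>U. openin (space_of ?P) U \<and> z \<in> U \<and> (\<exists>s\<in>sect ?P U. s z = c)" by blast
  qed
qed

lemma mon_homD:
  assumes "h \<in> mon_hom P Q"
  shows "p \<in> carrier P \<Longrightarrow> h p \<in> carrier Q"
    and "p \<in> carrier P \<Longrightarrow> q \<in> carrier P \<Longrightarrow> h (p \<otimes>\<^bsub>P\<^esub> q) = h p \<otimes>\<^bsub>Q\<^esub> h q"
    and "h \<one>\<^bsub>P\<^esub> = \<one>\<^bsub>Q\<^esub>" and "h \<in> extensional (carrier P)"
  using assms unfolding mon_hom_def hom_def by auto

lemma mon_homI:
  assumes "\<And>p. p \<in> carrier P \<Longrightarrow> h p \<in> carrier Q"
    and "\<And>p q. p \<in> carrier P \<Longrightarrow> q \<in> carrier P \<Longrightarrow> h (p \<otimes>\<^bsub>P\<^esub> q) = h p \<otimes>\<^bsub>Q\<^esub> h q"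
    and "h \<one>\<^bsub>P\<^esub> = \<one>\<^bsub>Q\<^esub>" and "h \<in> extensional (carrier P)"
  shows "h \<in> mon_hom P Q"
  using assms unfolding mon_hom_def hom_def by auto

lemma Units_DirProd: 
  assumes "comm_monoid P" "comm_monoid Q"
  shows "Units (P \<times>\<times> Q) = Units P \<times> Units Q"
  unfolding Units_def by (auto; blast)

lemma local_homD: "local_hom Q P h \<Longrightarrow> q \<in> carrier Q \<Longrightarrow> h q \<in> Units P \<longleftrightarrow> q \<in> Units Q"
  unfolding local_hom_def by blast

lemma local_homI: "(\<And>q. q \<in> carrier Q \<Longrightarrow> h q \<in> Units P \<longleftrightarrow> q \<in> Units Q) \<Longrightarrow> local_hom Q P h"
  unfolding local_hom_def Units_def by blast

lemma inc_hom:
  assumes "comm_monoid P" "comm_monoid Q"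
  shows "inc_l P Q \<in> mon_hom P (P \<times>\<times> Q)" "inc_r P Q \<in> mon_hom Q (P \<times>\<times> Q)"
    "local_hom P (P \<times>\<times> Q) (inc_l P Q)" "local_hom Q (P \<times>\<times> Q) (inc_r P Q)"
proof -
  interpret P: comm_monoid P by fact
  interpret Q: comm_monoid Q by fact
  show "inc_l P Q \<in> mon_hom P (P \<times>\<times> Q)" "inc_r P Q \<in> mon_hom Q (P \<times>\<times> Q)"
    by (auto intro!: mon_homI simp: inc_l_def inc_r_def)
  show "local_hom P (P \<times>\<times> Q) (inc_l P Q)" "local_hom Q (P \<times>\<times> Q) (inc_r P Q)"
    by (rule local_homI, simp add: Units_DirProd[OF assms] inc_l_def inc_r_def)+
qed

lemma (in comm_monoid) Units_mult_iff:
  assumes "a \<in> carrier G" "b \<in> carrier G"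
  shows "a \<otimes> b \<in> Units G \<longleftrightarrow> a \<in> Units G \<and> b \<in> Units G"
proof
  assume "a \<otimes> b \<in> Units G"
  then obtain c where c: "c \<in> carrier G" "c \<otimes> (a \<otimes> b) = \<one>" unfolding Units_def by blast
  have "(b \<otimes> c) \<otimes> a = \<one>" "(a \<otimes> c) \<otimes> b = \<one>" "a \<otimes> (b \<otimes> c) = \<one>" "b \<otimes> (a \<otimes> c) = \<one>"
    unfolding c(2)[symmetric] using assms c(1) by (simp_all add: m_ac)
  then show "a \<in> Units G \<and> b \<in> Units G"
    unfolding Units_def using assms c(1) by blast
qed auto

lemma copair_hom:
  assumes "comm_monoid P" "comm_monoid Q" "comm_monoid R" 
    and h: "h \<in> mon_hom P R" and k: "k \<in> mon_hom Q R"
  shows "copair P Q R h k \<in> mon_hom (P \<times>\<times> Q) R"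
    and "local_hom P R h \<Longrightarrow> local_hom Q R k \<Longrightarrow> local_hom (P \<times>\<times> Q) R (copair P Q R h k)"
proof -
  interpret P: comm_monoid P by fact
  interpret Q: comm_monoid Q by fact
  interpret R: comm_monoid R by fact
  note hD = mon_homD[OF h] and kD = mon_homD[OF k]
  show "copair P Q R h k \<in> mon_hom (P \<times>\<times> Q) R"
    by (rule mon_homI) (auto simp: copair_def hD kD R.m_ac)
  assume lh: "local_hom P R h" and lk: "local_hom Q R k"
  show "local_hom (P \<times>\<times> Q) R (copair P Q R h k)"
    by (rule local_homI)
      (auto simp: copair_def R.Units_mult_iff hD kD local_homD[OF lh] local_homD[OF lk] 
        Units_DirProd[OF assms(1,2)])
qed

lemma lm_homI:
  assumes "continuous_map (space_of X) (space_of Y) (pt f)"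
    and "pt f \<in> extensional (points X)" and "st f \<in> extensional (points X)"
    and "\<And>x. x \<in> points X \<Longrightarrow> st f x \<in> mon_hom (stalk Y (pt f x)) (stalk X x)"
    and "\<And>x. x \<in> points X \<Longrightarrow> local_hom (stalk Y (pt f x)) (stalk X x) (st f x)"
    and "\<And>V s. openin (space_of Y) V \<Longrightarrow> s \<in> sect Y V \<Longrightarrow>
      (\<lambda>x\<in>{x\<in>points X. pt f x \<in> V}. st f x (s (pt f x))) \<in> sect X {x\<in>points X. pt f x \<in> V}"
  shows "f \<in> lm_hom X Y"
  using assms unfolding lm_hom_def by blast

lemma lm_map_eqI:
  fixes f g :: "('x, 'm, 'y, 'n) lmmap"
  assumes "pt f = pt g" "st f = st g" shows "f = g"
  using assms by (cases f, cases g) simp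

theorem lm_fst_hom:
  assumes X: "locally_monoidal X" and Y: "locally_monoidal Y"
  shows "lm_fst X Y \<in> lm_hom (lm_prod X Y) X"
proof (rule lm_homI)
  note XD = locally_monoidalD[OF X] and YD = locally_monoidalD[OF Y]
  show "continuous_map (space_of (lm_prod X Y)) (space_of X) (pt (lm_fst X Y))"
    unfolding lm_prod_sel by (rule continuous_map_eq[OF continuous_map_fst]) (simp add: lm_fst_def)
  show "pt (lm_fst X Y) \<in> extensional (points (lm_prod X Y))" 
       "st (lm_fst X Y) \<in> extensional (points (lm_prod X Y))"
    unfolding lm_prod_sel by (simp_all add: lm_fst_def)
  show "st (lm_fst X Y) z \<in> mon_hom (stalk X (pt (lm_fst X Y) z)) (stalk (lm_prod X Y) z)"
       "local_hom (stalk X (pt (lm_fst X Y) z)) (stalk (lm_prod X Y) z) (st (lm_fst X Y) z)"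
    if "z \<in> points (lm_prod X Y)" for z
    using that XD(1) YD(1) unfolding lm_prod_sel by (auto simp: lm_fst_def inc_hom)
  fix V s assume V: "openin (space_of X) V" and s: "s \<in> sect X V"
  have VX: "V \<subseteq> points X" using V by (rule openin_subset)
  have e: "{z \<in> points (lm_prod X Y). pt (lm_fst X Y) z \<in> V} = V \<times> points Y"
    unfolding lm_prod_sel using VX by (auto simp: lm_fst_def)
  show "(\<lambda>z\<in>{z \<in> points (lm_prod X Y). pt (lm_fst X Y) z \<in> V}. st (lm_fst X Y) z (s (pt (lm_fst X Y) z)))
       \<in> sect (lm_prod X Y) {z \<in> points (lm_prod X Y). pt (lm_fst X Y) z \<in> V}" (is "?s \<in> _")
    unfolding e
  proof (rule lm_prod_sectI[OF X Y])
    fix z assume z: "z \<in> V \<times> points Y"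
    have "\<forall>x\<in>V. \<forall>y\<in>points Y. (\<lambda>z\<in>V \<times> points Y. st (lm_fst X Y) z (s (pt (lm_fst X Y) z))) (x, y) 
        = (s x, (\<lambda>y\<in>points Y. \<one>\<^bsub>stalk Y y\<^esub>) y)"
      using VX PiE_mem[OF XD(2)[OF V s]] by (auto simp: lm_fst_def inc_l_def)
    then show "\<exists>U Va a b. openin (space_of X) U \<and> openin (space_of Y) Va \<and> z \<in> U \<times> Va \<and> U \<times> Va \<subseteq> V \<times> points Y \<and>
      a \<in> sect X U \<and> b \<in> sect Y Va \<and> (\<forall>x\<in>U. \<forall>y\<in>Va. (\<lambda>z\<in>V \<times> points Y. st (lm_fst X Y) z (s (pt (lm_fst X Y) z))) (x, y) = (a x, b y))"
      using V s z YD(3)[OF openin_topspace] openin_topspace[of "space_of Y"] by blast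
  qed simp
qed

theorem lm_snd_hom:
  assumes X: "locally_monoidal X" and Y: "locally_monoidal Y"
  shows "lm_snd X Y \<in> lm_hom (lm_prod X Y) Y"
proof (rule lm_homI)
  note XD = locally_monoidalD[OF X] and YD = locally_monoidalD[OF Y]
  show "continuous_map (space_of (lm_prod X Y)) (space_of Y) (pt (lm_snd X Y))"
    unfolding lm_prod_sel by (rule continuous_map_eq[OF continuous_map_snd]) (simp add: lm_snd_def)
  show "pt (lm_snd X Y) \<in> extensional (points (lm_prod X Y))" 
       "st (lm_snd X Y) \<in> extensional (points (lm_prod X Y))"
    unfolding lm_prod_sel by (simp_all add: lm_snd_def)
  show "st (lm_snd X Y) z \<in> mon_hom (stalk Y (pt (lm_snd X Y) z)) (stalk (lm_prod X Y) z)"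
       "local_hom (stalk Y (pt (lm_snd X Y) z)) (stalk (lm_prod X Y) z) (st (lm_snd X Y) z)"
    if "z \<in> points (lm_prod X Y)" for z
    using that XD(1) YD(1) unfolding lm_prod_sel by (auto simp: lm_snd_def inc_hom)
  fix V s assume V: "openin (space_of Y) V" and s: "s \<in> sect Y V"
  have VX: "V \<subseteq> points Y" using V by (rule openin_subset)
  have e: "{z \<in> points (lm_prod X Y). pt (lm_snd X Y) z \<in> V} = points X \<times> V"
    unfolding lm_prod_sel using VX by (auto simp: lm_snd_def)
  show "(\<lambda>z\<in>{z \<in> points (lm_prod X Y). pt (lm_snd X Y) z \<in> V}. st (lm_snd X Y) z (s (pt (lm_snd X Y) z)))
       \<in> sect (lm_prod X Y) {z \<in> points (lm_prod X Y). pt (lm_snd X Y) z \<in> V}" (is "?s \<in> _")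
    unfolding e
  proof (rule lm_prod_sectI[OF X Y])
    fix z assume z: "z \<in> points X \<times> V"
    have "\<forall>x\<in>points X. \<forall>y\<in>V. (\<lambda>z\<in>points X \<times> V. st (lm_snd X Y) z (s (pt (lm_snd X Y) z))) (x, y) 
        = ((\<lambda>y\<in>points X. \<one>\<^bsub>stalk X y\<^esub>) x, s y)"
      using VX PiE_mem[OF YD(2)[OF V s]] by (auto simp: lm_snd_def inc_r_def)
    then show "\<exists>U Va a b. openin (space_of X) U \<and> openin (space_of Y) Va \<and> z \<in> U \<times> Va \<and> U \<times> Va \<subseteq> points X \<times> V \<and>
      a \<in> sect X U \<and> b \<in> sect Y Va \<and> (\<forall>x\<in>U. \<forall>y\<in>Va. (\<lambda>z\<in>points X \<times> V. st (lm_snd X Y) z (s (pt (lm_snd X Y) z))) (x, y) = (a x, b y))"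
      using V s z XD(3)[OF openin_topspace] openin_topspace[of "space_of X"] by blast
  qed simp
qed

theorem lm_pair_hom:
  assumes T: "locally_monoidal T" and X: "locally_monoidal X" and Y: "locally_monoidal Y"
    and f: "f \<in> lm_hom T X" and g: "g \<in> lm_hom T Y"
  shows "lm_pair T X Y f g \<in> lm_hom T (lm_prod X Y)" (is "?h \<in> _")
proof (rule lm_homI)
  note TD = locally_monoidalD[OF T] and XD = locally_monoidalD[OF X] and YD = locally_monoidalD[OF Y]
  note fD = lm_homD[OF f] and gD = lm_homD[OF g]
  have pth: "pt ?h t = (pt f t, pt g t)" "st ?h t = copair (stalk X (pt f t)) (stalk Y (pt g t)) (stalk T t) (st f t) (st g t)"
    if "t \<in> points T" for t using that by (simp_all add: lm_pair_def)
  show cont: "continuous_map (space_of T) (space_of (lm_prod X Y)) (pt ?h)"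
    unfolding lm_prod_sel
    by (rule continuous_map_eq[of _ _ "\<lambda>t. (pt f t, pt g t)"]) 
      (simp_all add: continuous_map_paired fD gD pth)
  show "pt ?h \<in> extensional (points T)" "st ?h \<in> extensional (points T)"
    by (simp_all add: lm_pair_def)
  show "st ?h t \<in> mon_hom (stalk (lm_prod X Y) (pt ?h t)) (stalk T t)"
    "local_hom (stalk (lm_prod X Y) (pt ?h t)) (stalk T t) (st ?h t)" if t: "t \<in> points T" for t
    using copair_hom[OF XD(1)[OF fD(7)[OF t]] YD(1)[OF gD(7)[OF t]] TD(1)[OF t] fD(4)[OF t] gD(4)[OF t]]
      fD(5)[OF t] gD(5)[OF t]
    unfolding pth[OF t] lm_prod_sel by auto
  fix W s assume W: "openin (space_of (lm_prod X Y)) W" and s: "s \<in> sect (lm_prod X Y) W"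
  let ?W = "{t \<in> points T. pt ?h t \<in> W}" 
  let ?s = "\<lambda>t\<in>?W. st ?h t (s (pt ?h t))"
  have Wo: "openin (space_of T) ?W" by (rule openin_continuous_map_preimage[OF cont W])
  have loc: "\<exists>N. openin (space_of T) N \<and> t \<in> N \<and> N \<subseteq> ?W \<and> restrict ?s N \<in> sect T N \<and> ?s t \<in> carrier (stalk T t)" if t: "t \<in> ?W" for t
  proof -
    have tT: "t \<in> points T" and tW: "pt ?h t \<in> W" using t by auto
    obtain U V a b where 1: "openin (space_of X) U" "openin (space_of Y) V" "pt ?h t \<in> U \<times> V" "U \<times> V \<subseteq> W"
       "a \<in> sect X U" "b \<in> sect Y V" "\<And>x y. x \<in> U \<Longrightarrow> y \<in> V \<Longrightarrow> s (x, y) = (a x, b y)"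
      using lm_prod_sectE[OF s tW] by blast
    let ?U = "{t \<in> points T. pt f t \<in> U}" and ?V = "{t \<in> points T. pt g t \<in> V}"
    let ?N = "?U \<inter> ?V"
    let ?a = "restrict (\<lambda>t\<in>?U. st f t (a (pt f t))) ?N"
    let ?b = "restrict (\<lambda>t\<in>?V. st g t (b (pt g t))) ?N"
    have o: "openin (space_of T) ?U" "openin (space_of T) ?V"
      using openin_continuous_map_preimage[OF fD(1) 1(1)] openin_continuous_map_preimage[OF gD(1) 1(2)] .
    have N: "openin (space_of T) ?N" using o by (rule openin_Int)
    have a: "?a \<in> sect T ?N" by (rule TD(5)[OF o(1) fD(6)[OF 1(1,5)] N]) blast
    have b: "?b \<in> sect T ?N" by (rule TD(5)[OF o(2) gD(6)[OF 1(2,6)] N]) blast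
    have ac: "a x \<in> carrier (stalk X x)" if "x \<in> U" for x using PiE_mem[OF XD(2)[OF 1(1,5)] that] .
    have bc: "b x \<in> carrier (stalk Y x)" if "x \<in> V" for x using PiE_mem[OF YD(2)[OF 1(2,6)] that] .
    have NW: "?N \<subseteq> ?W" using pth 1(4) by auto
    have tN: "t \<in> ?N" using pth[OF tT] 1(3) tT by auto
    have "restrict ?s ?N = (\<lambda>t\<in>?N. ?a t \<otimes>\<^bsub>stalk T t\<^esub> ?b t)" 
    proof (rule restrict_ext)
      fix u assume u: "u \<in> ?N"
      then have "u \<in> ?W" using NW by blast
      then show "?s u = ?a u \<otimes>\<^bsub>stalk T u\<^esub> ?b u"
        using u subsetD[OF 1(4), of "(pt f u, pt g u)"] by (simp add: pth 1(7) copair_def ac bc)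
    qed
    moreover have "(\<lambda>t\<in>?N. ?a t \<otimes>\<^bsub>stalk T t\<^esub> ?b t) \<in> sect T ?N" by (rule TD(4)[OF N a b])
    ultimately have r: "restrict ?s ?N \<in> sect T ?N" by simp
    have "?s t \<in> carrier (stalk T t)" using PiE_mem[OF TD(2)[OF N r] tN] tN by simp
    then show ?thesis using N NW tN r by blast
  qed
  have "?s \<in> (\<Pi>\<^sub>E t\<in>?W. carrier (stalk T t))"
    by (rule PiE_I) (use loc in \<open>auto\<close>)
  then show "?s \<in> sect T ?W"
    by (rule TD(6)[OF Wo]) (use loc in blast)
qed


lemma lm_comp_ext: "st (lm_comp X Z g f) \<in> extensional (points X)"
  by (simp add: lm_comp_def)

theorem lm_fst_pair:
  assumes T: "locally_monoidal T" and X: "locally_monoidal X" and Y: "locally_monoidal Y"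
    and f: "f \<in> lm_hom T X" and g: "g \<in> lm_hom T Y"
  shows "lm_comp T X (lm_fst X Y) (lm_pair T X Y f g) = f"
    and "lm_comp T Y (lm_snd X Y) (lm_pair T X Y f g) = g"
proof -
  note fD = lm_homD[OF f] and gD = lm_homD[OF g]
  have 1: "st (lm_comp T X (lm_fst X Y) (lm_pair T X Y f g)) t = st f t" 
    "st (lm_comp T Y (lm_snd X Y) (lm_pair T X Y f g)) t = st g t" if t: "t \<in> points T" for t
  proof -
    interpret M: comm_monoid "stalk T t" using locally_monoidalD(1)[OF T t] .
    interpret A: comm_monoid "stalk X (pt f t)" using locally_monoidalD(1)[OF X fD(7)[OF t]] .
    interpret B: comm_monoid "stalk Y (pt g t)" using locally_monoidalD(1)[OF Y gD(7)[OF t]] .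
    note F = mon_homD[OF fD(4)[OF t]] and G = mon_homD[OF gD(4)[OF t]]
    show "st (lm_comp T X (lm_fst X Y) (lm_pair T X Y f g)) t = st f t"
      by (rule extensionalityI[OF _ F(4)]) 
       (use t in \<open>simp_all add: lm_comp_def lm_fst_def lm_pair_def copair_def inc_l_def F G fD(7) gD(7)\<close>)
    show "st (lm_comp T Y (lm_snd X Y) (lm_pair T X Y f g)) t = st g t"
      by (rule extensionalityI[OF _ G(4)]) 
       (use t in \<open>simp_all add: lm_comp_def lm_snd_def lm_pair_def copair_def inc_r_def F G fD(7) gD(7)\<close>)
  qed
  show "lm_comp T X (lm_fst X Y) (lm_pair T X Y f g) = f"
  proof (rule lm_map_eqI)
    show "pt (lm_comp T X (lm_fst X Y) (lm_pair T X Y f g)) = pt f"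
      by (rule extensionalityI[OF _ fD(2)]) (simp_all add: lm_comp_def lm_fst_def lm_pair_def fD(7) gD(7))
    show "st (lm_comp T X (lm_fst X Y) (lm_pair T X Y f g)) = st f"
      by (rule extensionalityI[OF lm_comp_ext fD(3)]) (rule 1)
  qed
  show "lm_comp T Y (lm_snd X Y) (lm_pair T X Y f g) = g"
  proof (rule lm_map_eqI)
    show "pt (lm_comp T Y (lm_snd X Y) (lm_pair T X Y f g)) = pt g"
      by (rule extensionalityI[OF _ gD(2)]) (simp_all add: lm_comp_def lm_snd_def lm_pair_def fD(7) gD(7))
    show "st (lm_comp T Y (lm_snd X Y) (lm_pair T X Y f g)) = st g"
      by (rule extensionalityI[OF lm_comp_ext gD(3)]) (rule 1)
  qed
qed

theorem lm_pair_unique: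
  assumes T: "locally_monoidal T" and X: "locally_monoidal X" and Y: "locally_monoidal Y"
    and h: "h \<in> lm_hom T (lm_prod X Y)"
  shows "h = lm_pair T X Y (lm_comp T X (lm_fst X Y) h) (lm_comp T Y (lm_snd X Y) h)" (is "_ = ?h")
proof -
  note hD = lm_homD[OF h]
  have p: "pt ?h t = pt h t \<and> st ?h t = st h t" if t: "t \<in> points T" for t
  proof -
    obtain x y where xy: "pt h t = (x, y)" by (cases "pt h t")
    have x: "x \<in> points X" and y: "y \<in> points Y" using hD(7)[OF t] xy unfolding lm_prod_sel by auto
    interpret M: comm_monoid "stalk T t" using locally_monoidalD(1)[OF T t] .
    interpret A: comm_monoid "stalk X x" using locally_monoidalD(1)[OF X x] .
    interpret B: comm_monoid "stalk Y y" using locally_monoidalD(1)[OF Y y] .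
    have "st h t \<in> mon_hom (stalk X x \<times>\<times> stalk Y y) (stalk T t)"
      using hD(4)[OF t] unfolding lm_prod_sel xy by simp
    note H = mon_homD[OF this]
    have e: "st h t (a, b) = st h t (a, \<one>\<^bsub>stalk Y y\<^esub>) \<otimes>\<^bsub>stalk T t\<^esub> st h t (\<one>\<^bsub>stalk X x\<^esub>, b)"
      if "a \<in> carrier (stalk X x)" "b \<in> carrier (stalk Y y)" for a b
      using that by (subst H(2)[symmetric]) auto
    have "st ?h t = st h t"
      by (rule extensionalityI[OF _ H(4)])
        (use t x y xy in \<open>auto simp: lm_pair_def lm_comp_def lm_fst_def lm_snd_def copair_def inc_l_def inc_r_def e[symmetric]\<close>)
    moreover have "pt ?h t = pt h t"
      using t x y xy by (simp add: lm_pair_def lm_comp_def lm_fst_def lm_snd_def)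
    ultimately show ?thesis by simp
  qed
  have "pt ?h = pt h" 
    by (rule extensionalityI[OF _ hD(2)]) (use p in simp_all, simp add: lm_pair_def)
  moreover have "st ?h = st h" 
    by (rule extensionalityI[OF _ hD(3)]) (use p in simp_all, simp add: lm_pair_def)
  ultimately show ?thesis by (intro lm_map_eqI) simp_all
qed

lemma face_vimage:
  assumes "comm_monoid P" "comm_monoid Q" and h: "h \<in> mon_hom Q P" and F: "F \<in> faces P"
  shows "{q \<in> carrier Q. h q \<in> F} \<in> faces Q"
proof -
  interpret P: comm_monoid P by fact
  interpret Q: comm_monoid Q by fact
  note hD = mon_homD[OF h]
  have "submonoid {q \<in> carrier Q. h q \<in> F} Q"
    by (rule submonoid.intro) (auto simp: hD(2,3) facesD(2,3)[OF F])
  moreover have "p \<in> {q \<in> carrier Q. h q \<in> F} \<and> q \<in> {q \<in> carrier Q. h q \<in> F}"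
    if c: "p \<in> carrier Q" "q \<in> carrier Q" and m: "p \<otimes>\<^bsub>Q\<^esub> q \<in> {q \<in> carrier Q. h q \<in> F}" for p q
  proof -
    have i: "h p \<otimes>\<^bsub>P\<^esub> h q \<in> F" using m hD(2)[OF c] by simp
    show ?thesis
      using facesD(4)[OF F hD(1)[OF c(1)] hD(1)[OF c(2)] i] facesD(5)[OF F hD(1)[OF c(1)] hD(1)[OF c(2)] i] c
      by simp
  qed
  ultimately show ?thesis unfolding faces_def by blast
qed

lemma Spec_map_sel:
  assumes "F \<in> faces P"
  shows "pt (Spec_map Q P h) F = {q \<in> carrier Q. h q \<in> F}"
  using assms by (simp add: Spec_map_def)

lemma Spec_map_frac:
  fixes P :: "'a monoid" and Q :: "'b monoid"
  assumes P: "comm_monoid P" and Q: "comm_monoid Q" and h: "h \<in> mon_hom Q P" and F: "F \<in> faces P"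
    and q: "q \<in> carrier Q" and g: "g \<in> {q \<in> carrier Q. h q \<in> F}"
  shows "st (Spec_map Q P h) F (loc_frac Q {q \<in> carrier Q. h q \<in> F} q g) = loc_frac P F (h q) (h g)"
proof -
  interpret P: comm_monoid P by fact
  interpret Q: comm_monoid Q by fact
  note hD = mon_homD[OF h]
  let ?F = "{q \<in> carrier Q. h q \<in> F}"
  have F': "?F \<in> faces Q" by (rule face_vimage[OF P Q h F])
  have "st (Spec_map Q P h) F (loc_frac Q ?F q g) = (\<Union>(q, g)\<in>loc_frac Q ?F q g. loc_frac P F (h q) (h g))"
    using Q.frac_in_carrier[OF q g] F by (simp add: Spec_map_def)
  also have "\<dots> = loc_frac P F (h q) (h g)"
  proof (rule Q.UN_frac[OF F' q g])
    fix q' g' assume 1: "q' \<in> carrier Q" "g' \<in> ?F" "loc_frac Q ?F q' g' = loc_frac Q ?F q g"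
    then obtain k where k: "k \<in> ?F" "q' \<otimes>\<^bsub>Q\<^esub> g \<otimes>\<^bsub>Q\<^esub> k = q \<otimes>\<^bsub>Q\<^esub> g' \<otimes>\<^bsub>Q\<^esub> k"
      using Q.frac_eq_iff[OF F' 1(1) q 1(2) g] by blast
    have "h q' \<otimes>\<^bsub>P\<^esub> h g \<otimes>\<^bsub>P\<^esub> h k = h q \<otimes>\<^bsub>P\<^esub> h g' \<otimes>\<^bsub>P\<^esub> h k"
    proof -
      have c: "g \<in> carrier Q" "g' \<in> carrier Q" "k \<in> carrier Q" using 1(2) g k(1) by auto
      have "h (q' \<otimes>\<^bsub>Q\<^esub> g \<otimes>\<^bsub>Q\<^esub> k) = h q' \<otimes>\<^bsub>P\<^esub> h g \<otimes>\<^bsub>P\<^esub> h k" using 1(1) c by (simp add: hD(2))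
      moreover have "h (q \<otimes>\<^bsub>Q\<^esub> g' \<otimes>\<^bsub>Q\<^esub> k) = h q \<otimes>\<^bsub>P\<^esub> h g' \<otimes>\<^bsub>P\<^esub> h k" using q c by (simp add: hD(2))
      ultimately show ?thesis using k(2) by simp
    qed
    then show "loc_frac P F (h q') (h g') = loc_frac P F (h q) (h g)"
      using P.frac_eq_iff[OF F hD(1)[OF 1(1)] hD(1)[OF q], of "h g'" "h g"] 1(2) g k(1) by blast
  qed
  finally show ?thesis .
qed

theorem Spec_map_hom:
  fixes P :: "'a monoid" and Q :: "'b monoid"
  assumes P: "comm_monoid P" and Q: "comm_monoid Q" and h: "h \<in> mon_hom Q P"
  shows "Spec_map Q P h \<in> lm_hom (Spec P) (Spec Q)" (is "?f \<in> _")
proof (rule lm_homI)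
  interpret P: comm_monoid P by fact
  interpret Q: comm_monoid Q by fact
  note hD = mon_homD[OF h]
  note sel = P.Spec_sel Q.Spec_sel P.topspace_Tp Q.topspace_Tp
  let ?pre = "\<lambda>F. {q \<in> carrier Q. h q \<in> F}"
  have pre: "?pre F \<in> faces Q" if "F \<in> faces P" for F using face_vimage[OF P Q h that] .
  have preb: "?pre F \<in> spec_basic Q q" if "F \<in> spec_basic P (h q)" "q \<in> carrier Q" for F q
    using that pre by (simp add: spec_basic_def)
  show cont: "continuous_map (space_of (Spec P)) (space_of (Spec Q)) (pt ?f)"
    unfolding continuous_map sel
  proof (intro conjI allI impI)
    show "pt ?f ` faces P \<subseteq> faces Q" using pre by (auto simp: Spec_map_sel)
    fix U assume U: "openin Q.Tp U"
    show "openin P.Tp {x \<in> faces P. pt ?f x \<in> U}"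
      unfolding P.openin_Tp
    proof (intro conjI ballI)
      fix F assume F: "F \<in> {x \<in> faces P. pt ?f x \<in> U}"
      then have FF: "F \<in> faces P" "?pre F \<in> U" by (auto simp: Spec_map_sel)
      obtain q where q: "q \<in> ?pre F" "spec_basic Q q \<subseteq> U" using Q.openin_TpE[OF U FF(2)] by blast
      have "spec_basic P (h q) \<subseteq> {x \<in> faces P. pt ?f x \<in> U}"
      proof
        fix H assume H: "H \<in> spec_basic P (h q)"
        then have "H \<in> faces P" by (simp add: spec_basic_def)
        then show "H \<in> {x \<in> faces P. pt ?f x \<in> U}" using preb[OF H] q by (auto simp: Spec_map_sel)
      qed
      then show "\<exists>p\<in>F. spec_basic P p \<subseteq> {x \<in> faces P. pt ?f x \<in> U}" using q by blast
    qed simp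
  qed
  show "pt ?f \<in> extensional (points (Spec P))" "st ?f \<in> extensional (points (Spec P))"
    unfolding sel by (simp_all add: Spec_map_def)
  fix F assume "F \<in> points (Spec P)"
  then have F: "F \<in> faces P" unfolding sel .
  note pF = pre[OF F]
  have ev: "st ?f F (loc_frac Q (?pre F) q g) = loc_frac P F (h q) (h g)" 
    if "q \<in> carrier Q" "g \<in> ?pre F" for q g using Spec_map_frac[OF P Q h F that] .
  have "st ?f F \<in> mon_hom (localization Q (?pre F)) (localization P F)"
  proof (rule mon_homI)
    fix A assume "A \<in> carrier (localization Q (?pre F))"
    then obtain q g where 1: "q \<in> carrier Q" "g \<in> ?pre F" "A = loc_frac Q (?pre F) q g"
      by (rule Q.localization_cases)
    show "st ?f F A \<in> carrier (localization P F)"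
      unfolding 1(3) ev[OF 1(1,2)] by (rule P.frac_in_carrier) (use 1 hD(1) in auto)
  next
    fix A B assume A: "A \<in> carrier (localization Q (?pre F))" and B: "B \<in> carrier (localization Q (?pre F))"
    obtain q g where 11: "q \<in> carrier Q" "g \<in> ?pre F" "A = loc_frac Q (?pre F) q g"
      using A by (rule Q.localization_cases)
    obtain r k where 12: "r \<in> carrier Q" "k \<in> ?pre F" "B = loc_frac Q (?pre F) r k"
      using B by (rule Q.localization_cases)
    note 1 = 11 12
    have 2: "q \<otimes>\<^bsub>Q\<^esub> r \<in> carrier Q" "g \<otimes>\<^bsub>Q\<^esub> k \<in> ?pre F" using 1 facesD(3)[OF pF] by blast+
    have 3: "h g \<in> F" "h k \<in> F" "g \<in> carrier Q" "k \<in> carrier Q" using 1 by auto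
    show "st ?f F (A \<otimes>\<^bsub>localization Q (?pre F)\<^esub> B) = st ?f F A \<otimes>\<^bsub>localization P F\<^esub> st ?f F B"
      unfolding 1(3,6) Q.frac_mult[OF pF 1(1,4,2,5)] ev[OF 2] ev[OF 1(1,2)] ev[OF 1(4,5)]
        P.frac_mult[OF F hD(1)[OF 1(1)] hD(1)[OF 1(4)] 3(1,2)] hD(2)[OF 1(1,4)] hD(2)[OF 3(3,4)] ..
  next
    show "st ?f F \<one>\<^bsub>localization Q (?pre F)\<^esub> = \<one>\<^bsub>localization P F\<^esub>"
      unfolding Q.localization_one P.localization_one ev[OF Q.one_closed facesD(2)[OF pF]] hD(3) ..
  next
    show "st ?f F \<in> extensional (carrier (localization Q (?pre F)))"
      using F by (simp add: Spec_map_def)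
  qed
  then show "st ?f F \<in> mon_hom (stalk (Spec Q) (pt ?f F)) (stalk (Spec P) F)"
    unfolding sel Spec_map_sel[OF F] .
  have "local_hom (localization Q (?pre F)) (localization P F) (st ?f F)"
  proof (rule local_homI)
    fix A assume "A \<in> carrier (localization Q (?pre F))"
    then obtain q g where 1: "q \<in> carrier Q" "g \<in> ?pre F" "A = loc_frac Q (?pre F) q g"
      by (rule Q.localization_cases)
    have 2: "h g \<in> F" using 1 by simp
    show "st ?f F A \<in> Units (localization P F) \<longleftrightarrow> A \<in> Units (localization Q (?pre F))"
      unfolding 1(3) ev[OF 1(1,2)] Q.frac_Units[OF pF 1(1,2)] P.frac_Units[OF F hD(1)[OF 1(1)] 2]
      using 1 by simp
  qed
  then show "local_hom (stalk (Spec Q) (pt ?f F)) (stalk (Spec P) F) (st ?f F)"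
    unfolding sel Spec_map_sel[OF F] .
next
  interpret P: comm_monoid P by fact
  interpret Q: comm_monoid Q by fact
  note hD = mon_homD[OF h]
  note sel = P.Spec_sel Q.Spec_sel P.topspace_Tp Q.topspace_Tp
  let ?pre = "\<lambda>F. {q \<in> carrier Q. h q \<in> F}"
  have pre: "?pre F \<in> faces Q" if "F \<in> faces P" for F using face_vimage[OF P Q h that] .
  fix V s assume "openin (space_of (Spec Q)) V" and s: "s \<in> sect (Spec Q) V"
  then have V: "openin Q.Tp V" unfolding sel by simp
  let ?V = "{x \<in> faces P. pt ?f x \<in> V}"
  have Vo: "openin P.Tp ?V"
    unfolding P.openin_Tp
  proof (intro conjI ballI)
    fix F assume F: "F \<in> ?V"
    then have FF: "F \<in> faces P" "?pre F \<in> V" by (auto simp: Spec_map_sel)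
    obtain q where q: "q \<in> ?pre F" "spec_basic Q q \<subseteq> V" using Q.openin_TpE[OF V FF(2)] by blast
    have "spec_basic P (h q) \<subseteq> ?V"
      using q pre by (auto simp: Spec_map_sel spec_basic_def)
    then show "\<exists>p\<in>F. spec_basic P p \<subseteq> ?V" using q by blast
  qed simp
  let ?s = "\<lambda>x\<in>?V. st ?f x (s (pt ?f x))"
  have "\<exists>q p f. q \<in> F \<and> spec_basic P q \<subseteq> ?V \<and> p \<in> carrier P \<and>
        (\<forall>H\<in>spec_basic P q. f \<in> H \<and> ?s H = loc_frac P H p f)" if F: "F \<in> ?V" for F
  proof -
    have FF: "F \<in> faces P" "?pre F \<in> V" using F by (auto simp: Spec_map_sel)
    obtain q p f where *: "q \<in> ?pre F" "spec_basic Q q \<subseteq> V" "p \<in> carrier Q"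
      and s4: "\<forall>H\<in>spec_basic Q q. f \<in> H \<and> s H = loc_frac Q H p f"
      using Q.Spec_sectE[OF V s FF(2)] by blast
    have "h f \<in> H \<and> ?s H = loc_frac P H (h p) (h f) \<and> H \<in> ?V" if "H \<in> spec_basic P (h q)" for H
    proof -
      have H: "H \<in> faces P" "h q \<in> H" using that by (auto simp: spec_basic_def)
      have "?pre H \<in> spec_basic Q q" using pre[OF H(1)] H * by (simp add: spec_basic_def)
      from bspec[OF s4 this] subsetD[OF *(2) this]
      have 1: "f \<in> ?pre H" "s (?pre H) = loc_frac Q (?pre H) p f" "?pre H \<in> V" by simp_all
      have HV: "H \<in> ?V" using H 1 by (simp add: Spec_map_sel)
      then have "?s H = st ?f H (s (?pre H))" using H by (simp add: Spec_map_sel)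
      also have "\<dots> = loc_frac P H (h p) (h f)" unfolding 1(2) by (rule Spec_map_frac[OF P Q h H(1) *(3) 1(1)])
      finally show ?thesis using 1(1) HV by simp
    qed
    then have "spec_basic P (h q) \<subseteq> ?V" "\<forall>H\<in>spec_basic P (h q). h f \<in> H \<and> ?s H = loc_frac P H (h p) (h f)"
      by blast+
    moreover have "h q \<in> F" "h p \<in> carrier P" using * hD(1) by auto
    ultimately show ?thesis by blast
  qed
  then have "?s \<in> sect (Spec P) ?V"
    using iffD2[OF P.Spec_sect_iff[OF Vo]] by simp
  then show "(\<lambda>x\<in>{x \<in> points (Spec P). pt ?f x \<in> V}. st ?f x (s (pt ?f x)))
       \<in> sect (Spec P) {x \<in> points (Spec P). pt ?f x \<in> V}"
    unfolding sel .
qed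

lemma trivial_comm_monoid: "comm_monoid trivial_monoid"
  by (rule comm_monoidI) (simp_all add: trivial_monoid_def)

lemma faces_trivial: "faces trivial_monoid = {UNIV}"
  unfolding faces_def submonoid_def by (auto simp: trivial_monoid_def)

lemma lm_one_sel: "points lm_one = {UNIV}" "carrier (stalk lm_one UNIV) = {\<one>\<^bsub>stalk lm_one UNIV\<^esub>}"
proof -
  interpret T: comm_monoid trivial_monoid by (rule trivial_comm_monoid)
  show "points lm_one = {UNIV}" unfolding lm_one_def T.Spec_sel T.topspace_Tp by (rule faces_trivial)
  have F: "UNIV \<in> faces trivial_monoid" by (simp add: faces_trivial)
  have "A = \<one>\<^bsub>localization trivial_monoid UNIV\<^esub>" if "A \<in> carrier (localization trivial_monoid UNIV)" for A
    using that by (rule T.localization_cases) (simp add: T.localization_one)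
  then show "carrier (stalk lm_one UNIV) = {\<one>\<^bsub>stalk lm_one UNIV\<^esub>}"
    unfolding lm_one_def T.Spec_sel
    using T.frac_in_carrier[OF T.one_closed facesD(2)[OF F]] unfolding T.localization_one[symmetric] by blast
qed

theorem lm_bang_hom:
  assumes X: "locally_monoidal X"
  shows "lm_bang X \<in> lm_hom X lm_one"
proof (rule lm_homI)
  note XD = locally_monoidalD[OF X]
  interpret T: comm_monoid trivial_monoid by (rule trivial_comm_monoid)
  show "continuous_map (space_of X) (space_of lm_one) (pt (lm_bang X))"
    by (rule continuous_map_eq[of _ _ "\<lambda>_. UNIV"]) (simp_all add: lm_bang_def lm_one_sel)
  show "pt (lm_bang X) \<in> extensional (points X)" "st (lm_bang X) \<in> extensional (points X)"
    by (simp_all add: lm_bang_def)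
  show "st (lm_bang X) x \<in> mon_hom (stalk lm_one (pt (lm_bang X) x)) (stalk X x)"
     "local_hom (stalk lm_one (pt (lm_bang X) x)) (stalk X x) (st (lm_bang X) x)" if x: "x \<in> points X" for x
  proof -
    interpret M: comm_monoid "stalk X x" using XD(1)[OF x] .
    have "comm_monoid (localization trivial_monoid UNIV)"
      by (rule T.comm_monoid_localization) (simp add: faces_trivial)
    then interpret O: comm_monoid "stalk lm_one UNIV" by (simp add: lm_one_def T.Spec_sel)
    show "st (lm_bang X) x \<in> mon_hom (stalk lm_one (pt (lm_bang X) x)) (stalk X x)"
      using x by (intro mon_homI) (auto simp: lm_bang_def lm_one_sel)
    show "local_hom (stalk lm_one (pt (lm_bang X) x)) (stalk X x) (st (lm_bang X) x)"
      using x by (intro local_homI) (auto simp: lm_bang_def lm_one_sel)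
  qed
  fix V s assume V: "openin (space_of lm_one) V" and s: "s \<in> sect lm_one V"
  have VV: "V \<subseteq> {UNIV}" using openin_subset[OF V] lm_one_sel by simp
  have c: "s UNIV = \<one>\<^bsub>stalk lm_one UNIV\<^esub>" if "UNIV \<in> V"
  proof -
    have "locally_monoidal lm_one" unfolding lm_one_def by (rule T.locally_monoidal_Spec)
    then have "s \<in> (\<Pi>\<^sub>E x\<in>V. carrier (stalk lm_one x))" using locally_monoidalD(2) V s by blast
    from PiE_mem[OF this that] show ?thesis using lm_one_sel by simp
  qed
  let ?V = "{x \<in> points X. pt (lm_bang X) x \<in> V}"
  have "?V = (if UNIV \<in> V then points X else {})" by (auto simp: lm_bang_def)
  then have o: "openin (space_of X) ?V" by simp
  have "(\<lambda>x\<in>?V. st (lm_bang X) x (s (pt (lm_bang X) x))) = (\<lambda>x\<in>?V. \<one>\<^bsub>stalk X x\<^esub>)"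
    by (rule restrict_ext) (auto simp: lm_bang_def c lm_one_sel)
  then show "(\<lambda>x\<in>?V. st (lm_bang X) x (s (pt (lm_bang X) x))) \<in> sect X ?V"
    using XD(3)[OF o] by simp
qed

theorem lm_bang_unique:
  assumes f: "f \<in> lm_hom X lm_one"
  shows "f = lm_bang X"
proof (rule lm_map_eqI)
  note fD = lm_homD[OF f]
  have p: "pt f x = UNIV" if "x \<in> points X" for x using fD(7)[OF that] lm_one_sel by simp
  show "pt f = pt (lm_bang X)"
    by (rule extensionalityI[OF fD(2)]) (simp_all add: p lm_bang_def)
  have e: "st f x = st (lm_bang X) x" if x: "x \<in> points X" for x
  proof -
    have h: "st f x \<in> mon_hom (stalk lm_one UNIV) (stalk X x)" using fD(4)[OF x] p[OF x] by simp
    show ?thesis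
      by (rule extensionalityI[OF mon_homD(4)[OF h]])
        (use x mon_homD(3)[OF h] in \<open>simp_all add: lm_bang_def lm_one_sel\<close>)
  qed
  show "st f = st (lm_bang X)"
    by (rule extensionalityI[OF fD(3)]) (simp_all add: e, simp add: lm_bang_def)
qed

lemma facesI:
  assumes "submonoid F P"
    and "\<And>p q. p \<in> carrier P \<Longrightarrow> q \<in> carrier P \<Longrightarrow> p \<otimes>\<^bsub>P\<^esub> q \<in> F \<Longrightarrow> p \<in> F \<and> q \<in> F"
  shows "F \<in> faces P"
  using assms unfolding faces_def by blast

lemma lm_comp_assoc:
  assumes f: "f \<in> lm_hom W X" and g: "g \<in> lm_hom X Y" and h: "h \<in> lm_hom Y Z"
  shows "lm_comp W Z (lm_comp X Z h g) f = lm_comp W Z h (lm_comp W Y g f)"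
proof (rule lm_map_eqI)
  note fD = lm_homD[OF f] and gD = lm_homD[OF g] and hD = lm_homD[OF h]
  show "pt (lm_comp W Z (lm_comp X Z h g) f) = pt (lm_comp W Z h (lm_comp W Y g f))"
    by (rule ext) (simp add: lm_comp_def fD(7))
  show "st (lm_comp W Z (lm_comp X Z h g) f) = st (lm_comp W Z h (lm_comp W Y g f))"
  proof (rule extensionalityI[OF lm_comp_ext lm_comp_ext])
    fix x assume x: "x \<in> points W"
    show "st (lm_comp W Z (lm_comp X Z h g) f) x = st (lm_comp W Z h (lm_comp W Y g f)) x"
      using x fD(7)[OF x] gD(7)[OF fD(7)[OF x]] mon_homD(1)[OF hD(4)[OF gD(7)[OF fD(7)[OF x]]]]
      by (auto simp: lm_comp_def intro!: restrict_ext)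
  qed
qed

lemma lm_comp_id:
  assumes f: "f \<in> lm_hom X Y"
  shows "lm_comp X Y (lm_id Y) f = f" "lm_comp X Y f (lm_id X) = f"
proof -
  note fD = lm_homD[OF f]
  have 1: "st (lm_comp X Y (lm_id Y) f) x = st f x" "st (lm_comp X Y f (lm_id X)) x = st f x" 
    if x: "x \<in> points X" for x
    by (rule extensionalityI[OF _ mon_homD(4)[OF fD(4)[OF x]]],
      use x fD(7)[OF x] mon_homD(1)[OF fD(4)[OF x]] in \<open>simp_all add: lm_comp_def lm_id_def\<close>)+
  show "lm_comp X Y (lm_id Y) f = f"
    by (rule lm_map_eqI, rule extensionalityI[OF _ fD(2)], simp add: lm_comp_def,
       simp add: lm_comp_def lm_id_def fD(7), rule extensionalityI[OF lm_comp_ext fD(3)], rule 1)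
  show "lm_comp X Y f (lm_id X) = f"
    by (rule lm_map_eqI, rule extensionalityI[OF _ fD(2)], simp add: lm_comp_def,
       simp add: lm_comp_def lm_id_def fD(7), rule extensionalityI[OF lm_comp_ext fD(3)], rule 1)
qed

lemma lm_inverse_unique:
  assumes "lm_inverse X Y f g" "lm_inverse X Y f g'"
  shows "g = g'"
proof -
  have h: "f \<in> lm_hom X Y" "g \<in> lm_hom Y X" "g' \<in> lm_hom Y X" and 
    e: "lm_comp X X g f = lm_id X" "lm_comp Y Y f g' = lm_id Y"
    using assms unfolding lm_inverse_def by auto
  have "g = lm_comp Y X g (lm_comp Y Y f g')" unfolding e lm_comp_id(2)[OF h(2)] ..
  also have "\<dots> = lm_comp Y X (lm_comp X X g f) g'" by (rule lm_comp_assoc[OF h(3,1,2), symmetric])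
  also have "\<dots> = g'" unfolding e by (rule lm_comp_id(1)[OF h(3)])
  finally show ?thesis .
qed

definition split_spec :: "'a monoid \<Rightarrow> 'b monoid \<Rightarrow>
    ('a set \<times> 'b set, ('a \<times> 'a) set \<times> ('b \<times> 'b) set,
     ('a \<times> 'b) set, (('a \<times> 'b) \<times> ('a \<times> 'b)) set) lmmap" where
  "split_spec P Q = \<lparr>pt = (\<lambda>(A, B)\<in>faces P \<times> faces Q. A \<times> B),
     st = (\<lambda>(A, B)\<in>faces P \<times> faces Q. \<lambda>C\<in>carrier (localization (P \<times>\<times> Q) (A \<times> B)).
       (\<Union>((p, q), (f, g))\<in>C. loc_frac P A p f, \<Union>((p, q), (f, g))\<in>C. loc_frac Q B q g))\<rparr>"

context
  fixes P :: "'a monoid" and Q :: "'b monoid"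
  assumes P: "comm_monoid P" and Q: "comm_monoid Q"
begin

interpretation P: comm_monoid P by (rule P)
interpretation Q: comm_monoid Q by (rule Q)
interpretation PQ: comm_monoid "P \<times>\<times> Q" by (rule DirProd_comm_monoid[OF P Q])

lemma face_Times:
  assumes A: "A \<in> faces P" and B: "B \<in> faces Q" shows "A \<times> B \<in> faces (P \<times>\<times> Q)"
proof -
  have "submonoid (A \<times> B) (P \<times>\<times> Q)"
    by (rule submonoid.intro) (use facesD(1,2,3)[OF A] facesD(1,2,3)[OF B] in auto)
  moreover have "p \<in> A \<times> B \<and> q \<in> A \<times> B" 
    if c: "p \<in> carrier (P \<times>\<times> Q)" "q \<in> carrier (P \<times>\<times> Q)" "p \<otimes>\<^bsub>P \<times>\<times> Q\<^esub> q \<in> A \<times> B" for p q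
  proof -
    obtain a b where p: "p = (a, b)" by (cases p)
    obtain c d where q: "q = (c, d)" by (cases q)
    have m: "a \<in> carrier P" "b \<in> carrier Q" "c \<in> carrier P" "d \<in> carrier Q" "a \<otimes>\<^bsub>P\<^esub> c \<in> A" "b \<otimes>\<^bsub>Q\<^esub> d \<in> B" 
      using c p q by auto
    then show ?thesis unfolding p q using facesD(4,5)[OF A m(1,3,5)] facesD(4,5)[OF B m(2,4,6)] by simp
  qed
  ultimately show ?thesis by (rule facesI)
qed

lemma inc_pre:
  assumes F: "F \<in> faces (P \<times>\<times> Q)"
  shows "F = {p \<in> carrier P. inc_l P Q p \<in> F} \<times> {q \<in> carrier Q. inc_r P Q q \<in> F}"
proof (intro Set.equalityI subsetI)
  fix x assume x: "x \<in> F"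
  obtain a b where ab: "x = (a, b)" by (cases x)
  have c: "a \<in> carrier P" "b \<in> carrier Q" using x ab facesD(1)[OF F] by auto
  have "(a, \<one>\<^bsub>Q\<^esub>) \<otimes>\<^bsub>P \<times>\<times> Q\<^esub> (\<one>\<^bsub>P\<^esub>, b) \<in> F" using x ab c by simp
  then have "(a, \<one>\<^bsub>Q\<^esub>) \<in> F" "(\<one>\<^bsub>P\<^esub>, b) \<in> F"
    using facesD(4,5)[OF F, of "(a, \<one>\<^bsub>Q\<^esub>)" "(\<one>\<^bsub>P\<^esub>, b)"] c by auto
  then show "x \<in> {p \<in> carrier P. inc_l P Q p \<in> F} \<times> {q \<in> carrier Q. inc_r P Q q \<in> F}"
    using ab c by (simp add: inc_l_def inc_r_def)
next
  fix x assume "x \<in> {p \<in> carrier P. inc_l P Q p \<in> F} \<times> {q \<in> carrier Q. inc_r P Q q \<in> F}"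
  then obtain a b where ab: "x = (a, b)" "a \<in> carrier P" "b \<in> carrier Q" "(a, \<one>\<^bsub>Q\<^esub>) \<in> F" "(\<one>\<^bsub>P\<^esub>, b) \<in> F"
    by (auto simp: inc_l_def inc_r_def)
  then show "x \<in> F" using facesD(3)[OF F ab(4,5)] by simp
qed

lemma inc_pre_Times:
  assumes A: "A \<in> faces P" and B: "B \<in> faces Q" 
  shows "{p \<in> carrier P. inc_l P Q p \<in> A \<times> B} = A" "{q \<in> carrier Q. inc_r P Q q \<in> A \<times> B} = B"
  using facesD(1,2)[OF A] facesD(1,2)[OF B] by (auto simp: inc_l_def inc_r_def)

lemma split_spec_frac:
  assumes A: "A \<in> faces P" and B: "B \<in> faces Q" 
   and c: "p \<in> carrier P" "q \<in> carrier Q" "f \<in> A" "g \<in> B"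
  shows "st (split_spec P Q) (A, B) (loc_frac (P \<times>\<times> Q) (A \<times> B) (p, q) (f, g)) = (loc_frac P A p f, loc_frac Q B q g)"
proof -
  note AB = face_Times[OF A B]
  have pq: "(p, q) \<in> carrier (P \<times>\<times> Q)" "(f, g) \<in> A \<times> B" using c by auto
  have *: "loc_frac P A (fst x) (fst y) = loc_frac P A p f \<and> loc_frac Q B (snd x) (snd y) = loc_frac Q B q g"
    if 1: "x \<in> carrier (P \<times>\<times> Q)" "y \<in> A \<times> B" "loc_frac (P \<times>\<times> Q) (A \<times> B) x y = loc_frac (P \<times>\<times> Q) (A \<times> B) (p, q) (f, g)" for x y
  proof -
    obtain h where h: "h \<in> A \<times> B" "x \<otimes>\<^bsub>P \<times>\<times> Q\<^esub> (f, g) \<otimes>\<^bsub>P \<times>\<times> Q\<^esub> h = (p, q) \<otimes>\<^bsub>P \<times>\<times> Q\<^esub> y \<otimes>\<^bsub>P \<times>\<times> Q\<^esub> h"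
      using PQ.frac_eq_iff[OF AB 1(1) pq(1) 1(2) pq(2)] 1(3) by blast
    obtain x1 x2 y1 y2 h1 h2 where e: "x = (x1, x2)" "y = (y1, y2)" "h = (h1, h2)" by (metis surj_pair)
    have m: "x1 \<in> carrier P" "x2 \<in> carrier Q" "y1 \<in> A" "y2 \<in> B" "h1 \<in> A" "h2 \<in> B" using 1 h e by auto
    have "x1 \<otimes>\<^bsub>P\<^esub> f \<otimes>\<^bsub>P\<^esub> h1 = p \<otimes>\<^bsub>P\<^esub> y1 \<otimes>\<^bsub>P\<^esub> h1" "x2 \<otimes>\<^bsub>Q\<^esub> g \<otimes>\<^bsub>Q\<^esub> h2 = q \<otimes>\<^bsub>Q\<^esub> y2 \<otimes>\<^bsub>Q\<^esub> h2"
      using h(2) e by simp_all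
    then show ?thesis
      using P.frac_eq_iff[OF A m(1) c(1) m(3) c(3)] Q.frac_eq_iff[OF B m(2) c(2) m(4) c(4)] m(5,6) e by auto
  qed
  have "(\<Union>(x, y)\<in>loc_frac (P \<times>\<times> Q) (A \<times> B) (p, q) (f, g). loc_frac P A (fst x) (fst y)) = loc_frac P A p f"
    using PQ.UN_frac[OF AB pq, of "\<lambda>x y. loc_frac P A (fst x) (fst y)"] * by simp
  moreover have "(\<Union>(x, y)\<in>loc_frac (P \<times>\<times> Q) (A \<times> B) (p, q) (f, g). loc_frac Q B (snd x) (snd y)) = loc_frac Q B q g"
    using PQ.UN_frac[OF AB pq, of "\<lambda>x y. loc_frac Q B (snd x) (snd y)"] * by simp
  ultimately show ?thesis
    using A B PQ.frac_in_carrier[OF pq] by (simp add: split_spec_def case_prod_beta)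
qed

lemma Spec_locally_monoidal: "locally_monoidal (Spec P)" "locally_monoidal (Spec Q)" "locally_monoidal (Spec (P \<times>\<times> Q))"
  by (rule P.locally_monoidal_Spec Q.locally_monoidal_Spec PQ.locally_monoidal_Spec)+

lemmas Spec_sels = P.Spec_sel Q.Spec_sel PQ.Spec_sel P.topspace_Tp Q.topspace_Tp PQ.topspace_Tp

lemma points_prod_Spec: "points (lm_prod (Spec P) (Spec Q)) = faces P \<times> faces Q"
  unfolding lm_prod_sel(3) Spec_sels ..

lemma split_pt: "A \<in> faces P \<Longrightarrow> B \<in> faces Q \<Longrightarrow> pt (split_spec P Q) (A, B) = A \<times> B"
  by (simp add: split_spec_def)

lemma split_pre_box:
  assumes W: "openin PQ.Tp W" and z: "A \<in> faces P" "B \<in> faces Q" and pq: "p \<in> A" "q \<in> B"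
    and sub: "spec_basic (P \<times>\<times> Q) (p, q) \<subseteq> W"
  shows "openin P.Tp (spec_basic P p)" "openin Q.Tp (spec_basic Q q)" 
    "(A, B) \<in> spec_basic P p \<times> spec_basic Q q"
    "\<And>A' B'. A' \<in> spec_basic P p \<Longrightarrow> B' \<in> spec_basic Q q \<Longrightarrow> 
       A' \<in> faces P \<and> B' \<in> faces Q \<and> pt (split_spec P Q) (A', B') \<in> spec_basic (P \<times>\<times> Q) (p, q)"
  subgoal using P.openin_spec_basic facesD(1)[OF z(1)] pq(1) by blast
  subgoal using Q.openin_spec_basic facesD(1)[OF z(2)] pq(2) by blast
  subgoal using z pq by (simp add: spec_basic_def)
  subgoal using face_Times by (simp add: spec_basic_def split_pt)
  done

theorem split_spec_hom: "split_spec P Q \<in> lm_hom (lm_prod (Spec P) (Spec Q)) (Spec (P \<times>\<times> Q))" (is "?f \<in> _")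
proof (rule lm_homI)
  show cont: "continuous_map (space_of (lm_prod (Spec P) (Spec Q))) (space_of (Spec (P \<times>\<times> Q))) (pt ?f)"
    unfolding continuous_map lm_prod_sel Spec_sels
  proof (intro conjI allI impI)
    show "pt ?f ` (topspace (prod_topology P.Tp Q.Tp)) \<subseteq> faces (P \<times>\<times> Q)"
      unfolding topspace_prod_topology P.topspace_Tp Q.topspace_Tp using face_Times by (auto simp: split_pt)
    fix W assume W: "openin PQ.Tp W"
    show "openin (prod_topology P.Tp Q.Tp) {x \<in> topspace (prod_topology P.Tp Q.Tp). pt ?f x \<in> W}"
      unfolding openin_prod_topology_alt
    proof (intro allI impI)
      fix A B assume "(A, B) \<in> {x \<in> topspace (prod_topology P.Tp Q.Tp). pt ?f x \<in> W}"
      then have AB: "A \<in> faces P" "B \<in> faces Q" "A \<times> B \<in> W" 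
        unfolding topspace_prod_topology P.topspace_Tp Q.topspace_Tp by (auto simp: split_pt)
      obtain p q where pq: "p \<in> A" "q \<in> B" "spec_basic (P \<times>\<times> Q) (p, q) \<subseteq> W"
        using PQ.openin_TpE[OF W AB(3)] by blast
      note b = split_pre_box[OF W AB(1,2) pq]
      have "spec_basic P p \<times> spec_basic Q q \<subseteq> {x \<in> topspace (prod_topology P.Tp Q.Tp). pt ?f x \<in> W}"
        unfolding topspace_prod_topology P.topspace_Tp Q.topspace_Tp using b(4) pq(3) by auto
      then show "\<exists>U V. openin P.Tp U \<and> openin Q.Tp V \<and> A \<in> U \<and> B \<in> V \<and> 
        U \<times> V \<subseteq> {x \<in> topspace (prod_topology P.Tp Q.Tp). pt ?f x \<in> W}"
        using b(1,2,3) by blast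
    qed
  qed
  show "pt ?f \<in> extensional (points (lm_prod (Spec P) (Spec Q)))" 
       "st ?f \<in> extensional (points (lm_prod (Spec P) (Spec Q)))"
    unfolding lm_prod_sel Spec_sels topspace_prod_topology by (simp_all add: split_spec_def del: topology_generated_by_topspace)
  fix z assume "z \<in> points (lm_prod (Spec P) (Spec Q))"
  then obtain A B where z: "z = (A, B)" and A: "A \<in> faces P" and B: "B \<in> faces Q"
    unfolding lm_prod_sel Spec_sels topspace_prod_topology by blast
  note AB = face_Times[OF A B]
  let ?L = "localization (P \<times>\<times> Q) (A \<times> B)" and ?M = "localization P A \<times>\<times> localization Q B"
  have cs: thesis if C: "C \<in> carrier ?L" and 
     "\<And>p q f g. p \<in> carrier P \<Longrightarrow> q \<in> carrier Q \<Longrightarrow> f \<in> A \<Longrightarrow> g \<in> B \<Longrightarrow> C = loc_frac (P \<times>\<times> Q) (A \<times> B) (p, q) (f, g) \<Longrightarrow> thesis" for C thesis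
    using PQ.localization_cases[OF C] that(2) by (metis SigmaE carrier_DirProd)
  have "st ?f z \<in> mon_hom ?L ?M"
    unfolding z
  proof (rule mon_homI)
    fix C assume "C \<in> carrier ?L"
    then obtain p q f g where 1: "p \<in> carrier P" "q \<in> carrier Q" "f \<in> A" "g \<in> B" "C = loc_frac (P \<times>\<times> Q) (A \<times> B) (p, q) (f, g)"
      by (rule cs)
    show "st ?f (A, B) C \<in> carrier ?M" unfolding 1(5) split_spec_frac[OF A B 1(1-4)]
      using P.frac_in_carrier[OF 1(1,3)] Q.frac_in_carrier[OF 1(2,4)] by simp
  next
    fix C D assume C: "C \<in> carrier ?L" and D: "D \<in> carrier ?L"
    obtain p q f g where 1: "p \<in> carrier P" "q \<in> carrier Q" "f \<in> A" "g \<in> B" "C = loc_frac (P \<times>\<times> Q) (A \<times> B) (p, q) (f, g)"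
      using C by (rule cs)
    obtain p' q' f' g' where 2: "p' \<in> carrier P" "q' \<in> carrier Q" "f' \<in> A" "g' \<in> B" "D = loc_frac (P \<times>\<times> Q) (A \<times> B) (p', q') (f', g')"
      using D by (rule cs)
    have 3: "(p, q) \<in> carrier (P \<times>\<times> Q)" "(p', q') \<in> carrier (P \<times>\<times> Q)" "(f, g) \<in> A \<times> B" "(f', g') \<in> A \<times> B"
      using 1 2 by auto
    have 4: "p \<otimes>\<^bsub>P\<^esub> p' \<in> carrier P" "q \<otimes>\<^bsub>Q\<^esub> q' \<in> carrier Q" "f \<otimes>\<^bsub>P\<^esub> f' \<in> A" "g \<otimes>\<^bsub>Q\<^esub> g' \<in> B"
      using 1 2 facesD(3)[OF A 1(3) 2(3)] facesD(3)[OF B 1(4) 2(4)] by auto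
    show "st ?f (A, B) (C \<otimes>\<^bsub>?L\<^esub> D) = st ?f (A, B) C \<otimes>\<^bsub>?M\<^esub> st ?f (A, B) D"
      unfolding 1(5) 2(5) PQ.frac_mult[OF AB 3] mult_DirProd split_spec_frac[OF A B 4] 
        split_spec_frac[OF A B 1(1-4)] split_spec_frac[OF A B 2(1-4)]
        P.frac_mult[OF A 1(1) 2(1) 1(3) 2(3)] Q.frac_mult[OF B 1(2) 2(2) 1(4) 2(4)] ..
  next
    show "st ?f (A, B) \<one>\<^bsub>?L\<^esub> = \<one>\<^bsub>?M\<^esub>"
      unfolding PQ.localization_one one_DirProd P.localization_one Q.localization_one
      by (rule split_spec_frac[OF A B P.one_closed Q.one_closed facesD(2)[OF A] facesD(2)[OF B]])
  next
    show "st ?f (A, B) \<in> extensional (carrier ?L)"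
      using A B by (simp add: split_spec_def)
  qed
  then show "st ?f z \<in> mon_hom (stalk (Spec (P \<times>\<times> Q)) (pt ?f z)) (stalk (lm_prod (Spec P) (Spec Q)) z)"
    unfolding lm_prod_sel Spec_sels z split_pt[OF A B] by simp
  have "local_hom ?L ?M (st ?f z)"
    unfolding z
  proof (rule local_homI)
    fix C assume "C \<in> carrier ?L"
    then obtain p q f g where 1: "p \<in> carrier P" "q \<in> carrier Q" "f \<in> A" "g \<in> B" "C = loc_frac (P \<times>\<times> Q) (A \<times> B) (p, q) (f, g)"
      by (rule cs)
    have 3: "(p, q) \<in> carrier (P \<times>\<times> Q)" "(f, g) \<in> A \<times> B" using 1 by auto
    show "st ?f (A, B) C \<in> Units ?M \<longleftrightarrow> C \<in> Units ?L"
      unfolding 1(5) split_spec_frac[OF A B 1(1-4)] PQ.frac_Units[OF AB 3]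
        Units_DirProd[OF P.comm_monoid_localization[OF A] Q.comm_monoid_localization[OF B]]
      by (simp add: P.frac_Units[OF A 1(1,3)] Q.frac_Units[OF B 1(2,4)])
  qed
  then show "local_hom (stalk (Spec (P \<times>\<times> Q)) (pt ?f z)) (stalk (lm_prod (Spec P) (Spec Q)) z) (st ?f z)"
    unfolding lm_prod_sel Spec_sels z split_pt[OF A B] by simp
next
  fix W s assume "openin (space_of (Spec (P \<times>\<times> Q))) W" and s: "s \<in> sect (Spec (P \<times>\<times> Q)) W"
  then have W: "openin PQ.Tp W" unfolding Spec_sels by simp
  let ?W = "{z \<in> points (lm_prod (Spec P) (Spec Q)). pt ?f z \<in> W}"
  let ?s = "\<lambda>z\<in>?W. st ?f z (s (pt ?f z))"
  show "?s \<in> sect (lm_prod (Spec P) (Spec Q)) ?W"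
  proof (rule lm_prod_sectI[OF Spec_locally_monoidal(1,2)])
    fix z assume z: "z \<in> ?W"
    then obtain A B where zAB: "z = (A, B)" and A: "A \<in> faces P" and B: "B \<in> faces Q" and ABW: "A \<times> B \<in> W"
      unfolding points_prod_Spec by (auto simp: split_pt)
    obtain r x y where r: "r \<in> A \<times> B" "spec_basic (P \<times>\<times> Q) r \<subseteq> W" 
      and x: "x \<in> carrier (P \<times>\<times> Q)" 
      and sr: "\<forall>H\<in>spec_basic (P \<times>\<times> Q) r. y \<in> H \<and> s H = loc_frac (P \<times>\<times> Q) H x y"
      using PQ.Spec_sectE[OF W s ABW] by blast
    obtain p q where rr: "r = (p, q)" by (cases r)
    have pq: "p \<in> A" "q \<in> B" "spec_basic (P \<times>\<times> Q) (p, q) \<subseteq> W" using r rr by auto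
    note sx = sr[unfolded rr]
    obtain a b f g where e: "x = (a, b)" "y = (f, g)" by (metis surj_pair)
    have ab: "a \<in> carrier P" "b \<in> carrier Q" using x e by auto
    note bx = split_pre_box[OF W A B pq]
    have pqc: "p \<in> carrier P" "q \<in> carrier Q" using facesD(1)[OF A] facesD(1)[OF B] pq by auto
    have fg: "f \<in> A' \<and> g \<in> B' \<and> s (A' \<times> B') = loc_frac (P \<times>\<times> Q) (A' \<times> B') (a, b) (f, g)" 
      if "A' \<in> spec_basic P p" "B' \<in> spec_basic Q q" for A' B'
    proof -
      have "A' \<times> B' \<in> spec_basic (P \<times>\<times> Q) (p, q)" using bx(4)[OF that] split_pt[of A' B'] by auto
      from bspec[OF sx this] show ?thesis using e by simp
    qed
    have AB0: "A \<in> spec_basic P p" "B \<in> spec_basic Q q" using bx(3) by auto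
    let ?a = "\<lambda>H\<in>spec_basic P p. loc_frac P H a f" and ?b = "\<lambda>H\<in>spec_basic Q q. loc_frac Q H b g"
    have "?a \<in> sect (Spec P) (spec_basic P p)"
      by (rule P.Spec_sect_fracI[OF pqc(1) ab(1)]) (use fg AB0 in blast)
    moreover have "?b \<in> sect (Spec Q) (spec_basic Q q)"
      by (rule Q.Spec_sect_fracI[OF pqc(2) ab(2)]) (use fg AB0 in blast)
    moreover have "\<forall>A'\<in>spec_basic P p. \<forall>B'\<in>spec_basic Q q. ?s (A', B') = (?a A', ?b B')"
    proof (intro ballI)
      fix A' B' assume i: "A' \<in> spec_basic P p" "B' \<in> spec_basic Q q"
      note b = bx(4)[OF i] and f = fg[OF i]
      have "(A', B') \<in> ?W" unfolding points_prod_Spec using b pq(3) by auto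
      then have "?s (A', B') = st ?f (A', B') (s (A' \<times> B'))" using b by (simp add: split_pt)
      also have "\<dots> = (loc_frac P A' a f, loc_frac Q B' b g)"
        using split_spec_frac[of A' B' a b f g] b f ab by simp
      finally show "?s (A', B') = (?a A', ?b B')" using i by simp
    qed
    moreover have "spec_basic P p \<times> spec_basic Q q \<subseteq> ?W"
      unfolding points_prod_Spec using bx(4) pq(3) by auto
    ultimately show "\<exists>U V a b. openin (space_of (Spec P)) U \<and> openin (space_of (Spec Q)) V \<and> z \<in> U \<times> V \<and> U \<times> V \<subseteq> ?W \<and>
      a \<in> sect (Spec P) U \<and> b \<in> sect (Spec Q) V \<and> (\<forall>x\<in>U. \<forall>y\<in>V. ?s (x, y) = (a x, b y))"
      using bx(1,2,3) unfolding zAB Spec_sels by blast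
  qed simp
qed

lemmas Spec_stalks = P.Spec_sel(2) Q.Spec_sel(2) PQ.Spec_sel(2)

lemma points_Spec_prod: "points (Spec (P \<times>\<times> Q)) = faces (P \<times>\<times> Q)" unfolding Spec_sels ..

abbreviation "Spec_cmp \<equiv> lm_pair (Spec (P \<times>\<times> Q)) (Spec P) (Spec Q)
        (Spec_map P (P \<times>\<times> Q) (inc_l P Q)) (Spec_map Q (P \<times>\<times> Q) (inc_r P Q))"

theorem split_spec_inverse:
  "lm_inverse (Spec (P \<times>\<times> Q)) (lm_prod (Spec P) (Spec Q)) Spec_cmp (split_spec P Q)"
proof -
  note inc = inc_hom[OF P Q]
  have l: "Spec_map P (P \<times>\<times> Q) (inc_l P Q) \<in> lm_hom (Spec (P \<times>\<times> Q)) (Spec P)"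
    by (rule Spec_map_hom[OF DirProd_comm_monoid[OF P Q] P inc(1)])
  have r: "Spec_map Q (P \<times>\<times> Q) (inc_r P Q) \<in> lm_hom (Spec (P \<times>\<times> Q)) (Spec Q)"
    by (rule Spec_map_hom[OF DirProd_comm_monoid[OF P Q] Q inc(2)])
  have c: "Spec_cmp \<in> lm_hom (Spec (P \<times>\<times> Q)) (lm_prod (Spec P) (Spec Q))"
    by (rule lm_pair_hom[OF Spec_locally_monoidal(3,1,2) l r])
  have cpt: "pt Spec_cmp (A \<times> B) = (A, B)" if "A \<in> faces P" "B \<in> faces Q" for A B
    using that face_Times[OF that] inc_pre_Times[OF that] by (simp add: lm_pair_def points_Spec_prod Spec_stalks Spec_map_sel)
  have cst: "st Spec_cmp (A \<times> B) (loc_frac P A p f, loc_frac Q B q g) = loc_frac (P \<times>\<times> Q) (A \<times> B) (p, q) (f, g)"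
    if A: "A \<in> faces P" and B: "B \<in> faces Q" and m: "p \<in> carrier P" "q \<in> carrier Q" "f \<in> A" "g \<in> B" for A B p q f g
  proof -
    note AB = face_Times[OF A B]
    have fg: "f \<in> carrier P" "g \<in> carrier Q" using facesD(1)[OF A] facesD(1)[OF B] m by auto
    have 1: "st (Spec_map P (P \<times>\<times> Q) (inc_l P Q)) (A \<times> B) (loc_frac P A p f) = loc_frac (P \<times>\<times> Q) (A \<times> B) (p, \<one>\<^bsub>Q\<^esub>) (f, \<one>\<^bsub>Q\<^esub>)"
      using Spec_map_frac[OF DirProd_comm_monoid[OF P Q] P inc(1) AB m(1), of f] m(3) fg
      unfolding inc_pre_Times[OF A B] by (simp add: inc_l_def m)
    have 2: "st (Spec_map Q (P \<times>\<times> Q) (inc_r P Q)) (A \<times> B) (loc_frac Q B q g) = loc_frac (P \<times>\<times> Q) (A \<times> B) (\<one>\<^bsub>P\<^esub>, q) (\<one>\<^bsub>P\<^esub>, g)"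
      using Spec_map_frac[OF DirProd_comm_monoid[OF P Q] Q inc(2) AB m(2), of g] m(4) fg
      unfolding inc_pre_Times[OF A B] by (simp add: inc_r_def m)
    have 3: "(p, \<one>\<^bsub>Q\<^esub>) \<in> carrier (P \<times>\<times> Q)" "(\<one>\<^bsub>P\<^esub>, q) \<in> carrier (P \<times>\<times> Q)"
      "(f, \<one>\<^bsub>Q\<^esub>) \<in> A \<times> B" "(\<one>\<^bsub>P\<^esub>, g) \<in> A \<times> B"
      using m facesD(2)[OF A] facesD(2)[OF B] by auto
    have pf: "loc_frac P A p f \<in> carrier (localization P A)" "loc_frac Q B q g \<in> carrier (localization Q B)"
      using P.frac_in_carrier[OF m(1,3)] Q.frac_in_carrier[OF m(2,4)] by auto
    have "st Spec_cmp (A \<times> B) (loc_frac P A p f, loc_frac Q B q g) = 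
      st (Spec_map P (P \<times>\<times> Q) (inc_l P Q)) (A \<times> B) (loc_frac P A p f) \<otimes>\<^bsub>localization (P \<times>\<times> Q) (A \<times> B)\<^esub>
      st (Spec_map Q (P \<times>\<times> Q) (inc_r P Q)) (A \<times> B) (loc_frac Q B q g)"
      using AB pf inc_pre_Times[OF A B]
      by (simp add: lm_pair_def points_Spec_prod Spec_stalks Spec_map_sel copair_def)
    also have "\<dots> = loc_frac (P \<times>\<times> Q) (A \<times> B) (p, q) (f, g)"
      unfolding 1 2 PQ.frac_mult[OF AB 3] using m fg by simp
    finally show ?thesis .
  qed
  have dec: "\<exists>A\<in>faces P. \<exists>B\<in>faces Q. F = A \<times> B" if F: "F \<in> faces (P \<times>\<times> Q)" for F
    using inc_pre[OF F] face_vimage[OF DirProd_comm_monoid[OF P Q] P inc(1) F]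
      face_vimage[OF DirProd_comm_monoid[OF P Q] Q inc(2) F] by blast
  have "lm_comp (Spec (P \<times>\<times> Q)) (Spec (P \<times>\<times> Q)) (split_spec P Q) Spec_cmp = lm_id (Spec (P \<times>\<times> Q))" (is "?c = ?i")
  proof -
    have *: "pt ?c F = pt ?i F \<and> st ?c F = st ?i F" if F: "F \<in> points (Spec (P \<times>\<times> Q))" for F
    proof -
      have FF: "F \<in> faces (P \<times>\<times> Q)" using F unfolding points_Spec_prod .
      then obtain A B where A: "A \<in> faces P" and B: "B \<in> faces Q" and e: "F = A \<times> B" using dec by blast
      have p: "pt Spec_cmp F = (A, B)" unfolding e by (rule cpt[OF A B])
      have "pt ?c F = pt ?i F" using F p e A B by (simp add: lm_comp_def lm_id_def split_pt)
      moreover have "st ?c F = st ?i F"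
      proof (rule extensionalityI[of _ "carrier (localization (P \<times>\<times> Q) F)"])
        show "st ?c F \<in> extensional (carrier (localization (P \<times>\<times> Q) F))"
          using F p A B by (simp add: lm_comp_def split_pt Spec_stalks e)
        show "st ?i F \<in> extensional (carrier (localization (P \<times>\<times> Q) F))"
          using F by (simp add: lm_id_def Spec_stalks)
        fix C assume C: "C \<in> carrier (localization (P \<times>\<times> Q) F)"
        then obtain x y where xy: "x \<in> carrier (P \<times>\<times> Q)" "y \<in> F" "C = loc_frac (P \<times>\<times> Q) F x y"
          by (rule PQ.localization_cases)
        obtain a b f g where ee: "x = (a, b)" "y = (f, g)" by (metis surj_pair)
        have m: "a \<in> carrier P" "b \<in> carrier Q" "f \<in> A" "g \<in> B" using xy e ee by auto
        have "st ?c F C = st Spec_cmp F (st (split_spec P Q) (A, B) C)"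
          using F p C A B by (simp add: lm_comp_def split_pt Spec_stalks e)
        also have "\<dots> = C" unfolding xy(3) ee e split_spec_frac[OF A B m] by (rule cst[OF A B m])
        finally show "st ?c F C = st ?i F C" using F C by (simp add: lm_id_def Spec_stalks)
      qed
      ultimately show ?thesis by simp
    qed
    show ?thesis
    proof (rule lm_map_eqI)
      show "pt ?c = pt ?i" by (rule extensionalityI[of _ "points (Spec (P \<times>\<times> Q))"]) (simp_all add: *, simp_all add: lm_comp_def lm_id_def)
      show "st ?c = st ?i" by (rule extensionalityI[of _ "points (Spec (P \<times>\<times> Q))"]) (simp_all add: *, simp_all add: lm_comp_def lm_id_def)
    qed
  qed
  moreover have "lm_comp (lm_prod (Spec P) (Spec Q)) (lm_prod (Spec P) (Spec Q)) Spec_cmp (split_spec P Q) = lm_id (lm_prod (Spec P) (Spec Q))" (is "?c = ?i")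
  proof -
    have *: "pt ?c z = pt ?i z \<and> st ?c z = st ?i z" if z: "z \<in> points (lm_prod (Spec P) (Spec Q))" for z
    proof -
      obtain A B where e: "z = (A, B)" and A: "A \<in> faces P" and B: "B \<in> faces Q" using z unfolding points_prod_Spec by blast
      have p: "pt (split_spec P Q) z = A \<times> B" unfolding e by (rule split_pt[OF A B])
      have q: "pt Spec_cmp (A \<times> B) = (A, B)" by (rule cpt[OF A B])
      have "pt ?c z = pt ?i z" using z p q e by (simp add: lm_comp_def lm_id_def)
      moreover have "st ?c z = st ?i z"
      proof (rule extensionalityI[of _ "carrier (localization P A) \<times> carrier (localization Q B)"])
        show "st ?c z \<in> extensional (carrier (localization P A) \<times> carrier (localization Q B))"
          using z p q e by (simp add: lm_comp_def lm_prod_sel(2) Spec_stalks)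
        show "st ?i z \<in> extensional (carrier (localization P A) \<times> carrier (localization Q B))"
          using z e by (simp add: lm_id_def lm_prod_sel(2) Spec_stalks)
        fix C assume C: "C \<in> carrier (localization P A) \<times> carrier (localization Q B)"
        obtain C1 C2 where CC: "C = (C1, C2)" "C1 \<in> carrier (localization P A)" "C2 \<in> carrier (localization Q B)" using C by blast
        obtain a f where 1: "a \<in> carrier P" "f \<in> A" "C1 = loc_frac P A a f" using CC(2) by (rule P.localization_cases)
        obtain b g where 2: "b \<in> carrier Q" "g \<in> B" "C2 = loc_frac Q B b g" using CC(3) by (rule Q.localization_cases)
        have "st ?c z C = st (split_spec P Q) (A, B) (st Spec_cmp (A \<times> B) C)"
          using z p q e C by (simp add: lm_comp_def lm_prod_sel(2) Spec_stalks)
        also have "\<dots> = C" unfolding CC(1) 1(3) 2(3) cst[OF A B 1(1) 2(1) 1(2) 2(2)] 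
          by (rule split_spec_frac[OF A B 1(1) 2(1) 1(2) 2(2)])
        finally show "st ?c z C = st ?i z C" using z C e by (simp add: lm_id_def lm_prod_sel(2) Spec_stalks)
      qed
      ultimately show ?thesis by simp
    qed
    show ?thesis
    proof (rule lm_map_eqI)
      show "pt ?c = pt ?i" by (rule extensionalityI[of _ "points (lm_prod (Spec P) (Spec Q))"]) (simp_all add: *, simp_all add: lm_comp_def lm_id_def)
      show "st ?c = st ?i" by (rule extensionalityI[of _ "points (lm_prod (Spec P) (Spec Q))"]) (simp_all add: *, simp_all add: lm_comp_def lm_id_def)
    qed
  qed
  ultimately show ?thesis using c split_spec_hom unfolding lm_inverse_def by blast
qed

theorem Spec_prod_iso_inverse:
  "lm_inverse (Spec (P \<times>\<times> Q)) (lm_prod (Spec P) (Spec Q)) Spec_cmp (Spec_prod_iso P Q)"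
  unfolding Spec_prod_iso_def
  by (rule theI[where P = "lm_inverse (Spec (P \<times>\<times> Q)) (lm_prod (Spec P) (Spec Q)) Spec_cmp", OF split_spec_inverse]) 
     (rule lm_inverse_unique[OF _ split_spec_inverse])

end

end

theory Submission
  imports Defs
begin

text \<open>The points of a group fan form a topological group, because products of fans have the product
  topology. In a topological group specialization is symmetric: if every neighbourhood of \<open>x\<close>
  contains \<open>y\<close>, then the homeomorphism \<open>z \<mapsto> x z\<^sup>-\<^sup>1 y\<close>, which exchanges \<open>x\<close> and \<open>y\<close>, shows the
  converse. But every point of \<open>Spec P\<close> is a generization of the closed point, the face of units. Hence an
  affine open subset of a group fan is a single point, and a group fan that is affine or connected has
  only one point. On a one-point group fan the counit laws force the comultiplication of the stalk to be
  \<open>a \<mapsto> (a, a)\<close>, and the coinverse law then makes the stalk an abelian group. So morphisms between such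
  group fans are simply homomorphisms between their stalks.\<close>

section \<open>Equivalences of categories\<close>

lemma is_categoryD:
  assumes "is_category C"
  shows "X \<in> Ob C \<Longrightarrow> Id C X \<in> Hom C X X"
    and "X \<in> Ob C \<Longrightarrow> Y \<in> Ob C \<Longrightarrow> Z \<in> Ob C \<Longrightarrow> f \<in> Hom C X Y \<Longrightarrow> g \<in> Hom C Y Z \<Longrightarrow>
      Comp C X Y Z g f \<in> Hom C X Z"
    and "X \<in> Ob C \<Longrightarrow> Y \<in> Ob C \<Longrightarrow> f \<in> Hom C X Y \<Longrightarrow> Comp C X Y Y (Id C Y) f = f"
    and "X \<in> Ob C \<Longrightarrow> Y \<in> Ob C \<Longrightarrow> f \<in> Hom C X Y \<Longrightarrow> Comp C X X Y f (Id C X) = f"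
    and "W \<in> Ob C \<Longrightarrow> X \<in> Ob C \<Longrightarrow> Y \<in> Ob C \<Longrightarrow> Z \<in> Ob C \<Longrightarrow>
      f \<in> Hom C W X \<Longrightarrow> g \<in> Hom C X Y \<Longrightarrow> h \<in> Hom C Y Z \<Longrightarrow>
      Comp C W X Z (Comp C X Y Z h g) f = Comp C W Y Z h (Comp C W X Y g f)"
  using assms unfolding is_category_def by blast+

lemma is_functorD:
  assumes "is_functor C D F"
  shows "is_category C" "is_category D"
    and "X \<in> Ob C \<Longrightarrow> FOb F X \<in> Ob D"
    and "X \<in> Ob C \<Longrightarrow> Y \<in> Ob C \<Longrightarrow> f \<in> Hom C X Y \<Longrightarrow> FArr F X Y f \<in> Hom D (FOb F X) (FOb F Y)"
    and "X \<in> Ob C \<Longrightarrow> FArr F X X (Id C X) = Id D (FOb F X)"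
    and "X \<in> Ob C \<Longrightarrow> Y \<in> Ob C \<Longrightarrow> Z \<in> Ob C \<Longrightarrow> f \<in> Hom C X Y \<Longrightarrow> g \<in> Hom C Y Z \<Longrightarrow>
      FArr F X Z (Comp C X Y Z g f) =
      Comp D (FOb F X) (FOb F Y) (FOb F Z) (FArr F Y Z g) (FArr F X Y f)"
  using assms unfolding is_functor_def by blast+

lemma is_functor_id: "is_category C \<Longrightarrow> is_functor C C id_functor"
  unfolding is_functor_def id_functor_def by simp

lemma is_functor_comp:
  assumes "is_functor C D F" "is_functor D E G"
  shows "is_functor C E (comp_functor G F)"
  unfolding is_functor_def[of C E] comp_functor_def
  using is_functorD[OF assms(1)] is_functorD[OF assms(2)] by simp

text \<open>A fully faithful, essentially surjective functor has a quasi-inverse: choose for each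
  \<open>Y\<close> a preimage \<open>R Y\<close> with an isomorphism from \<open>F (R Y)\<close> to
  \<open>Y\<close>, conjugate arrows by these isomorphisms, and lift the results along
  \<open>F\<close>.\<close>

theorem is_equivalenceI:
  assumes F: "is_functor C D F"
    and faithful: "\<And>X Y f g. X \<in> Ob C \<Longrightarrow> Y \<in> Ob C \<Longrightarrow> f \<in> Hom C X Y \<Longrightarrow> g \<in> Hom C X Y \<Longrightarrow>
      FArr F X Y f = FArr F X Y g \<Longrightarrow> f = g"
    and full: "\<And>X Y h. X \<in> Ob C \<Longrightarrow> Y \<in> Ob C \<Longrightarrow> h \<in> Hom D (FOb F X) (FOb F Y) \<Longrightarrow>
      \<exists>f\<in>Hom C X Y. FArr F X Y f = h"
    and surj: "\<And>Y. Y \<in> Ob D \<Longrightarrow> \<exists>X\<in>Ob C. \<exists>f. is_iso D (FOb F X) Y f"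
  shows "is_equivalence C D F"
proof -
  note FD = is_functorD[OF F]
  note C = is_categoryD[OF FD(1)] and D = is_categoryD[OF FD(2)]
  have "\<exists>X f g. X \<in> Ob C \<and> f \<in> Hom D (FOb F X) Y \<and> g \<in> Hom D Y (FOb F X) \<and>
      Comp D (FOb F X) Y (FOb F X) g f = Id D (FOb F X) \<and> Comp D Y (FOb F X) Y f g = Id D Y"
    if "Y \<in> Ob D" for Y
    using surj[OF that] unfolding is_iso_def by blast
  then obtain R e e' where R: "R Y \<in> Ob C" and e: "e Y \<in> Hom D (FOb F (R Y)) Y"
    and e': "e' Y \<in> Hom D Y (FOb F (R Y))"
    and e'e: "Comp D (FOb F (R Y)) Y (FOb F (R Y)) (e' Y) (e Y) = Id D (FOb F (R Y))"
    and ee': "Comp D Y (FOb F (R Y)) Y (e Y) (e' Y) = Id D Y" if "Y \<in> Ob D" for Y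
    by metis
  \<comment> \<open>\<open>L\<close> picks a preimage of an arrow under \<open>F\<close>; it exists
    by fullness and is unique by faithfulness.\<close>
  define L where "L X Y h = (SOME f. f \<in> Hom C X Y \<and> FArr F X Y f = h)" for X Y h
  have L: "L X Y h \<in> Hom C X Y" "FArr F X Y (L X Y h) = h"
    if "X \<in> Ob C" "Y \<in> Ob C" "h \<in> Hom D (FOb F X) (FOb F Y)" for X Y h
    using someI_ex[of "\<lambda>f. f \<in> Hom C X Y \<and> FArr F X Y f = h"] full[OF that] unfolding L_def by blast+
  \<comment> \<open>The conjugate of \<open>h\<close> by the chosen isomorphisms. It is the arrow
    that \<open>F\<close> must assign to the value of the quasi-inverse at \<open>h\<close>.\<close>
  define c where "c Y Z h = Comp D (FOb F (R Y)) Y (FOb F (R Z)) (Comp D Y Z (FOb F (R Z)) (e' Z) h) (e Y)"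
    for Y Z h
  have c: "c Y Z h \<in> Hom D (FOb F (R Y)) (FOb F (R Z))"
    if "Y \<in> Ob D" "Z \<in> Ob D" "h \<in> Hom D Y Z" for Y Z h
    unfolding c_def using that by (intro D(2)[of _ Y] D(2)[of _ Z] e e' FD(3) R)
  \<comment> \<open>The law \<open>ee'\<close> in the form needed once associativity has nested all
    composites to the right.\<close>
  have cancel: "Comp D W (FOb F (R Y)) Y (e Y) (Comp D W Y (FOb F (R Y)) (e' Y) t) = t"
    if "W \<in> Ob D" "Y \<in> Ob D" "t \<in> Hom D W Y" for W Y t
    using D(5)[of W Y "FOb F (R Y)" Y t "e' Y" "e Y"] that
    by (simp add: FD(3) R e e' ee' D(3))
  have ec: "Comp D (FOb F (R Y)) (FOb F (R Z)) Z (e Z) (c Y Z h) = Comp D (FOb F (R Y)) Y Z h (e Y)"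
    if "Y \<in> Ob D" "Z \<in> Ob D" "h \<in> Hom D Y Z" for Y Z h
    unfolding c_def using that by (simp add: D(2,5) FD(3) R e e' cancel)
  have c_id: "c Y Y (Id D Y) = Id D (FOb F (R Y))" if "Y \<in> Ob D" for Y
    unfolding c_def using that by (simp add: D(4) e' FD(3) R e'e)
  have c_comp: "c X Z (Comp D X Y Z g h) =
      Comp D (FOb F (R X)) (FOb F (R Y)) (FOb F (R Z)) (c Y Z g) (c X Y h)"
    if "X \<in> Ob D" "Y \<in> Ob D" "Z \<in> Ob D" "h \<in> Hom D X Y" "g \<in> Hom D Y Z" for X Y Z g h
    unfolding c_def using that by (simp add: D(2,5) FD(3) R e e' cancel)
  define G where "G = \<lparr>FOb = R, FArr = (\<lambda>Y Z h. L (R Y) (R Z) (c Y Z h))\<rparr>"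
  have Lc: "L (R Y) (R Z) (c Y Z h) \<in> Hom C (R Y) (R Z)" "FArr F (R Y) (R Z) (L (R Y) (R Z) (c Y Z h)) = c Y Z h"
    if "Y \<in> Ob D" "Z \<in> Ob D" "h \<in> Hom D Y Z" for Y Z h
    using L[OF R R c] that by simp_all
  \<comment> \<open>Since \<open>F\<close> is faithful, the functor laws of \<open>G\<close> can be
    checked after applying \<open>F\<close>, where they become \<open>c_id\<close> and
    \<open>c_comp\<close>.\<close>
  have G: "is_functor D C G"
    unfolding is_functor_def
  proof (intro conjI ballI)
    fix X assume X: "X \<in> Ob D"
    show "FArr G X X (Id D X) = Id C (FOb G X)"
      by (rule faithful[OF R[OF X] R[OF X]]) (use X in \<open>simp_all add: G_def L D(1) C(1) R c_id FD(3,5)\<close>)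
  next
    fix X Y Z f g assume a: "X \<in> Ob D" "Y \<in> Ob D" "Z \<in> Ob D" "f \<in> Hom D X Y" "g \<in> Hom D Y Z"
    show "FArr G X Z (Comp D X Y Z g f) =
        Comp C (FOb G X) (FOb G Y) (FOb G Z) (FArr G Y Z g) (FArr G X Y f)"
      by (rule faithful[OF R[OF a(1)] R[OF a(3)]])
        (use a in \<open>simp_all add: G_def L c D(2) C(2)[of _ "R Y"] R c_comp FD(3) FD(6)[of _ "R Y"]\<close>)
  qed (simp_all add: FD G_def R Lc)
  \<comment> \<open>The chosen isomorphisms \<open>e\<close> are the components of this
    transformation; \<open>ec\<close> is its naturality.\<close>
  have "naturally_isomorphic D D (comp_functor F G) id_functor"
    unfolding naturally_isomorphic_def
    by (intro conjI is_functor_comp[OF G F] is_functor_id[OF FD(2)] exI[of _ e])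
      (auto simp: is_iso_def comp_functor_def id_functor_def G_def e ee' e'e Lc ec intro!: bexI[OF _ e'])
  moreover have "naturally_isomorphic C C (comp_functor G F) id_functor"
  proof -
    \<comment> \<open>The components on the side of \<open>C\<close> are lifts of \<open>e\<close>
      at the objects \<open>F X\<close>; that they are invertible and natural is again tested after
      applying \<open>F\<close>.\<close>
    define \<eta> where "\<eta> X = L (R (FOb F X)) X (e (FOb F X))" for X
    define \<eta>' where "\<eta>' X = L X (R (FOb F X)) (e' (FOb F X))" for X
    have \<eta>: "\<eta> X \<in> Hom C (R (FOb F X)) X" "FArr F (R (FOb F X)) X (\<eta> X) = e (FOb F X)" if "X \<in> Ob C" for X
      using that L[of "R (FOb F X)" X] unfolding \<eta>_def by (simp_all add: R FD(3) e)
    have \<eta>': "\<eta>' X \<in> Hom C X (R (FOb F X))" "FArr F X (R (FOb F X)) (\<eta>' X) = e' (FOb F X)" if "X \<in> Ob C" for X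
      using that L[of X "R (FOb F X)"] unfolding \<eta>'_def by (simp_all add: R FD(3) e')
    have RF: "R (FOb F X) \<in> Ob C" if "X \<in> Ob C" for X using R FD(3) that by blast
    have "is_iso C (R (FOb F X)) X (\<eta> X)" if X: "X \<in> Ob C" for X
      unfolding is_iso_def
    proof (intro conjI bexI)
      show "Comp C (R (FOb F X)) X (R (FOb F X)) (\<eta>' X) (\<eta> X) = Id C (R (FOb F X))"
        by (rule faithful[OF RF[OF X] RF[OF X]])
          (simp_all add: X RF \<eta> \<eta>' C(1) C(2)[of _ X] FD(3,5) FD(6)[of _ X] e'e)
      show "Comp C X (R (FOb F X)) X (\<eta> X) (\<eta>' X) = Id C X"
        by (rule faithful[OF X X])
          (simp_all add: X RF \<eta> \<eta>' C(1) C(2)[of _ "R (FOb F X)"] FD(3,5) FD(6)[of _ "R (FOb F X)"] ee')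
    qed (rule \<eta> \<eta>' X)+
    moreover have "Comp C (R (FOb F X)) (R (FOb F Y)) Y (\<eta> Y) (L (R (FOb F X)) (R (FOb F Y)) (c (FOb F X) (FOb F Y) (FArr F X Y f)))
        = Comp C (R (FOb F X)) X Y f (\<eta> X)"
      if a: "X \<in> Ob C" "Y \<in> Ob C" "f \<in> Hom C X Y" for X Y f
    proof (rule faithful[OF RF[OF a(1)] a(2)])
      let ?g = "L (R (FOb F X)) (R (FOb F Y)) (c (FOb F X) (FOb F Y) (FArr F X Y f))"
      note g = Lc[OF FD(3)[OF a(1)] FD(3)[OF a(2)] FD(4)[OF a]]
      show "Comp C (R (FOb F X)) (R (FOb F Y)) Y (\<eta> Y) ?g \<in> Hom C (R (FOb F X)) Y"
        by (rule C(2)[OF RF RF _ g(1) \<eta>(1)]) (fact a)+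
      show "Comp C (R (FOb F X)) X Y f (\<eta> X) \<in> Hom C (R (FOb F X)) Y"
        by (rule C(2)[OF RF _ _ \<eta>(1)]) (fact a)+
      show "FArr F (R (FOb F X)) Y (Comp C (R (FOb F X)) (R (FOb F Y)) Y (\<eta> Y) ?g) =
          FArr F (R (FOb F X)) Y (Comp C (R (FOb F X)) X Y f (\<eta> X))"
        unfolding FD(6)[OF RF[OF a(1)] RF[OF a(2)] a(2) g(1) \<eta>(1)[OF a(2)]]
          FD(6)[OF RF[OF a(1)] a(1) a(2) \<eta>(1)[OF a(1)] a(3)] g(2) \<eta>(2)[OF a(1)] \<eta>(2)[OF a(2)]
        by (rule ec[OF FD(3)[OF a(1)] FD(3)[OF a(2)] FD(4)[OF a]])
    qed
    ultimately show ?thesis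
      unfolding naturally_isomorphic_def
      by (intro conjI is_functor_comp[OF F G] is_functor_id[OF FD(1)] exI[of _ \<eta>])
        (simp_all add: comp_functor_def id_functor_def G_def)
  qed
  ultimately show ?thesis unfolding is_equivalence_def using F G by blast
qed

lemma is_category_opposite: "is_category C \<Longrightarrow> is_category (opposite C)"
  unfolding is_category_def opposite_def by auto

section \<open>Group objects in the opposite category of monoids\<close>

text \<open>The composite \<open>?u\<close> of counit and unit is constantly one. The two counit
  laws therefore read off the second and the first component of \<open>\<delta> g\<close>, and the
  coinverse law then says that \<open>\<iota> g\<close> is inverse to \<open>g\<close>.\<close>

lemma mon_op_group_objectD:
  fixes P :: "'a monoid"
  assumes "mon_op_group_object P \<delta> \<epsilon> \<iota>"
  shows "comm_group P" "\<delta> = (\<lambda>g\<in>carrier P. (g, g))" "\<iota> = (\<lambda>g\<in>carrier P. inv\<^bsub>P\<^esub> g)"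
proof -
  let ?u = "compose (carrier P) (from_trivial P) \<epsilon>"
  have P: "comm_monoid P" and \<delta>: "\<delta> \<in> mon_hom P (P \<times>\<times> P)" and \<iota>: "\<iota> \<in> mon_hom P P"
    and counit: "compose (carrier P) (copair P P P ?u (mon_id P)) \<delta> = mon_id P"
      "compose (carrier P) (copair P P P (mon_id P) ?u) \<delta> = mon_id P"
    and coinv: "compose (carrier P) (copair P P P \<iota> (mon_id P)) \<delta> = ?u"
    using assms unfolding mon_op_group_object_def Let_def by blast+
  interpret P: comm_monoid P by (rule P)
  note dD = mon_homD[OF \<delta>] and iD = mon_homD[OF \<iota>]
  note calc = compose_def copair_def mon_id_def from_trivial_def
  have d: "\<delta> g = (g, g)" if g: "g \<in> carrier P" for g
  proof -
    obtain a b where ab: "\<delta> g = (a, b)" "a \<in> carrier P" "b \<in> carrier P" using dD(1)[OF g] by auto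
    have "b = g" using fun_cong[OF counit(1), of g] g ab by (simp add: calc)
    moreover have "a = g" using fun_cong[OF counit(2), of g] g ab by (simp add: calc)
    ultimately show ?thesis using ab by simp
  qed
  show "\<delta> = (\<lambda>g\<in>carrier P. (g, g))"
    by (rule extensionalityI[OF dD(4)]) (simp_all add: d)
  have i: "\<iota> g \<otimes>\<^bsub>P\<^esub> g = \<one>\<^bsub>P\<^esub>" if g: "g \<in> carrier P" for g
    using fun_cong[OF coinv, of g] g iD(1) by (simp add: calc d)
  show G: "comm_group P"
  proof (rule comm_groupI)
    fix g assume "g \<in> carrier P"
    then show "\<exists>h\<in>carrier P. h \<otimes>\<^bsub>P\<^esub> g = \<one>\<^bsub>P\<^esub>" using i iD(1) by blast
  qed (simp_all add: P.m_ac)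
  interpret G: comm_group P by (rule G)
  show "\<iota> = (\<lambda>g\<in>carrier P. inv\<^bsub>P\<^esub> g)"
    by (rule extensionalityI[OF iD(4)]) (simp_all add: G.inv_equality[OF i _ iD(1)])
qed

section \<open>Morphisms of locally monoidal spaces\<close>

lemma lm_id_hom:
  assumes X: "locally_monoidal X"
  shows "lm_id X \<in> lm_hom X X"
proof (rule lm_homI)
  show "continuous_map (space_of X) (space_of X) (pt (lm_id X))"
    by (rule continuous_map_eq[OF continuous_map_id]) (simp add: lm_id_def)
  show "pt (lm_id X) \<in> extensional (points X)" "st (lm_id X) \<in> extensional (points X)"
    by (simp_all add: lm_id_def)
  show "st (lm_id X) x \<in> mon_hom (stalk X (pt (lm_id X) x)) (stalk X x)"
    "local_hom (stalk X (pt (lm_id X) x)) (stalk X x) (st (lm_id X) x)" if x: "x \<in> points X" for x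
  proof -
    interpret comm_monoid "stalk X x" using locally_monoidalD(1)[OF X x] .
    show "st (lm_id X) x \<in> mon_hom (stalk X (pt (lm_id X) x)) (stalk X x)"
      by (rule mon_homI) (use x in \<open>simp_all add: lm_id_def\<close>)
    show "local_hom (stalk X (pt (lm_id X) x)) (stalk X x) (st (lm_id X) x)"
      by (rule local_homI) (use x in \<open>simp_all add: lm_id_def\<close>)
  qed
  fix V s assume V: "openin (space_of X) V" and s: "s \<in> sect X V"
  have e: "{x \<in> points X. pt (lm_id X) x \<in> V} = V"
    using openin_subset[OF V] by (auto simp: lm_id_def)
  have sV: "s \<in> (\<Pi>\<^sub>E x\<in>V. carrier (stalk X x))" using locally_monoidalD(2)[OF X V s] .
  have "(\<lambda>x\<in>V. st (lm_id X) x (s (pt (lm_id X) x))) = s"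
    by (rule extensionalityI[of _ V])
      (use openin_subset[OF V] sV in \<open>auto simp: lm_id_def PiE_iff subset_iff\<close>)
  then show "(\<lambda>x\<in>{x \<in> points X. pt (lm_id X) x \<in> V}. st (lm_id X) x (s (pt (lm_id X) x)))
      \<in> sect X {x \<in> points X. pt (lm_id X) x \<in> V}"
    unfolding e using s by simp
qed

lemma lm_comp_hom:
  assumes X: "locally_monoidal X" and Y: "locally_monoidal Y" and Z: "locally_monoidal Z"
    and f: "f \<in> lm_hom X Y" and g: "g \<in> lm_hom Y Z"
  shows "lm_comp X Z g f \<in> lm_hom X Z"
proof (rule lm_homI)
  note fD = lm_homD[OF f] and gD = lm_homD[OF g]
  have p: "pt (lm_comp X Z g f) x = pt g (pt f x)" if "x \<in> points X" for x
    using that by (simp add: lm_comp_def)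
  show "continuous_map (space_of X) (space_of Z) (pt (lm_comp X Z g f))"
    by (rule continuous_map_eq[OF continuous_map_compose[OF fD(1) gD(1)]]) (simp add: p)
  show "pt (lm_comp X Z g f) \<in> extensional (points X)" by (simp add: lm_comp_def)
  show "st (lm_comp X Z g f) \<in> extensional (points X)" by (rule lm_comp_ext)
  show "st (lm_comp X Z g f) x \<in> mon_hom (stalk Z (pt (lm_comp X Z g f) x)) (stalk X x)"
    "local_hom (stalk Z (pt (lm_comp X Z g f) x)) (stalk X x) (st (lm_comp X Z g f) x)"
    if x: "x \<in> points X" for x
  proof -
    note y = fD(7)[OF x] note z = gD(7)[OF y]
    interpret comm_monoid "stalk Z (pt g (pt f x))" using locally_monoidalD(1)[OF Z z] .
    note F = mon_homD[OF fD(4)[OF x]] and G = mon_homD[OF gD(4)[OF y]]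
    show "st (lm_comp X Z g f) x \<in> mon_hom (stalk Z (pt (lm_comp X Z g f) x)) (stalk X x)"
      by (rule mon_homI) (use x in \<open>simp_all add: lm_comp_def F G\<close>)
    show "local_hom (stalk Z (pt (lm_comp X Z g f) x)) (stalk X x) (st (lm_comp X Z g f) x)"
      by (rule local_homI)
        (use x in \<open>simp add: lm_comp_def local_homD[OF fD(5)[OF x] G(1)] local_homD[OF gD(5)[OF y]]\<close>)
  qed
  fix V s assume V: "openin (space_of Z) V" and s: "s \<in> sect Z V"
  let ?W = "{y \<in> points Y. pt g y \<in> V}"
  have W: "openin (space_of Y) ?W" using gD(1) V by (auto simp: continuous_map_def)
  have e: "{x \<in> points X. pt (lm_comp X Z g f) x \<in> V} = {x \<in> points X. pt f x \<in> ?W}"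
    using fD(7) p by auto
  have c: "s z \<in> carrier (stalk Z z)" if "z \<in> V" for z
    using PiE_mem[OF locally_monoidalD(2)[OF Z V s] that] .
  have "(\<lambda>x\<in>{x \<in> points X. pt f x \<in> ?W}. st (lm_comp X Z g f) x (s (pt (lm_comp X Z g f) x)))
    = (\<lambda>x\<in>{x \<in> points X. pt f x \<in> ?W}. st f x ((\<lambda>y\<in>?W. st g y (s (pt g y))) (pt f x)))"
    by (rule restrict_ext) (auto simp: lm_comp_def c)
  then show "(\<lambda>x\<in>{x \<in> points X. pt (lm_comp X Z g f) x \<in> V}.
      st (lm_comp X Z g f) x (s (pt (lm_comp X Z g f) x))) \<in> sect X {x \<in> points X. pt (lm_comp X Z g f) x \<in> V}"
    unfolding e using fD(6)[OF W gD(6)[OF V s]] by simp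
qed

section \<open>The topological group of points of a group fan\<close>

lemma group_fanD:
  assumes "group_fan \<X>"
  shows "fan (ufan \<X>)" "locally_monoidal (ufan \<X>)"
    "gmult \<X> \<in> lm_hom (lm_prod (ufan \<X>) (ufan \<X>)) (ufan \<X>)"
    "gunit \<X> \<in> lm_hom lm_one (ufan \<X>)" "ginv \<X> \<in> lm_hom (ufan \<X>) (ufan \<X>)"
    "lm_comp (ufan \<X>) (ufan \<X>) (gmult \<X>) (lm_pair (ufan \<X>) (ufan \<X>) (ufan \<X>)
       (lm_comp (ufan \<X>) (ufan \<X>) (gunit \<X>) (lm_bang (ufan \<X>))) (lm_id (ufan \<X>))) = lm_id (ufan \<X>)"
    "lm_comp (ufan \<X>) (ufan \<X>) (gmult \<X>) (lm_pair (ufan \<X>) (ufan \<X>) (ufan \<X>)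
       (lm_id (ufan \<X>)) (lm_comp (ufan \<X>) (ufan \<X>) (gunit \<X>) (lm_bang (ufan \<X>)))) = lm_id (ufan \<X>)"
    "lm_comp (ufan \<X>) (ufan \<X>) (gmult \<X>) (lm_pair (ufan \<X>) (ufan \<X>) (ufan \<X>) (ginv \<X>) (lm_id (ufan \<X>)))
       = lm_comp (ufan \<X>) (ufan \<X>) (gunit \<X>) (lm_bang (ufan \<X>))"
    "lm_comp (ufan \<X>) (ufan \<X>) (gmult \<X>) (lm_pair (ufan \<X>) (ufan \<X>) (ufan \<X>) (lm_id (ufan \<X>)) (ginv \<X>))
       = lm_comp (ufan \<X>) (ufan \<X>) (gunit \<X>) (lm_bang (ufan \<X>))"
  using assms unfolding group_fan_def Let_def fan_def by simp_all

text \<open>Associativity of the group fan, evaluated on the point \<open>((x, y), z)\<close> of the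
  triple product.\<close>

lemma group_fan_assoc:
  assumes \<X>: "group_fan \<X>" and "x \<in> points (ufan \<X>)" "y \<in> points (ufan \<X>)" "z \<in> points (ufan \<X>)"
  shows "pt (gmult \<X>) (pt (gmult \<X>) (x, y), z) = pt (gmult \<X>) (x, pt (gmult \<X>) (y, z))"
proof -
  let ?X = "ufan \<X>" let ?XX = "lm_prod ?X ?X" let ?XXX = "lm_prod ?XX ?X"
  have "lm_comp ?XXX ?X (gmult \<X>) (lm_pair ?XXX ?X ?X (lm_comp ?XXX ?X (gmult \<X>) (lm_fst ?XX ?X)) (lm_snd ?XX ?X)) =
    lm_comp ?XXX ?X (gmult \<X>) (lm_pair ?XXX ?X ?X (lm_comp ?XXX ?X (lm_fst ?X ?X) (lm_fst ?XX ?X))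
      (lm_comp ?XXX ?X (gmult \<X>) (lm_pair ?XXX ?X ?X (lm_comp ?XXX ?X (lm_snd ?X ?X) (lm_fst ?XX ?X)) (lm_snd ?XX ?X))))"
    using \<X> unfolding group_fan_def Let_def by blast
  from fun_cong[OF arg_cong[OF this, of pt], of "((x, y), z)"]
  show ?thesis using assms(2-) by (simp add: lm_comp_def lm_pair_def lm_fst_def lm_snd_def lm_prod_sel)
qed

lemma group_fan_points:
  fixes \<X> :: "('x, 'm) gfan"
  assumes \<X>: "group_fan \<X>"
  defines "e \<equiv> pt (gunit \<X>) UNIV"
  shows "e \<in> points (ufan \<X>)"
    and "x \<in> points (ufan \<X>) \<Longrightarrow> y \<in> points (ufan \<X>) \<Longrightarrow> pt (gmult \<X>) (x, y) \<in> points (ufan \<X>)"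
    and "x \<in> points (ufan \<X>) \<Longrightarrow> pt (ginv \<X>) x \<in> points (ufan \<X>)"
    and "x \<in> points (ufan \<X>) \<Longrightarrow> pt (gmult \<X>) (e, x) = x"
    and "x \<in> points (ufan \<X>) \<Longrightarrow> pt (gmult \<X>) (x, e) = x"
    and "x \<in> points (ufan \<X>) \<Longrightarrow> pt (gmult \<X>) (pt (ginv \<X>) x, x) = e"
    and "x \<in> points (ufan \<X>) \<Longrightarrow> pt (gmult \<X>) (x, pt (ginv \<X>) x) = e"
proof -
  note D = group_fanD[OF \<X>]
  show "e \<in> points (ufan \<X>)" unfolding e_def by (rule lm_homD(7)[OF D(4)]) (simp add: lm_one_sel)
  show "pt (gmult \<X>) (x, y) \<in> points (ufan \<X>)" if "x \<in> points (ufan \<X>)" "y \<in> points (ufan \<X>)"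
    by (rule lm_homD(7)[OF D(3)]) (use that in \<open>simp add: lm_prod_sel\<close>)
  assume x: "x \<in> points (ufan \<X>)"
  show "pt (ginv \<X>) x \<in> points (ufan \<X>)" by (rule lm_homD(7)[OF D(5) x])
  note E = D(6-9)[THEN arg_cong[of _ _ pt], THEN fun_cong[of _ _ x]]
  show "pt (gmult \<X>) (e, x) = x" "pt (gmult \<X>) (x, e) = x"
    "pt (gmult \<X>) (pt (ginv \<X>) x, x) = e" "pt (gmult \<X>) (x, pt (ginv \<X>) x) = e"
    using x E by (simp_all add: e_def lm_comp_def lm_pair_def lm_id_def lm_bang_def)
qed

lemma group_fan_specialization_sym:
  fixes \<X> :: "('x, 'm) gfan"
  assumes \<X>: "group_fan \<X>" and x: "x \<in> points (ufan \<X>)" and y: "y \<in> points (ufan \<X>)"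
    and spec: "\<And>U. openin (space_of (ufan \<X>)) U \<Longrightarrow> x \<in> U \<Longrightarrow> y \<in> U"
    and U: "openin (space_of (ufan \<X>)) U" "y \<in> U"
  shows "x \<in> U"
proof -
  let ?T = "space_of (ufan \<X>)"
  note D = group_fanD[OF \<X>] and P = group_fan_points[OF \<X>]
  define \<phi> where "\<phi> z = pt (gmult \<X>) (x, pt (gmult \<X>) (pt (ginv \<X>) z, y))" for z
  have m: "continuous_map (prod_topology ?T ?T) ?T (pt (gmult \<X>))"
    using lm_homD(1)[OF D(3)] by (simp add: lm_prod_sel)
  \<comment> \<open>A pair of continuous maps is continuous into the product topology, which is the
    topology of the product fan, so multiplication preserves continuity.\<close>
  have pm: "continuous_map ?T ?T (\<lambda>z. pt (gmult \<X>) (f z, g z))"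
    if "continuous_map ?T ?T f" "continuous_map ?T ?T g" for f g
    using continuous_map_compose[OF _ m, of ?T "\<lambda>z. (f z, g z)"] that
    by (simp add: continuous_map_pairwise o_def)
  have \<phi>: "continuous_map ?T ?T \<phi>"
    unfolding \<phi>_def by (intro pm lm_homD(1)[OF D(5)]) (use x y in simp_all)
  have "\<phi> x = y"
    unfolding \<phi>_def
    using group_fan_assoc[OF \<X> x P(3)[OF x] y] by (simp add: P(4)[OF y] P(7)[OF x])
  moreover have "\<phi> y = x"
    unfolding \<phi>_def by (simp add: P(6)[OF y] P(5)[OF x])
  moreover have "openin ?T {z \<in> topspace ?T. \<phi> z \<in> U}"
    using \<phi> U(1) by (auto simp: continuous_map_def)
  \<comment> \<open>The preimage of \<open>U\<close> under \<open>\<phi>\<close> is an open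
    neighbourhood of \<open>x\<close>, because \<open>\<phi> x = y\<close>. By \<open>spec\<close>
    it contains \<open>y\<close>, and \<open>\<phi> y = x\<close>.\<close>
  ultimately show ?thesis using spec[of "{z \<in> topspace ?T. \<phi> z \<in> U}"] x U(2) by simp
qed

section \<open>The closed point of a spectrum and affine open subsets of a group fan\<close>

lemma (in comm_monoid) Units_face: "Units G \<in> faces G"
proof (rule facesI)
  show "submonoid (Units G) G" by (rule submonoid.intro) auto
qed (simp add: Units_mult_iff)

lemma (in comm_monoid) Units_subset_face:
  assumes "F \<in> faces G" shows "Units G \<subseteq> F"
proof
  fix u assume u: "u \<in> Units G"
  have "u \<otimes> inv u \<in> F" using facesD(2)[OF assms] u by simp
  then show "u \<in> F" using facesD(4)[OF assms Units_closed[OF u] _] u Units_inv_closed by blast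
qed

text \<open>A basic open set around the face of units is given by a unit \<open>p\<close>, and a
  unit lies in every face.\<close>

lemma (in comm_monoid) open_Units_face:
  assumes U: "openin Tp U" and "Units G \<in> U" shows "U = faces G"
proof -
  obtain p where p: "p \<in> Units G" "spec_basic G p \<subseteq> U"
    using openin_TpE[OF U \<open>Units G \<in> U\<close>] .
  then show ?thesis using openin_subset[OF U] Units_subset_face unfolding topspace_Tp spec_basic_def by blast
qed

text \<open>Here \<open>f\<close> and \<open>g\<close> are mutually inverse homeomorphisms between
  \<open>U\<close> and the spectrum. The face of units lies in the closure of every point of the
  spectrum; symmetry of specialization in the group fan forces every face to equal it.\<close>

lemma group_fan_affine_open:
  fixes P :: "'p monoid"
  assumes \<X>: "group_fan \<X>" and P: "comm_monoid P" and U: "openin (space_of (ufan \<X>)) U"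
    and f: "continuous_map (subtopology (space_of (ufan \<X>)) U) (space_of (Spec P)) f"
    and g: "continuous_map (space_of (Spec P)) (subtopology (space_of (ufan \<X>)) U) g"
    and gf: "\<And>x. x \<in> U \<Longrightarrow> g (f x) = x" and fg: "\<And>F. F \<in> faces P \<Longrightarrow> f (g F) = F"
  shows "faces P = {carrier P}" "U = {g (carrier P)}"
proof -
  interpret P: comm_monoid P by fact
  let ?T = "space_of (ufan \<X>)"
  have UX: "U \<subseteq> topspace ?T" using openin_subset[OF U] .
  have top: "topspace (subtopology ?T U) = U" using UX by auto
  have fU: "f x \<in> faces P" if "x \<in> U" for x
    using f that unfolding continuous_map_def P.Spec_sel P.topspace_Tp top by auto
  have gU: "g F \<in> U" if "F \<in> faces P" for F
    using g that unfolding continuous_map_def P.Spec_sel P.topspace_Tp top by auto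
  have triv: "F \<subseteq> Units P" if F: "F \<in> faces P" for F
  proof
    fix p assume p: "p \<in> F"
    have pc: "p \<in> carrier P" using facesD(1)[OF F] p by blast
    \<comment> \<open>A neighbourhood of \<open>g (Units P)\<close> pulls back along
      \<open>g\<close> to an open set containing the closed point, hence to all of the
      spectrum.\<close>
    have gen: "g F \<in> W" if W: "openin ?T W" "g (Units P) \<in> W" for W
    proof -
      have "openin (subtopology ?T U) (W \<inter> U)"
        using W(1) by (auto simp: openin_subtopology)
      then have "openin P.Tp {H \<in> faces P. g H \<in> W \<inter> U}"
        using g unfolding continuous_map_def P.Spec_sel P.topspace_Tp by blast
      then have "{H \<in> faces P. g H \<in> W \<inter> U} = faces P"
        using P.open_Units_face P.Units_face gU W(2) by blast
      then show ?thesis using F by blast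
    qed
    \<comment> \<open>The basic open set of \<open>p\<close>, transported to \<open>U\<close>, is
      open in the whole group fan because \<open>U\<close> is open.\<close>
    have o: "openin ?T {x \<in> U. f x \<in> spec_basic P p}"
    proof -
      have "openin (subtopology ?T U) {x \<in> U. f x \<in> spec_basic P p}"
        using f P.openin_spec_basic[OF pc] unfolding continuous_map_def P.Spec_sel top by blast
      then show ?thesis using openin_trans_full U by blast
    qed
    \<comment> \<open>This neighbourhood contains \<open>g F\<close> since \<open>p\<close> lies in
      \<open>F\<close>; by symmetry it contains \<open>g (Units P)\<close>, which says that
      \<open>p\<close> is a unit.\<close>
    have "g (Units P) \<in> {x \<in> U. f x \<in> spec_basic P p}"
      by (rule group_fan_specialization_sym[OF \<X> _ _ gen o])
        (use gU[OF F] gU[OF P.Units_face] UX F p in \<open>auto simp: fg spec_basic_def\<close>)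
    then show "p \<in> Units P" by (simp add: fg[OF P.Units_face] spec_basic_def)
  qed
  \<comment> \<open>Applied to the face \<open>carrier P\<close>, \<open>triv\<close> makes every
    element a unit. As each face contains the units, only one face is left.\<close>
  have "carrier P \<in> faces P"
    unfolding faces_def using P.carrier_not_empty by (auto intro!: submonoid.intro)
  moreover have "F = carrier P" if F: "F \<in> faces P" for F
    using triv[OF \<open>carrier P \<in> faces P\<close>] P.Units_subset_face[OF F] facesD(1)[OF F] by order
  ultimately show 1: "faces P = {carrier P}" by blast
  have "x = g (carrier P)" if "x \<in> U" for x
    using fU[OF that] gf[OF that] unfolding 1 by simp
  then show "U = {g (carrier P)}" using gU[of "carrier P"] unfolding 1 by blast
qed

section \<open>One-point spaces\<close>

lemma openin_point: "points X = {x} \<Longrightarrow> openin (space_of X) V \<longleftrightarrow> V = {} \<or> V = {x}"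
  using openin_topspace[of "space_of X"] openin_subset[of "space_of X" V] by auto

text \<open>The only neighbourhood of \<open>x\<close> is the whole space, so every germ at
  \<open>x\<close> comes from a global section, and that section is determined by its value at
  \<open>x\<close>.\<close>

lemma sect_point:
  assumes X: "locally_monoidal X" and x: "points X = {x}"
  shows "sect X {x} = (\<Pi>\<^sub>E z\<in>{x}. carrier (stalk X z))"
proof
  note XD = locally_monoidalD[OF X] and o = openin_point[OF x]
  show "sect X {x} \<subseteq> (\<Pi>\<^sub>E z\<in>{x}. carrier (stalk X z))" using XD(2) o by blast
  show "(\<Pi>\<^sub>E z\<in>{x}. carrier (stalk X z)) \<subseteq> sect X {x}"
  proof
    fix s assume s: "s \<in> (\<Pi>\<^sub>E z\<in>{x}. carrier (stalk X z))"
    then obtain t where t: "t \<in> sect X {x}" "t x = s x"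
      using XD(8)[of x "s x"] x o by auto
    have "t \<in> (\<Pi>\<^sub>E z\<in>{x}. carrier (stalk X z))" using XD(2)[OF _ t(1)] o by blast
    then have "s = t" using s t(2) by (intro extensionalityI[of _ "{x}"]) (auto simp: PiE_iff)
    then show "s \<in> sect X {x}" using t(1) by simp
  qed
qed

text \<open>The stalk map \<open>h\<close> runs backwards, from the stalk at \<open>y\<close> to the
  stalk at \<open>x\<close>. The restrictions to \<open>{x}\<close> provide the extensionality that
  \<open>lm_hom\<close> demands.\<close>

definition point_map :: "'x \<Rightarrow> 'y \<Rightarrow> ('n \<Rightarrow> 'm) \<Rightarrow> ('x, 'm, 'y, 'n) lmmap" where
  "point_map x y h = \<lparr>pt = (\<lambda>_\<in>{x}. y), st = (\<lambda>_\<in>{x}. h)\<rparr>"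

lemma point_map_hom:
  assumes X: "locally_monoidal X" and x: "points X = {x}"
    and Y: "locally_monoidal Y" and y: "points Y = {y}"
    and h: "h \<in> mon_hom (stalk Y y) (stalk X x)" "local_hom (stalk Y y) (stalk X x) h"
  shows "point_map x y h \<in> lm_hom X Y"
proof (rule lm_homI)
  show "continuous_map (space_of X) (space_of Y) (pt (point_map x y h))"
    by (rule continuous_map_eq[of _ _ "\<lambda>_. y"]) (use x y in \<open>simp_all add: point_map_def\<close>)
  fix V s assume V: "openin (space_of Y) V" and s: "s \<in> sect Y V"
  let ?V = "{z \<in> points X. pt (point_map x y h) z \<in> V}"
  let ?s = "\<lambda>z\<in>?V. st (point_map x y h) z (s (pt (point_map x y h) z))"
  consider "V = {}" | "V = {y}" using V openin_point[OF y] by blast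
  then show "?s \<in> sect X ?V"
  proof cases
    case 1
    then show ?thesis using locally_monoidalD(3)[OF X, of "{}"] by (simp add: restrict_def)
  next
    case 2
    then have V': "?V = {x}" using x by (auto simp: point_map_def)
    have "s y \<in> carrier (stalk Y y)" using s unfolding 2 sect_point[OF Y y] by auto
    then show ?thesis unfolding V' sect_point[OF X x] using mon_homD(1)[OF h(1)] by (auto simp: point_map_def)
  qed
qed (use x h in \<open>simp_all add: point_map_def\<close>)

text \<open>This reduces every diagram of one-point spaces to an equation between homomorphisms of
  single stalks.\<close>

lemma lm_hom_point_eqI:
  assumes f: "f \<in> lm_hom X Y" and g: "g \<in> lm_hom X Y" and x: "points X = {x}" and y: "points Y = {y}"
    and eq: "\<And>a. a \<in> carrier (stalk Y y) \<Longrightarrow> st f x a = st g x a"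
  shows "f = g"
proof (rule lm_map_eqI)
  note fD = lm_homD[OF f] and gD = lm_homD[OF g]
  have p: "pt f x = y" "pt g x = y" using fD(7) gD(7) x y by auto
  show "pt f = pt g" by (rule extensionalityI[OF fD(2) gD(2)]) (simp add: x p)
  have "st f x = st g x"
    using fD(4)[of x] gD(4)[of x] x p
    by (intro extensionalityI[of _ "carrier (stalk Y y)"] eq) (auto dest: mon_homD(4))
  then show "st f = st g" by (intro extensionalityI[OF fD(3) gD(3)]) (simp add: x)
qed

lemma lm_hom_point:
  assumes "f \<in> lm_hom X Y" "points X = {x}" "points Y = {y}"
  shows "pt f x = y" "st f x \<in> mon_hom (stalk Y y) (stalk X x)"
  using lm_homD(4,7)[OF assms(1), of x] assms(2,3) by auto

text \<open>All elements of both groups are units, so locality is automatic.\<close>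

lemma local_hom_group:
  assumes "group Q" "group P" "h \<in> mon_hom Q P" shows "local_hom Q P h"
  by (rule local_homI) (use assms in \<open>simp add: group.Units_eq mon_homD(1)\<close>)

lemma lm_isomorphic_point:
  assumes X: "locally_monoidal X" "points X = {x}" "comm_group (stalk X x)"
    and Y: "locally_monoidal Y" "points Y = {y}" "comm_group (stalk Y y)"
    and h: "h \<in> mon_hom (stalk Y y) (stalk X x)" and k: "k \<in> mon_hom (stalk X x) (stalk Y y)"
    and kh: "\<And>b. b \<in> carrier (stalk Y y) \<Longrightarrow> k (h b) = b"
    and hk: "\<And>a. a \<in> carrier (stalk X x) \<Longrightarrow> h (k a) = a"
  shows "lm_isomorphic X Y"
proof -
  note gX = comm_group.axioms(2)[OF X(3)] and gY = comm_group.axioms(2)[OF Y(3)]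
  have f: "point_map x y h \<in> lm_hom X Y" by (intro point_map_hom X Y h local_hom_group gX gY)
  have g: "point_map y x k \<in> lm_hom Y X" by (intro point_map_hom X Y k local_hom_group gX gY)
  have "lm_comp X X (point_map y x k) (point_map x y h) = lm_id X"
    by (rule lm_hom_point_eqI[OF lm_comp_hom[OF X(1) Y(1) X(1) f g] lm_id_hom[OF X(1)] X(2) X(2)])
      (use X(2) hk in \<open>simp add: lm_comp_def lm_id_def point_map_def\<close>)
  moreover have "lm_comp Y Y (point_map x y h) (point_map y x k) = lm_id Y"
    by (rule lm_hom_point_eqI[OF lm_comp_hom[OF Y(1) X(1) Y(1) g f] lm_id_hom[OF Y(1)] Y(2) Y(2)])
      (use Y(2) kh in \<open>simp add: lm_comp_def lm_id_def point_map_def\<close>)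
  ultimately show ?thesis unfolding lm_isomorphic_def lm_inverse_def using f g by blast
qed

section \<open>Abelian groups as monoids: their only face and the localization at it\<close>

lemma (in comm_group) faces_group: "faces G = {carrier G}"
proof -
  have "F = carrier G" if F: "F \<in> faces G" for F
    using Units_subset_face[OF F] facesD(1)[OF F] by (simp add: Units_eq)
  then show ?thesis using Units_face unfolding Units_eq by blast
qed

text \<open>The localization map to fractions with denominator one. For an abelian group it is an
  isomorphism, with inverse \<open>loc_ret\<close>, so the stalk at the only point of the spectrum
  is the group itself.\<close>

abbreviation loc_inc :: "('a, 'b) monoid_scheme \<Rightarrow> 'a \<Rightarrow> ('a \<times> 'a) set" where
  "loc_inc G \<equiv> \<lambda>a\<in>carrier G. loc_frac G (carrier G) a \<one>\<^bsub>G\<^esub>"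

abbreviation loc_ret :: "('a, 'b) monoid_scheme \<Rightarrow> ('a \<times> 'a) set \<Rightarrow> 'a" where
  "loc_ret G \<equiv> \<lambda>A\<in>carrier (localization G (carrier G)). inv_into (carrier G) (loc_inc G) A"

context
  fixes G :: "'a monoid" (structure)
  assumes G: "comm_group G"
begin

interpretation comm_group G by (rule G)

lemma carrier_face: "carrier G \<in> faces G" by (simp add: faces_group)

lemma loc_inc_eq_iff:
  assumes "a \<in> carrier G" "b \<in> carrier G"
  shows "loc_frac G (carrier G) a \<one> = loc_frac G (carrier G) b \<one> \<longleftrightarrow> a = b"
proof -
  have "a \<otimes> \<one> \<otimes> h = b \<otimes> \<one> \<otimes> h \<longleftrightarrow> a = b" if "h \<in> carrier G" for h
    using assms that by simp
  then show ?thesis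
    using frac_eq_iff[OF carrier_face assms one_closed one_closed] one_closed by blast
qed

lemma localization_group_cases:
  assumes "A \<in> carrier (localization G (carrier G))"
  obtains a where "a \<in> carrier G" "A = loc_frac G (carrier G) a \<one>"
proof -
  obtain p f where pf: "p \<in> carrier G" "f \<in> carrier G" "A = loc_frac G (carrier G) p f"
    using assms by (rule localization_cases)
  \<comment> \<open>The criterion \<open>frac_eq_iff\<close> with witness one: a fraction equals its
    numerator times the inverse of its denominator, over one.\<close>
  have "p \<otimes> \<one> \<otimes> \<one> = p \<otimes> inv f \<otimes> f \<otimes> \<one>" using pf(1,2) by (simp add: m_assoc)
  then have "A = loc_frac G (carrier G) (p \<otimes> inv f) \<one>"
    using frac_eq_iff[OF carrier_face, of p "p \<otimes> inv f" f \<one>] pf by blast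
  then show ?thesis using that pf by blast
qed

lemma loc_inc_hom: "loc_inc G \<in> mon_hom G (localization G (carrier G))"
  by (rule mon_homI) (simp_all add: frac_in_carrier frac_mult[OF carrier_face] localization_one)

lemma loc_ret_inc: "a \<in> carrier G \<Longrightarrow> loc_ret G (loc_frac G (carrier G) a \<one>) = a"
  using frac_in_carrier[of a \<one> "carrier G"] loc_inc_eq_iff
    inv_into_f_f[of "loc_inc G" "carrier G" a] by (simp add: inj_on_def)

lemma loc_ret_loc_inc: "a \<in> carrier G \<Longrightarrow> loc_ret G (loc_inc G a) = a"
  using loc_ret_inc[of a] by (simp only: restrict_apply if_True)

lemma loc_inc_loc_ret:
  assumes "A \<in> carrier (localization G (carrier G))" shows "loc_inc G (loc_ret G A) = A"
  using assms by (rule localization_group_cases) (simp only: loc_ret_inc, simp)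

lemma loc_ret_hom: "loc_ret G \<in> mon_hom (localization G (carrier G)) G"
proof (rule mon_homI)
  show "loc_ret G \<one>\<^bsub>localization G (carrier G)\<^esub> = \<one>"
    unfolding localization_one by (rule loc_ret_inc) simp
  show "loc_ret G A \<in> carrier G" if "A \<in> carrier (localization G (carrier G))" for A
    using that by (rule localization_group_cases) (simp only: loc_ret_inc)
  show "loc_ret G (A \<otimes>\<^bsub>localization G (carrier G)\<^esub> B) = loc_ret G A \<otimes> loc_ret G B"
    if "A \<in> carrier (localization G (carrier G))" "B \<in> carrier (localization G (carrier G))" for A B
    using that(1) that(2)
    by (elim localization_group_cases)
      (simp only: frac_mult[OF carrier_face] loc_ret_inc one_closed m_closed r_one)
qed simp

lemma comm_group_localization: "comm_group (localization G (carrier G))"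
proof -
  interpret L: comm_monoid "localization G (carrier G)" by (rule comm_monoid_localization[OF carrier_face])
  show ?thesis
  proof (rule comm_groupI)
    fix A assume "A \<in> carrier (localization G (carrier G))"
    then obtain a where a: "a \<in> carrier G" "A = loc_frac G (carrier G) a \<one>" by (rule localization_group_cases)
    have "loc_frac G (carrier G) (inv a) \<one> \<otimes>\<^bsub>localization G (carrier G)\<^esub> A = \<one>\<^bsub>localization G (carrier G)\<^esub>"
      using a by (simp add: frac_mult[OF carrier_face] localization_one)
    then show "\<exists>B\<in>carrier (localization G (carrier G)). B \<otimes>\<^bsub>localization G (carrier G)\<^esub> A = \<one>\<^bsub>localization G (carrier G)\<^esub>"
      using a frac_in_carrier[of "inv a" \<one> "carrier G"] by auto
  qed (simp_all add: L.m_ac)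
qed

lemma points_Spec_group: "points (Spec G) = {carrier G}"
  unfolding Spec_sel topspace_Tp by (rule faces_group)

end

text \<open>Both spaces have one point, and \<open>loc_inc\<close> and \<open>loc_ret\<close>
  identify their stalks.\<close>

lemma lm_isomorphic_Spec_stalk:
  assumes X: "locally_monoidal X" "points X = {x}" "comm_group (stalk X x)"
  shows "lm_isomorphic X (Spec (stalk X x))"
proof -
  interpret A: comm_group "stalk X x" by fact
  show ?thesis
    by (rule lm_isomorphic_point[OF X A.locally_monoidal_Spec points_Spec_group[OF assms(3)], unfolded A.Spec_sel,
          OF comm_group_localization[OF assms(3)]
          loc_ret_hom[OF assms(3)] loc_inc_hom[OF assms(3)] loc_inc_loc_ret[OF assms(3)] loc_ret_loc_inc[OF assms(3)]])
qed

section \<open>One-point group fans\<close>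

text \<open>The stalk carries the dual of the group structure, and the argument for group objects in
  the opposite category of monoids repeats: the unit laws give the diagonal, the inverse law gives
  inverses.\<close>

lemma gfan_point:
  fixes \<X> :: "('x, 'm) gfan"
  assumes \<X>: "group_fan \<X>" and x: "points (ufan \<X>) = {x}"
  shows "a \<in> carrier (stalk (ufan \<X>) x) \<Longrightarrow> st (gmult \<X>) (x, x) a = (a, a)"
    and "comm_group (stalk (ufan \<X>) x)"
proof -
  let ?X = "ufan \<X>" let ?M = "stalk ?X x"
  note D = group_fanD[OF \<X>]
  have xx: "points (lm_prod ?X ?X) = {(x, x)}" by (simp add: lm_prod_sel x)
  interpret M: comm_monoid ?M using locally_monoidalD(1)[OF D(2)] x by simp
  note m = lm_hom_point[OF D(3) xx x, unfolded lm_prod_sel fst_conv snd_conv]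
  note u = lm_hom_point[OF D(4) lm_one_sel(1) x]
  note i = lm_hom_point[OF D(5) x x]
  \<comment> \<open>The composite of the unit with the map to the terminal fan passes through the
    trivial stalk of \<open>lm_one\<close>, so on stalks it is constantly one.\<close>
  have bang: "st (lm_bang ?X) x (st (gunit \<X>) UNIV a) = \<one>\<^bsub>?M\<^esub>" if "a \<in> carrier ?M" for a
    using mon_homD(1)[OF u(2) that] x by (simp add: lm_bang_def)
  have pb: "pt (lm_bang ?X) x = UNIV" using x by (simp add: lm_bang_def)
  \<comment> \<open>The unit and inverse laws, evaluated on the stalk at \<open>x\<close>.\<close>
  note E = D(6-9)[THEN arg_cong[of _ _ st], THEN fun_cong[of _ _ x], THEN fun_cong]
  note calc = lm_comp_def lm_pair_def lm_id_def x m(1) u(1) i(1) pb bang copair_def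
  show diag: "st (gmult \<X>) (x, x) a = (a, a)" if a: "a \<in> carrier ?M" for a
  proof -
    obtain b c where bc: "st (gmult \<X>) (x, x) a = (b, c)" "b \<in> carrier ?M" "c \<in> carrier ?M"
      using mon_homD(1)[OF m(2) a] by auto
    have "c = a" using E(1)[of a] a bc by (simp add: calc)
    moreover have "b = a" using E(2)[of a] a bc by (simp add: calc)
    ultimately show ?thesis using bc by simp
  qed
  show "comm_group ?M"
  proof (rule comm_groupI)
    fix a assume a: "a \<in> carrier ?M"
    have "st (ginv \<X>) x a \<otimes>\<^bsub>?M\<^esub> a = \<one>\<^bsub>?M\<^esub>"
      using E(3)[of a] a mon_homD(1)[OF i(2) a] by (simp add: calc diag)
    then show "\<exists>b\<in>carrier ?M. b \<otimes>\<^bsub>?M\<^esub> a = \<one>\<^bsub>?M\<^esub>" using mon_homD(1)[OF i(2) a] by blast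
  qed (simp_all add: M.m_ac)
qed

text \<open>Both comultiplications are diagonal, and every stalk map \<open>h\<close> respects the
  diagonal: \<open>b\<close> goes to \<open>(h b, h b)\<close> either way.\<close>

lemma gfan_hom_point:
  assumes \<X>: "group_fan \<X>" and x: "points (ufan \<X>) = {x}"
    and \<Y>: "group_fan \<Y>" and y: "points (ufan \<Y>) = {y}"
  shows "gfan_hom \<X> \<Y> = lm_hom (ufan \<X>) (ufan \<Y>)"
proof -
  let ?X = "ufan \<X>" and ?Y = "ufan \<Y>" let ?XX = "lm_prod ?X ?X" and ?YY = "lm_prod ?Y ?Y"
  note DX = group_fanD[OF \<X>] and DY = group_fanD[OF \<Y>]
  note XX = locally_monoidal_prod[OF DX(2) DX(2)] and YY = locally_monoidal_prod[OF DY(2) DY(2)]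
  have xx: "points ?XX = {(x, x)}" by (simp add: lm_prod_sel x)
  have yy: "points ?YY = {(y, y)}" by (simp add: lm_prod_sel y)
  interpret M: comm_group "stalk ?X x" by (rule gfan_point(2)[OF \<X> x])
  interpret N: comm_group "stalk ?Y y" by (rule gfan_point(2)[OF \<Y> y])
  have "lm_comp ?XX ?Y f (gmult \<X>) = lm_comp ?XX ?Y (gmult \<Y>) (lm_times ?X ?X ?Y ?Y f f)"
    if f: "f \<in> lm_hom ?X ?Y" for f
  proof (rule lm_hom_point_eqI[OF _ _ xx y])
    show "lm_comp ?XX ?Y f (gmult \<X>) \<in> lm_hom ?XX ?Y"
      by (rule lm_comp_hom[OF XX DX(2) DY(2) DX(3) f])
    show "lm_comp ?XX ?Y (gmult \<Y>) (lm_times ?X ?X ?Y ?Y f f) \<in> lm_hom ?XX ?Y"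
      unfolding lm_times_def
      by (intro lm_comp_hom[OF XX YY DY(2)] lm_pair_hom lm_comp_hom[OF XX DX(2) DY(2)]
          lm_fst_hom lm_snd_hom XX DX DY f)
    fix b assume b: "b \<in> carrier (stalk ?Y y)"
    note h = mon_homD[OF lm_hom_point(2)[OF f x y]]
    note c = lm_comp_def lm_times_def lm_pair_def lm_fst_def lm_snd_def copair_def inc_l_def inc_r_def
    show "st (lm_comp ?XX ?Y f (gmult \<X>)) (x, x) b =
      st (lm_comp ?XX ?Y (gmult \<Y>) (lm_times ?X ?X ?Y ?Y f f)) (x, x) b"
      using b h(1)[OF b] lm_hom_point(1)[OF f x y] lm_hom_point(1)[OF DX(3) xx x]
        lm_hom_point(1)[OF DY(3) yy y] gfan_point(1)[OF \<X> x h(1)[OF b]] gfan_point(1)[OF \<Y> y b]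
      by (simp add: c lm_prod_sel x)
  qed
  then show ?thesis unfolding gfan_hom_def by blast
qed

lemma open_subspace_points: "open_subspace X (points X) = X"
  by (simp add: open_subspace_def subtopology_topspace)

lemma fan_point:
  assumes X: "locally_monoidal X" "points X = {x}" "comm_group (stalk X x)"
  shows "fan X"
proof -
  have "affine_fan X"
    unfolding affine_fan_def using X(1,3) lm_isomorphic_Spec_stalk[OF X] comm_group.axioms(1) by blast
  then show ?thesis unfolding fan_def using X(1) open_subspace_points[of X] openin_topspace by metis
qed

text \<open>All group laws are equations on the one stalk. With diagonal comultiplication,
  coassociativity compares two copies of \<open>((a, a), a)\<close>, the unit laws hold because the
  unit composite is constantly one, and the inverse laws are those of the group.\<close>

lemma group_fan_pointI:
  assumes X: "locally_monoidal (ufan \<X>)" "points (ufan \<X>) = {x}" "comm_group (stalk (ufan \<X>) x)"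
    and m: "gmult \<X> \<in> lm_hom (lm_prod (ufan \<X>) (ufan \<X>)) (ufan \<X>)"
    and u: "gunit \<X> \<in> lm_hom lm_one (ufan \<X>)" and i: "ginv \<X> \<in> lm_hom (ufan \<X>) (ufan \<X>)"
    and diag: "\<And>a. a \<in> carrier (stalk (ufan \<X>) x) \<Longrightarrow> st (gmult \<X>) (x, x) a = (a, a)"
    and inv: "\<And>a. a \<in> carrier (stalk (ufan \<X>) x) \<Longrightarrow> st (ginv \<X>) x a = inv\<^bsub>stalk (ufan \<X>) x\<^esub> a"
  shows "group_fan \<X>"
proof -
  let ?X = "ufan \<X>" let ?XX = "lm_prod ?X ?X" let ?XXX = "lm_prod ?XX ?X" let ?M = "stalk ?X x"
  interpret M: comm_group ?M by fact
  have one: "locally_monoidal lm_one"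
    unfolding lm_one_def by (rule comm_monoid.locally_monoidal_Spec[OF trivial_comm_monoid])
  note XX = locally_monoidal_prod[OF X(1) X(1)] note XXX = locally_monoidal_prod[OF XX X(1)]
  have xx: "points ?XX = {(x, x)}" and xxx: "points ?XXX = {((x, x), x)}" by (simp_all add: lm_prod_sel X(2))
  note mp = lm_hom_point[OF m xx X(2), unfolded lm_prod_sel fst_conv snd_conv]
  note up = lm_hom_point[OF u lm_one_sel(1) X(2)]
  note ip = lm_hom_point[OF i X(2) X(2)]
  have bang: "st (lm_bang ?X) x (st (gunit \<X>) UNIV a) = \<one>\<^bsub>?M\<^esub>" if "a \<in> carrier ?M" for a
    using mon_homD(1)[OF up(2) that] X(2) by (simp add: lm_bang_def)
  have pb: "pt (lm_bang ?X) x = UNIV" using X(2) by (simp add: lm_bang_def)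
  note homs = lm_comp_hom[OF X(1) one X(1)] lm_comp_hom[OF XXX XX X(1)] lm_comp_hom[OF X(1) XX X(1)]
    lm_pair_hom lm_fst_hom lm_snd_hom lm_bang_hom lm_id_hom X(1) XX XXX m u i
  note calc = lm_comp_def lm_pair_def lm_id_def X(2) mp(1) up(1) ip(1) pb bang copair_def diag inv
    lm_prod_sel lm_fst_def lm_snd_def inc_l_def inc_r_def
  note eqI = lm_hom_point_eqI[OF _ _ X(2) X(2)]
  have "lm_comp ?XXX ?X (gmult \<X>) (lm_pair ?XXX ?X ?X (lm_comp ?XXX ?X (gmult \<X>) (lm_fst ?XX ?X)) (lm_snd ?XX ?X)) =
    lm_comp ?XXX ?X (gmult \<X>) (lm_pair ?XXX ?X ?X (lm_comp ?XXX ?X (lm_fst ?X ?X) (lm_fst ?XX ?X))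
      (lm_comp ?XXX ?X (gmult \<X>) (lm_pair ?XXX ?X ?X (lm_comp ?XXX ?X (lm_snd ?X ?X) (lm_fst ?XX ?X)) (lm_snd ?XX ?X))))"
    by (rule lm_hom_point_eqI[OF _ _ xxx X(2)], (intro homs)+) (simp add: calc)
  moreover have "lm_comp ?X ?X (gmult \<X>) (lm_pair ?X ?X ?X (lm_comp ?X ?X (gunit \<X>) (lm_bang ?X)) (lm_id ?X)) = lm_id ?X"
    "lm_comp ?X ?X (gmult \<X>) (lm_pair ?X ?X ?X (lm_id ?X) (lm_comp ?X ?X (gunit \<X>) (lm_bang ?X))) = lm_id ?X"
    "lm_comp ?X ?X (gmult \<X>) (lm_pair ?X ?X ?X (ginv \<X>) (lm_id ?X)) = lm_comp ?X ?X (gunit \<X>) (lm_bang ?X)"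
    "lm_comp ?X ?X (gmult \<X>) (lm_pair ?X ?X ?X (lm_id ?X) (ginv \<X>)) = lm_comp ?X ?X (gunit \<X>) (lm_bang ?X)"
    by (rule eqI, (intro homs)+, simp add: calc)+
  ultimately show ?thesis
    unfolding group_fan_def Let_def using fan_point[OF X] m u i by blast
qed

section \<open>Affine and connected group fans\<close>

lemma lm_inverse_ptD:
  assumes "lm_inverse X Y f g"
  shows "x \<in> points X \<Longrightarrow> pt g (pt f x) = x" "y \<in> points Y \<Longrightarrow> pt f (pt g y) = y"
proof -
  have e: "lm_comp X X g f = lm_id X" "lm_comp Y Y f g = lm_id Y"
    using assms unfolding lm_inverse_def by auto
  show "pt g (pt f x) = x" if "x \<in> points X"
    using fun_cong[OF arg_cong[OF e(1), of pt], of x] that by (simp add: lm_comp_def lm_id_def)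
  show "pt f (pt g y) = y" if "y \<in> points Y"
    using fun_cong[OF arg_cong[OF e(2), of pt], of y] that by (simp add: lm_comp_def lm_id_def)
qed

lemma group_fan_affine_subspace:
  fixes P :: "'p monoid"
  assumes \<X>: "group_fan \<X>" and P: "comm_monoid P" and U: "openin (space_of (ufan \<X>)) U"
    and iso: "lm_isomorphic (open_subspace (ufan \<X>) U) (Spec P)"
  shows "faces P = {carrier P}" "\<exists>x. U = {x}"
proof -
  interpret P: comm_monoid P by (rule P)
  obtain f g where fg: "lm_inverse (open_subspace (ufan \<X>) U) (Spec P) f g"
    using iso unfolding lm_isomorphic_def by blast
  then have f: "f \<in> lm_hom (open_subspace (ufan \<X>) U) (Spec P)"
    and g: "g \<in> lm_hom (Spec P) (open_subspace (ufan \<X>) U)"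
    unfolding lm_inverse_def by auto
  have s: "space_of (open_subspace (ufan \<X>) U) = subtopology (space_of (ufan \<X>)) U"
    by (simp add: open_subspace_def)
  have pU: "points (open_subspace (ufan \<X>) U) = U" unfolding s using openin_subset[OF U] by auto
  note inv = lm_inverse_ptD[OF fg, unfolded pU P.Spec_sel P.topspace_Tp]
  note * = group_fan_affine_open[OF \<X> P U lm_homD(1)[OF f, unfolded s] lm_homD(1)[OF g, unfolded s] inv]
  show "faces P = {carrier P}" "\<exists>x. U = {x}" using * by blast+
qed

text \<open>The whole fan is an affine open subset. Since the face of units is then all of
  \<open>P\<close>, the monoid \<open>P\<close> is a group.\<close>

lemma affine_group_fan_point:
  fixes P :: "'p monoid"
  assumes \<X>: "group_fan \<X>" and P: "comm_monoid P" and iso: "lm_isomorphic (ufan \<X>) (Spec P)"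
  obtains x where "points (ufan \<X>) = {x}" "comm_group P"
proof -
  interpret P: comm_monoid P by (rule P)
  note * = group_fan_affine_subspace[OF \<X> P openin_topspace, unfolded open_subspace_points, OF iso]
  have "Units P = carrier P" using P.Units_face *(1) by blast
  then have "comm_group P"
    by (intro comm_group.intro group.intro group_axioms.intro P P.monoid_axioms) simp
  then show ?thesis using that *(2) by blast
qed

text \<open>Every point has an affine neighbourhood, which is a single point, so the space is
  discrete; connectedness leaves only the unit point.\<close>

lemma connected_group_fan_point:
  fixes \<X> :: "('x, 'm) gfan"
  assumes \<X>: "group_fan \<X>" and conn: "connected_space (space_of (ufan \<X>))"
  obtains x where "points (ufan \<X>) = {x}"
proof -
  let ?T = "space_of (ufan \<X>)"
  have disc: "openin ?T {x}" if x: "x \<in> topspace ?T" for x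
  proof -
    obtain U where U: "openin ?T U" "x \<in> U" "affine_fan (open_subspace (ufan \<X>) U)"
      using group_fanD(1)[OF \<X>] x unfolding fan_def by blast
    then obtain P :: "'m monoid" where P: "comm_monoid P" "lm_isomorphic (open_subspace (ufan \<X>) U) (Spec P)"
      unfolding affine_fan_def by blast
    obtain z where "U = {z}" using group_fan_affine_subspace(2)[OF \<X> P(1) U(1) P(2)] by blast
    then show ?thesis using U by simp
  qed
  let ?e = "pt (gunit \<X>) UNIV"
  have e: "?e \<in> topspace ?T" by (rule group_fan_points(1)[OF \<X>])
  \<comment> \<open>The complement of the unit point is a union of open singletons, so that point is
    both open and closed.\<close>
  have "openin ?T (\<Union>x\<in>topspace ?T - {?e}. {x})" using disc by blast
  then have "closedin ?T {?e}" using e by (simp add: closedin_def)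
  then have "topspace ?T = {?e}" using conn disc[OF e] unfolding connected_space_clopen_in by blast
  then show ?thesis by (rule that)
qed

section \<open>The functor from abelian groups to affine group fans\<close>

context
  fixes A :: "'a monoid"
  assumes A: "comm_group A"
begin

interpretation A: comm_group A by (rule A)

lemma stalk_Spec_group: "stalk (Spec A) (carrier A) = localization A (carrier A)"
  by (simp add: A.Spec_sel)

lemma ufan_GG: "ufan (GG A) = Spec A"
  by (simp add: GG_def)

lemma group_fan_GG: "group_fan (GG A)"
proof (rule group_fan_pointI)
  let ?S = "Spec A" and ?L = "localization A (carrier A)"
  have Ac: "comm_monoid A" by (rule A.comm_monoid_axioms)
  note AA = DirProd_comm_monoid[OF Ac Ac]
  note S = A.locally_monoidal_Spec
  interpret L: comm_group ?L by (rule comm_group_localization[OF A])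
  show "locally_monoidal (ufan (GG A))" unfolding ufan_GG by (rule S)
  show "points (ufan (GG A)) = {carrier A}" unfolding ufan_GG by (rule points_Spec_group[OF A])
  show "comm_group (stalk (ufan (GG A)) (carrier A))"
    unfolding ufan_GG stalk_Spec_group by (rule comm_group_localization[OF A])
  have d: "(\<lambda>a\<in>carrier A. (a, a)) \<in> mon_hom A (A \<times>\<times> A)" by (rule mon_homI) auto
  have i: "(\<lambda>a\<in>carrier A. inv\<^bsub>A\<^esub> a) \<in> mon_hom A A" by (rule mon_homI) (auto simp: A.inv_mult)
  have u: "(\<lambda>a\<in>carrier A. ()) \<in> mon_hom A trivial_monoid" by (rule mon_homI) (auto simp: trivial_monoid_def)
  \<comment> \<open>The description of \<open>Spec_prod_iso\<close> does not compute; uniqueness of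
    inverses replaces it by the explicit \<open>split_spec\<close>.\<close>
  have iso: "Spec_prod_iso A A = split_spec A A"
    by (rule lm_inverse_unique[OF Spec_prod_iso_inverse[OF Ac Ac] split_spec_inverse[OF Ac Ac]])
  show "gmult (GG A) \<in> lm_hom (lm_prod (ufan (GG A)) (ufan (GG A))) (ufan (GG A))"
    unfolding GG_def iso gfan.simps
    by (rule lm_comp_hom[OF locally_monoidal_prod[OF S S] comm_monoid.locally_monoidal_Spec[OF AA] S
          split_spec_hom[OF Ac Ac] Spec_map_hom[OF AA Ac d]])
  show "gunit (GG A) \<in> lm_hom lm_one (ufan (GG A))"
    unfolding GG_def lm_one_def gfan.simps by (rule Spec_map_hom[OF trivial_comm_monoid Ac u])
  show "ginv (GG A) \<in> lm_hom (ufan (GG A)) (ufan (GG A))"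
    unfolding GG_def gfan.simps by (rule Spec_map_hom[OF Ac Ac i])
  fix B assume B: "B \<in> carrier (stalk (ufan (GG A)) (carrier A))"
  then obtain b where b: "b \<in> carrier A" "B = loc_frac A (carrier A) b \<one>\<^bsub>A\<^esub>"
    unfolding ufan_GG stalk_Spec_group by (rule localization_group_cases[OF A])
  note cf = carrier_face[OF A]
  \<comment> \<open>The preimage of the only face is the only face, which lets
    \<open>Spec_map_frac\<close> be applied at the face \<open>carrier A\<close>.\<close>
  have pre: "{q \<in> carrier A. (\<lambda>a\<in>carrier A. (a, a)) q \<in> carrier A \<times> carrier A} = carrier A" by auto
  have "st (gmult (GG A)) (carrier A, carrier A) B =
      st (split_spec A A) (carrier A, carrier A)
        (st (Spec_map A (A \<times>\<times> A) (\<lambda>a\<in>carrier A. (a, a))) (carrier A \<times> carrier A) B)"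
    using B unfolding ufan_GG
    by (simp add: GG_def iso lm_comp_def lm_prod_sel points_Spec_group[OF A] split_pt[OF Ac Ac cf cf]
        Spec_map_sel[OF face_Times[OF Ac Ac cf cf]] pre)
  also have "\<dots> = st (split_spec A A) (carrier A, carrier A)
        (loc_frac (A \<times>\<times> A) (carrier A \<times> carrier A) (b, b) (\<one>\<^bsub>A\<^esub>, \<one>\<^bsub>A\<^esub>))"
    using Spec_map_frac[OF AA Ac d face_Times[OF Ac Ac cf cf] b(1), of "\<one>\<^bsub>A\<^esub>"] b(1)
    unfolding pre b(2) by simp
  also have "\<dots> = (B, B)"
    unfolding b(2) by (rule split_spec_frac[OF Ac Ac cf cf]) (use b(1) in simp_all)
  finally show "st (gmult (GG A)) (carrier A, carrier A) B = (B, B)" .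
  have pre: "{q \<in> carrier A. (\<lambda>a\<in>carrier A. inv\<^bsub>A\<^esub> a) q \<in> carrier A} = carrier A" by auto
  have "st (ginv (GG A)) (carrier A) B = loc_frac A (carrier A) (inv\<^bsub>A\<^esub> b) \<one>\<^bsub>A\<^esub>"
    using Spec_map_frac[OF Ac Ac i cf b(1), of "\<one>\<^bsub>A\<^esub>"] b(1) unfolding pre b(2) by (simp add: GG_def)
  moreover have "loc_frac A (carrier A) (inv\<^bsub>A\<^esub> b) \<one>\<^bsub>A\<^esub> = inv\<^bsub>?L\<^esub> B"
  proof (rule L.inv_equality[symmetric])
    show "loc_frac A (carrier A) (inv\<^bsub>A\<^esub> b) \<one>\<^bsub>A\<^esub> \<otimes>\<^bsub>?L\<^esub> B = \<one>\<^bsub>?L\<^esub>"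
      using b by (simp add: A.frac_mult[OF cf] A.localization_one)
  qed (use b A.frac_in_carrier in simp_all)
  ultimately show "st (ginv (GG A)) (carrier A) B = inv\<^bsub>stalk (ufan (GG A)) (carrier A)\<^esub> B"
    unfolding ufan_GG stalk_Spec_group by simp
qed

end

text \<open>An isomorphism of the underlying one-point spaces respects multiplication automatically,
  by \<open>gfan_hom_point\<close>.\<close>

lemma gfan_isomorphic_GG_stalk:
  assumes \<X>: "group_fan \<X>" and x: "points (ufan \<X>) = {x}"
  shows "gfan_isomorphic \<X> (GG (stalk (ufan \<X>) x))"
proof -
  let ?A = "stalk (ufan \<X>) x"
  have A: "comm_group ?A" by (rule gfan_point(2)[OF \<X> x])
  have p: "points (ufan (GG ?A)) = {carrier ?A}" unfolding ufan_GG[OF A] by (rule points_Spec_group[OF A])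
  note h = gfan_hom_point[OF \<X> x group_fan_GG[OF A] p] gfan_hom_point[OF group_fan_GG[OF A] p \<X> x]
  obtain f g where fg: "lm_inverse (ufan \<X>) (Spec ?A) f g"
    using lm_isomorphic_Spec_stalk[OF group_fanD(2)[OF \<X>] x A] unfolding lm_isomorphic_def by blast
  then show ?thesis
    unfolding gfan_isomorphic_def h unfolding ufan_GG[OF A] lm_inverse_def by blast
qed

section \<open>The categories of abelian groups and of affine group fans\<close>

lemma Ab_sel:
  "Ob Ab = {A. comm_group A}" "Id Ab = mon_id" "Comp Ab X Y Z g f = compose (carrier X) g f"
  by (simp_all add: Ab_def)

text \<open>The extra demand of \<open>mon_hom\<close>, preservation of one, is automatic between
  groups.\<close>

lemma Hom_Ab: "comm_group A \<Longrightarrow> comm_group B \<Longrightarrow> Hom Ab A B = mon_hom A B"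
  unfolding Ab_def mon_hom_def
  using hom_one[OF _ comm_group.axioms(2) comm_group.axioms(2)] by auto

lemma compose_mon_hom:
  assumes "comm_group P" "h \<in> mon_hom P Q" "k \<in> mon_hom Q R"
  shows "compose (carrier P) k h \<in> mon_hom P R"
proof -
  interpret comm_group P by fact
  show ?thesis
    by (rule mon_homI) (simp_all add: compose_def mon_homD[OF assms(2)] mon_homD[OF assms(3)])
qed

lemma is_category_Ab: "is_category (Ab :: ('a monoid, 'a \<Rightarrow> 'a) category)"
proof -
  have "mon_id A \<in> mon_hom A A" if "comm_group A" for A :: "'a monoid"
  proof -
    interpret comm_group A by (rule that)
    show ?thesis unfolding mon_id_def by (rule mon_homI) simp_all
  qed
  moreover have "compose (carrier A) (mon_id B) f = f" "compose (carrier A) f (mon_id A) = f"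
    if "f \<in> mon_hom A B" for A B :: "'a monoid" and f
    using mon_homD[OF that] 
    by (auto simp: compose_def mon_id_def fun_eq_iff extensional_def)
  moreover have "compose (carrier A) (compose (carrier B) h g) f = compose (carrier A) h (compose (carrier A) g f)"
    if "f \<in> mon_hom A B" for A B :: "'a monoid" and f and g h :: "'a \<Rightarrow> 'a"
    using mon_homD(1)[OF that] by (auto simp: compose_def fun_eq_iff)
  ultimately show ?thesis
    unfolding is_category_def Ab_sel by (auto simp: Hom_Ab intro: compose_mon_hom)
qed

lemma AffGrpFan_point:
  fixes \<X> :: "('a set, ('a \<times> 'a) set) gfan"
  assumes "\<X> \<in> Ob AffGrpFan"
  obtains x where "group_fan \<X>" "points (ufan \<X>) = {x}"
proof -
  obtain P :: "'a monoid" where "group_fan \<X>" "comm_monoid P" "lm_isomorphic (ufan \<X>) (Spec P)"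
    using assms unfolding AffGrpFan_def by auto
  then obtain x where "points (ufan \<X>) = {x}" by (rule affine_group_fan_point)
  then show ?thesis using that \<open>group_fan \<X>\<close> by blast
qed

text \<open>Affine group fans have one point, so they form a full subcategory of locally monoidal
  spaces; the category laws are inherited from there.\<close>

lemma Hom_AffGrpFan:
  assumes "\<X> \<in> Ob AffGrpFan" "\<Y> \<in> Ob AffGrpFan"
  shows "Hom AffGrpFan \<X> \<Y> = lm_hom (ufan \<X>) (ufan \<Y>)"
proof -
  obtain x where x: "group_fan \<X>" "points (ufan \<X>) = {x}" using assms(1) by (rule AffGrpFan_point)
  obtain y where y: "group_fan \<Y>" "points (ufan \<Y>) = {y}" using assms(2) by (rule AffGrpFan_point)
  show ?thesis using gfan_hom_point[OF x y] by (simp add: AffGrpFan_def)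
qed

lemma AffGrpFan_sel:
  "Id AffGrpFan \<X> = lm_id (ufan \<X>)"
  "Comp AffGrpFan \<X> \<Y> \<Z> g f = lm_comp (ufan \<X>) (ufan \<Z>) g f"
  by (simp_all add: AffGrpFan_def)

lemma is_category_AffGrpFan: "is_category AffGrpFan"
proof -
  have lm: "locally_monoidal (ufan \<X>)" if "\<X> \<in> Ob AffGrpFan" for \<X> :: "('a set, ('a \<times> 'a) set) gfan"
    using that by (rule AffGrpFan_point) (rule group_fanD(2))
  show ?thesis
    unfolding is_category_def AffGrpFan_sel
    by (intro conjI ballI)
      (simp_all add: Hom_AffGrpFan lm_id_hom lm lm_comp_hom[OF lm lm lm] lm_comp_id lm_comp_assoc)
qed

lemma GG_Ob: "comm_group A \<Longrightarrow> GG A \<in> Ob AffGrpFan"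
proof -
  assume A: "comm_group A"
  interpret comm_group A by (rule A)
  have "lm_isomorphic (Spec A) (Spec A)"
    unfolding lm_isomorphic_def lm_inverse_def
    using lm_id_hom[OF locally_monoidal_Spec] lm_comp_id(1)[OF lm_id_hom[OF locally_monoidal_Spec]] by blast
  then show "GG A \<in> Ob AffGrpFan"
    using group_fan_GG[OF A] comm_monoid_axioms by (auto simp: AffGrpFan_def ufan_GG[OF A])
qed

section \<open>The functor on morphisms: faithfulness, fullness and functoriality\<close>

lemma Spec_map_group:
  fixes A B :: "'a monoid"
  assumes A: "comm_group A" and B: "comm_group B" and h: "h \<in> mon_hom B A"
  shows "Spec_map B A h \<in> lm_hom (Spec A) (Spec B)"
    and "b \<in> carrier B \<Longrightarrow>
      st (Spec_map B A h) (carrier A) (loc_frac B (carrier B) b \<one>\<^bsub>B\<^esub>) = loc_frac A (carrier A) (h b) \<one>\<^bsub>A\<^esub>"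
proof -
  interpret A: comm_group A by (rule A)
  interpret B: comm_group B by (rule B)
  show "Spec_map B A h \<in> lm_hom (Spec A) (Spec B)"
    by (rule Spec_map_hom[OF A.comm_monoid_axioms B.comm_monoid_axioms h])
  have "{q \<in> carrier B. h q \<in> carrier A} = carrier B" using mon_homD(1)[OF h] by blast
  then show "st (Spec_map B A h) (carrier A) (loc_frac B (carrier B) b \<one>\<^bsub>B\<^esub>) = loc_frac A (carrier A) (h b) \<one>\<^bsub>A\<^esub>"
    if "b \<in> carrier B"
    using Spec_map_frac[OF A.comm_monoid_axioms B.comm_monoid_axioms h carrier_face[OF A] that, of "\<one>\<^bsub>B\<^esub>"]
    by (simp add: mon_homD(3)[OF h])
qed

text \<open>Every element of the stalk is a fraction with denominator one, so equality need only be
  tested on these.\<close>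

lemma lm_hom_Spec_eqI:
  fixes A B :: "'a monoid"
  assumes A: "comm_group A" and B: "comm_group B"
    and f: "f \<in> lm_hom (Spec A) (Spec B)" and g: "g \<in> lm_hom (Spec A) (Spec B)"
    and eq: "\<And>b. b \<in> carrier B \<Longrightarrow>
      st f (carrier A) (loc_frac B (carrier B) b \<one>\<^bsub>B\<^esub>) = st g (carrier A) (loc_frac B (carrier B) b \<one>\<^bsub>B\<^esub>)"
  shows "f = g"
  by (rule lm_hom_point_eqI[OF f g points_Spec_group[OF A] points_Spec_group[OF B]])
    (use eq in \<open>auto simp: stalk_Spec_group[OF B] elim: localization_group_cases[OF B]\<close>)

text \<open>The stalk map of \<open>Spec_map\<close> sends \<open>b\<close> over one to
  \<open>h b\<close> over one, and passing to such fractions is injective.\<close>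

lemma Spec_map_faithful:
  fixes A B :: "'a monoid"
  assumes A: "comm_group A" and B: "comm_group B" and h: "h \<in> mon_hom B A" and k: "k \<in> mon_hom B A"
    and eq: "Spec_map B A h = Spec_map B A k"
  shows "h = k"
proof (rule extensionalityI[OF mon_homD(4)[OF h] mon_homD(4)[OF k]])
  fix b assume b: "b \<in> carrier B"
  show "h b = k b"
    using Spec_map_group(2)[OF A B h b] Spec_map_group(2)[OF A B k b]
      loc_inc_eq_iff[OF A mon_homD(1)[OF h b] mon_homD(1)[OF k b]] eq by simp
qed

lemma Spec_map_full:
  fixes A B :: "'a monoid"
  assumes A: "comm_group A" and B: "comm_group B" and f: "f \<in> lm_hom (Spec A) (Spec B)"
  obtains h where "h \<in> mon_hom B A" "Spec_map B A h = f"
proof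
  interpret A: comm_group A by (rule A)
  interpret B: comm_group B by (rule B)
  \<comment> \<open>The stalk map of \<open>f\<close>, transported along the isomorphisms of
    \<open>A\<close> and \<open>B\<close> with their localizations.\<close>
  define h where "h = compose (carrier B) (loc_ret A) (compose (carrier B) (st f (carrier A)) (loc_inc B))"
  have f': "st f (carrier A) \<in> mon_hom (localization B (carrier B)) (localization A (carrier A))"
    using lm_hom_point(2)[OF f points_Spec_group[OF A] points_Spec_group[OF B]]
    by (simp add: stalk_Spec_group[OF A] stalk_Spec_group[OF B])
  show h: "h \<in> mon_hom B A"
    unfolding h_def by (rule compose_mon_hom[OF B compose_mon_hom[OF B loc_inc_hom[OF B] f'] loc_ret_hom[OF A]])
  show "Spec_map B A h = f"
  proof (rule lm_hom_Spec_eqI[OF A B Spec_map_group(1)[OF A B h] f])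
    fix b assume b: "b \<in> carrier B"
    let ?b = "loc_frac B (carrier B) b \<one>\<^bsub>B\<^esub>"
    have "?b \<in> carrier (localization B (carrier B))" using B.frac_in_carrier[OF b, of "\<one>\<^bsub>B\<^esub>"] by simp
    then have fb: "st f (carrier A) ?b \<in> carrier (localization A (carrier A))" by (rule mon_homD(1)[OF f'])
    have "loc_frac A (carrier A) (h b) \<one>\<^bsub>A\<^esub> = loc_inc A (loc_ret A (st f (carrier A) ?b))"
      using b mon_homD(1)[OF loc_ret_hom[OF A] fb] fb by (simp add: h_def compose_def)
    then show "st (Spec_map B A h) (carrier A) ?b = st f (carrier A) ?b"
      unfolding Spec_map_group(2)[OF A B h b] loc_inc_loc_ret[OF A fb] .
  qed
qed

lemma opposite_sel:
  "Ob (opposite C) = Ob C" "Hom (opposite C) X Y = Hom C Y X"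
  "Id (opposite C) = Id C" "Comp (opposite C) X Y Z g f = Comp C Z Y X f g"
  by (simp_all add: opposite_def)

lemma GG_functor_sel: "FOb GG_functor = GG" "FArr GG_functor A B h = Spec_map B A h"
  by (simp_all add: GG_functor_def)

lemma is_functor_GG:
  "is_functor (opposite (Ab :: ('a monoid, 'a \<Rightarrow> 'a) category)) AffGrpFan GG_functor"
  unfolding is_functor_def GG_functor_sel opposite_sel
proof (intro conjI ballI)
  show "is_category (opposite Ab)" by (rule is_category_opposite[OF is_category_Ab])
  show "is_category AffGrpFan" by (rule is_category_AffGrpFan)
next
  fix A :: "'a monoid" assume "A \<in> Ob Ab"
  then have A: "comm_group A" by (simp add: Ab_sel)
  interpret A: comm_group A by (rule A)
  show "GG A \<in> Ob AffGrpFan" by (rule GG_Ob[OF A])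
  have id: "mon_id A \<in> mon_hom A A"
    using is_categoryD(1)[OF is_category_Ab, of A] Hom_Ab[OF A A] A by (simp add: Ab_sel)
  have "Spec_map A A (mon_id A) = lm_id (Spec A)"
  proof (rule lm_hom_Spec_eqI[OF A A Spec_map_group(1)[OF A A id] lm_id_hom[OF A.locally_monoidal_Spec]])
    fix a assume a: "a \<in> carrier A"
    show "st (Spec_map A A (mon_id A)) (carrier A) (loc_frac A (carrier A) a \<one>\<^bsub>A\<^esub>) =
        st (lm_id (Spec A)) (carrier A) (loc_frac A (carrier A) a \<one>\<^bsub>A\<^esub>)"
      using a A.frac_in_carrier[OF a, of "\<one>\<^bsub>A\<^esub>" "carrier A"]
      unfolding Spec_map_group(2)[OF A A id a]
      by (simp add: lm_id_def points_Spec_group[OF A] stalk_Spec_group[OF A] mon_id_def)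
  qed
  then show "Spec_map A A (Id Ab A) = Id AffGrpFan (GG A)"
    by (simp add: Ab_sel AffGrpFan_sel ufan_GG[OF A])
next
  fix A B :: "'a monoid" and h assume a: "A \<in> Ob Ab" "B \<in> Ob Ab" and h: "h \<in> Hom Ab B A"
  have A: "comm_group A" and B: "comm_group B" using a by (simp_all add: Ab_sel)
  show "Spec_map B A h \<in> Hom AffGrpFan (GG A) (GG B)"
    using Spec_map_group(1)[OF A B] h
    by (simp add: Hom_Ab[OF B A] Hom_AffGrpFan[OF GG_Ob[OF A] GG_Ob[OF B]] ufan_GG[OF A] ufan_GG[OF B])
next
  fix A B C :: "'a monoid" and h k
  assume a: "A \<in> Ob Ab" "B \<in> Ob Ab" "C \<in> Ob Ab" and hom: "h \<in> Hom Ab B A" "k \<in> Hom Ab C B"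
  have A: "comm_group A" and B: "comm_group B" and C: "comm_group C" using a by (simp_all add: Ab_sel)
  interpret A: comm_group A by (rule A)
  interpret B: comm_group B by (rule B)
  interpret C: comm_group C by (rule C)
  have h: "h \<in> mon_hom B A" and k: "k \<in> mon_hom C B"
    using hom Hom_Ab[OF B A] Hom_Ab[OF C B] by auto
  note hk = compose_mon_hom[OF C k h]
  note f = Spec_map_group(1)[OF A B h] and g = Spec_map_group(1)[OF B C k]
  have "Spec_map C A (compose (carrier C) h k) = lm_comp (Spec A) (Spec C) (Spec_map C B k) (Spec_map B A h)"
  proof (rule lm_hom_Spec_eqI[OF A C Spec_map_group(1)[OF A C hk]])
    show "lm_comp (Spec A) (Spec C) (Spec_map C B k) (Spec_map B A h) \<in> lm_hom (Spec A) (Spec C)"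
      by (rule lm_comp_hom[OF A.locally_monoidal_Spec B.locally_monoidal_Spec C.locally_monoidal_Spec f g])
    fix c assume c: "c \<in> carrier C"
    note kc = mon_homD(1)[OF k c]
    have p: "pt (Spec_map B A h) (carrier A) = carrier B" "pt (Spec_map C B k) (carrier B) = carrier C"
      using lm_hom_point(1)[OF f points_Spec_group[OF A] points_Spec_group[OF B]]
        lm_hom_point(1)[OF g points_Spec_group[OF B] points_Spec_group[OF C]] .
    show "st (Spec_map C A (compose (carrier C) h k)) (carrier A) (loc_frac C (carrier C) c \<one>\<^bsub>C\<^esub>) =
        st (lm_comp (Spec A) (Spec C) (Spec_map C B k) (Spec_map B A h)) (carrier A) (loc_frac C (carrier C) c \<one>\<^bsub>C\<^esub>)"
      unfolding Spec_map_group(2)[OF A C hk c]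
      using c C.frac_in_carrier[OF c, of "\<one>\<^bsub>C\<^esub>" "carrier C"]
      by (simp add: lm_comp_def p points_Spec_group[OF A] stalk_Spec_group[OF C]
          Spec_map_group(2)[OF B C k c] Spec_map_group(2)[OF A B h kc] compose_def)
  qed
  then show "Spec_map C A (Comp Ab C B A h k) =
      Comp AffGrpFan (GG A) (GG B) (GG C) (Spec_map C B k) (Spec_map B A h)"
    by (simp add: Ab_sel AffGrpFan_sel ufan_GG[OF A] ufan_GG[OF C])
qed

theorem is_equivalence_GG:
  "is_equivalence (opposite (Ab :: ('a monoid, 'a \<Rightarrow> 'a) category)) AffGrpFan GG_functor"
proof (rule is_equivalenceI[OF is_functor_GG], unfold opposite_sel GG_functor_sel)
  fix A B :: "'a monoid" assume "A \<in> Ob Ab" "B \<in> Ob Ab"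
  then have A: "comm_group A" and B: "comm_group B" by (simp_all add: Ab_sel)
  show "h = k" if "h \<in> Hom Ab B A" "k \<in> Hom Ab B A" "Spec_map B A h = Spec_map B A k" for h k
    using Spec_map_faithful[OF A B] that unfolding Hom_Ab[OF B A] by blast
  show "\<exists>h\<in>Hom Ab B A. Spec_map B A h = f" if "f \<in> Hom AffGrpFan (GG A) (GG B)" for f
    using that Spec_map_full[OF A B, of f]
    unfolding Hom_Ab[OF B A] Hom_AffGrpFan[OF GG_Ob[OF A] GG_Ob[OF B]] ufan_GG[OF A] ufan_GG[OF B] by blast
next
  fix \<Y> :: "('a set, ('a \<times> 'a) set) gfan" assume Y: "\<Y> \<in> Ob AffGrpFan"
  then obtain P :: "'a monoid" where \<Y>: "group_fan \<Y>" and P: "comm_monoid P" "lm_isomorphic (ufan \<Y>) (Spec P)"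
    unfolding AffGrpFan_def by auto
  \<comment> \<open>The stalk of \<open>\<Y>\<close> lives on a larger type, so the preimage is
    taken to be \<open>P\<close>, which \<open>AffGrpFan\<close> places on the type
    \<open>'a\<close> of the objects of \<open>Ab\<close>. The inverse \<open>g\<close> of the given
    isomorphism is then an isomorphism of group fans.\<close>
  have A: "comm_group P" using affine_group_fan_point[OF \<Y> P] by blast
  obtain f g where fg: "lm_inverse (ufan \<Y>) (Spec P) f g" using P(2) unfolding lm_isomorphic_def by blast
  have "is_iso AffGrpFan (GG P) \<Y> g"
    using fg unfolding is_iso_def AffGrpFan_sel Hom_AffGrpFan[OF Y GG_Ob[OF A]] Hom_AffGrpFan[OF GG_Ob[OF A] Y]
      ufan_GG[OF A] lm_inverse_def by blast
  then show "\<exists>A\<in>Ob Ab. \<exists>f. is_iso AffGrpFan (GG A) \<Y> f" using A by (auto simp: Ab_sel)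
qed

theorem lemma2p8p1:
  shows "(\<forall>(P :: 'a monoid) \<delta> \<epsilon> \<iota>. mon_op_group_object P \<delta> \<epsilon> \<iota> \<longrightarrow>
            comm_group P \<and> \<delta> = (\<lambda>g\<in>carrier P. (g, g)) \<and> \<iota> = (\<lambda>g\<in>carrier P. inv\<^bsub>P\<^esub> g)) \<and>
         is_equivalence (opposite (Ab :: ('a monoid, 'a \<Rightarrow> 'a) category)) AffGrpFan GG_functor \<and>
         (\<forall>\<X> :: ('x, 'm) gfan. group_fan \<X> \<and> affine_fan (ufan \<X>) \<longrightarrow>
            (\<exists>A :: 'm monoid. comm_group A \<and> gfan_isomorphic \<X> (GG A))) \<and>
         (\<forall>\<X> :: ('x, 'm) gfan. group_fan \<X> \<and> connected_space (space_of (ufan \<X>)) \<longrightarrow>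
            (\<exists>A :: 'm monoid. comm_group A \<and> gfan_isomorphic \<X> (GG A)))"
proof (intro conjI)
  \<comment> \<open>Affine and connected group fans both reduce to the case of one point, where the
    group is the stalk and therefore lives on \<open>'m\<close>.\<close>
  have GG: "\<exists>A :: 'm monoid. comm_group A \<and> gfan_isomorphic \<X> (GG A)"
    if "group_fan \<X>" "points (ufan \<X>) = {x}" for \<X> :: "('x, 'm) gfan" and x
    using gfan_point(2)[OF that] gfan_isomorphic_GG_stalk[OF that] by blast
  show "\<forall>\<X> :: ('x, 'm) gfan. group_fan \<X> \<and> affine_fan (ufan \<X>) \<longrightarrow>
      (\<exists>A :: 'm monoid. comm_group A \<and> gfan_isomorphic \<X> (GG A))"
    unfolding affine_fan_def using affine_group_fan_point GG by blast
  show "\<forall>\<X> :: ('x, 'm) gfan. group_fan \<X> \<and> connected_space (space_of (ufan \<X>)) \<longrightarrow>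
      (\<exists>A :: 'm monoid. comm_group A \<and> gfan_isomorphic \<X> (GG A))"
    using connected_group_fan_point GG by blast
qed (use mon_op_group_objectD is_equivalence_GG in blast)+

end
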